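(* There is a constant $C$ such that the following holds for all $t>0$. If $w\in C^5$ and $\square w=F$ in $[0,t]\times\mathbb R^3$, and the Cauchy data of $w$ vanishes at time $0$, then for all $x\in\mathbb R^3$ $$(1+t)\,|w(t,x)|\le C\int_0^t\int_{\mathbb R^3}\ \sum_{|\alpha|+j\le 3,\ j\le 1}|L^jZ^\alpha F(s,y)|\,\frac{dy\,ds}{|y|}.$$
   Context: $\square=\partial_t^2-\Delta$ is the scalar unit-speed D'Alembertian on $\mathbb R_+\times\mathbb R^3$. $\Omega_{ij}=x_i\partial_j-x_j\partial_i$, $1\le i<j\le3$; $Z$ denotes any vector field in the collection $\{\partial_t,\partial_1,\partial_2,\partial_3,\Omega_{12},\Omega_{13},\Omega_{23}\}$, and $Z^\alpha$, $\alpha$ a multi-index, denotes the corresponding product of $|\alpha|$ of these vector fields (in a fixed order). $L=t\partial_t+x\cdot\nabla_x$ is the scaling vector field. *)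

theory Defs
  imports "HOL-Analysis.Analysis"
begin

type_synonym spacetime = "real \<times> (real^3)"

definition strip :: "real \<Rightarrow> spacetime set" where
  "strip t = {0..t} \<times> UNIV"

text \<open>
  On a set \<open>S\<close> that is not open, \<open>C\<^sup>k\<close> means that all derivatives relative to \<open>S\<close> up to order
  \<open>k\<close> exist and are continuous on \<open>S\<close>. On a strip with \<open>t > 0\<close> derivatives relative to the strip
  are unique: they are the usual ones in the interior and one-sided in time at times \<open>0\<close> and \<open>t\<close>.
\<close>

primrec Ck_on :: "nat \<Rightarrow> 'a::euclidean_space set \<Rightarrow> ('a \<Rightarrow> 'b::real_normed_vector) \<Rightarrow> bool" where
  "Ck_on 0 S f \<longleftrightarrow> continuous_on S f"
| "Ck_on (Suc k) S f \<longleftrightarrow> f differentiable_on S \<and>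
     (\<forall>v. Ck_on k S (\<lambda>p. frechet_derivative f (at p within S) v))"

text \<open>A vector field is given by its coefficient vector at each point; this is its action on functions.\<close>

definition vf_deriv ::
  "spacetime set \<Rightarrow> (spacetime \<Rightarrow> spacetime) \<Rightarrow> (spacetime \<Rightarrow> real) \<Rightarrow> spacetime \<Rightarrow> real" where
  "vf_deriv S X f p = frechet_derivative f (at p within S) (X p)"

definition D_t :: "spacetime \<Rightarrow> spacetime" where
  "D_t = (\<lambda>(s, y). (1, 0))"

definition D_x :: "3 \<Rightarrow> spacetime \<Rightarrow> spacetime" where
  "D_x i = (\<lambda>(s, y). (0, axis i 1))"

definition Omega :: "3 \<Rightarrow> 3 \<Rightarrow> spacetime \<Rightarrow> spacetime" where
  "Omega i j = (\<lambda>(s, y). (0, (y $ i) *\<^sub>R axis j 1 - (y $ j) *\<^sub>R axis i 1))"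

definition L_scal :: "spacetime \<Rightarrow> spacetime" where
  "L_scal = (\<lambda>(s, y). (s, y))"

definition box_op :: "spacetime set \<Rightarrow> (spacetime \<Rightarrow> real) \<Rightarrow> spacetime \<Rightarrow> real" where
  "box_op S w p = vf_deriv S D_t (vf_deriv S D_t w) p
     - (\<Sum>i\<in>UNIV. vf_deriv S (D_x i) (vf_deriv S (D_x i) w) p)"

definition Z_fields :: "(spacetime \<Rightarrow> spacetime) list" where
  "Z_fields = [D_t, D_x 1, D_x 2, D_x 3, Omega 1 2, Omega 1 3, Omega 2 3]"

text \<open>
  A multi-index is a list of seven exponents, one for each entry of \<open>Z_fields\<close>. The fixed order of
  the product is the order of that list, so the last field acts first.
\<close>

definition Z_pow :: "spacetime set \<Rightarrow> nat list \<Rightarrow> (spacetime \<Rightarrow> real) \<Rightarrow> spacetime \<Rightarrow> real" where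
  "Z_pow S \<alpha> = foldr (\<lambda>(X, k). vf_deriv S X ^^ k) (zip Z_fields \<alpha>)"

definition LZ_indices :: "(nat \<times> nat list) set" where
  "LZ_indices = {(j, \<alpha>). length \<alpha> = length Z_fields \<and> sum_list \<alpha> + j \<le> 3 \<and> j \<le> 1}"

lemma finite_LZ_indices: "finite LZ_indices"
proof (rule finite_subset)
  show "LZ_indices \<subseteq> {..1} \<times> {\<alpha>. set \<alpha> \<subseteq> {..3} \<and> length \<alpha> = length Z_fields}"
    unfolding LZ_indices_def using member_le_sum_list by fastforce
  show "finite ({..1::nat} \<times> {\<alpha>. set \<alpha> \<subseteq> {..3::nat} \<and> length \<alpha> = length Z_fields})"
    by (intro finite_cartesian_product finite_lists_length_eq) auto
qed

end

theory Submission
  imports Defs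
begin

text \<open>
  Kirchhoff's formula writes $4\pi w(t,x)$ as the integral of $\tau F(t-\tau, x+\tau\omega)$ over
  $0<\tau<t$ and the unit sphere. Its kernel is positive, so $|F(s,y)|$ may be replaced by any
  majorant $H(s,|y|)$ that is radial in $y$. The Sobolev inequality on the sphere supplies one: $H$
  is a sum of integrals of $|\Omega^\alpha F|$, $|\alpha|\le 2$, over spheres about the origin. For a
  radial source the sphere about $x$ can be integrated out (its height function is uniformly
  distributed), which leaves, with $r=|x|$,
  \[ 2\,|w(t,x)| \le \frac1r \int_0^t \int_{|r-(t-s)|}^{r+(t-s)} H(s,v)\,v\,dv\,ds . \]
  By polar coordinates the integral of $H(s,v)\,v$ over all $v>0$ is bounded by that of the
  $|\Omega^\alpha F|$ against $dy/|y|$, so what remains is to trade the factor $1/r$ for $C/(1+t)$.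

  If $r \ge \max(1,t)/2$ this is immediate. If $t<1$ and $r<1/2$, the inner interval has
  length at most $2r$, and $v\,|G(s,v\theta)|$ is bounded by the integral of
  $(|G|+|\nabla G|)\,v'$ over $[v,v+1]$. If $t\ge 1$ and $r<t/2$, the coordinate $u=s+v$ ranges over
  $[t-r,t+r]$ only, an interval of length $2r$ away from $0$; the integral over a segment $s+v=u$ is
  estimated by averaging over the dilates of the segment by factors in $[1/2,1]$, which costs one
  field $L$ and gains $1/u\le 2/t$. Each regime thus uses at most two rotations and one more field,
  three in all, with at most one $L$.

  The main steps are \<open>kirchhoff_formula\<close>, \<open>sphere_sobolev\<close>, \<open>nn_integral_sphere_radial\<close>,
  \<open>radial_wave_decay\<close> and \<open>nn_integral_polar_weight_le\<close>. The point $x=0$ follows by continuity.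
\<close>

section \<open>Calculus relative to a strip\<close>

lemma frechet_derivative_within_cong:
  assumes "p \<in> S" "\<And>q. q \<in> S \<Longrightarrow> f q = g q"
  shows "frechet_derivative f (at p within S) = frechet_derivative g (at p within S)"
proof -
  have "(f has_derivative D) (at p within S) \<longleftrightarrow> (g has_derivative D) (at p within S)" for D
    using has_derivative_transform[of p S f g D] has_derivative_transform[of p S g f D] assms
    by metis
  then show ?thesis unfolding frechet_derivative_def by simp
qed

text \<open>
  The time derivatives at the two faces of the strip are one-sided, but a strip of positive height
  contains a short segment in every coordinate direction, which determines the derivative.
\<close>

lemma frechet_derivative_strip_eq:
  assumes "t > 0" "p \<in> strip t" "(f has_derivative D) (at p within strip t)"
  shows "frechet_derivative f (at p within strip t) = D"
proof -
  have "(f has_derivative frechet_derivative f (at p within strip t)) (at p within strip t)"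
    using assms(3) by (meson differentiableI frechet_derivative_works)
  then show ?thesis
  proof (rule frechet_derivative_unique_within[OF _ assms(3)])
    fix i :: spacetime and e :: real assume i: "i \<in> Basis" and e: "e > 0"
    obtain s y where p: "p = (s, y)" "0 \<le> s" "s \<le> t"
      using assms(2) by (auto simp: strip_def)
    \<comment> \<open>step inwards from the nearer face\<close>
    define d where "d = min (e / 2) (t / 2)"
    have d: "0 < d" "d < e" "d \<le> t / 2" using e assms(1) by (auto simp: d_def)
    consider "i = (1, 0)" | z where "i = (0, z)" using i by (auto simp: Basis_prod_def)
    then show "\<exists>d. 0 < \<bar>d\<bar> \<and> \<bar>d\<bar> < e \<and> p + d *\<^sub>R i \<in> strip t"
    proof cases
      case 1
      show ?thesis
        by (rule exI[of _ "if s \<le> t / 2 then d else - d"])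
          (use d p 1 in \<open>auto simp: strip_def\<close>)
    next
      case 2
      then show ?thesis by (intro exI[of _ d]) (use d p in \<open>auto simp: strip_def\<close>)
    qed
  qed
qed

lemma differentiable_on_has_frechet_derivative:
  assumes "f differentiable_on S" "p \<in> S"
  shows "(f has_derivative frechet_derivative f (at p within S)) (at p within S)"
  using assms by (simp add: differentiable_on_def frechet_derivative_works)

lemma Ck_on_cong:
  assumes "\<And>p. p \<in> S \<Longrightarrow> f p = g p"
  shows "Ck_on k S f \<longleftrightarrow> Ck_on k S g"
  using assms
proof (induction k arbitrary: f g)
  case 0
  then show ?case by (simp cong: continuous_on_cong)
next
  case (Suc k)
  have "f differentiable_on S \<longleftrightarrow> g differentiable_on S"
    unfolding differentiable_on_def
    using Suc.prems differentiable_transform_within[of f _ S 1 g]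
      differentiable_transform_within[of g _ S 1 f] by (metis zero_less_one)
  moreover have "Ck_on k S (\<lambda>p. frechet_derivative f (at p within S) v) \<longleftrightarrow>
      Ck_on k S (\<lambda>p. frechet_derivative g (at p within S) v)" for v
    using Suc.prems by (intro Suc.IH) (simp cong: frechet_derivative_within_cong)
  ultimately show ?case by simp
qed

lemma Ck_on_SucD: "Ck_on (Suc k) S f \<Longrightarrow> Ck_on k S f"
  by (induction k arbitrary: f) (auto simp: differentiable_imp_continuous_on)

lemma Ck_on_le: "Ck_on m S f \<Longrightarrow> n \<le> m \<Longrightarrow> Ck_on n S f"
  by (induction m arbitrary: n) (metis Ck_on_SucD le_Suc_eq le_zero_eq)+

lemma Ck_on_imp_continuous: "Ck_on k S f \<Longrightarrow> continuous_on S f"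
  using Ck_on_le[of k S f 0] by simp

text \<open>
  The form in which closure properties of \<open>C\<^sup>k\<close> are proved: any explicit formula for the derivative
  may replace the Frechet derivative chosen by the definition.
\<close>

lemma Ck_on_SucI:
  assumes "t > 0"
    and "\<And>p. p \<in> strip t \<Longrightarrow> (f has_derivative D p) (at p within strip t)"
    and "\<And>v. Ck_on k (strip t) (\<lambda>p. D p v)"
  shows "Ck_on (Suc k) (strip t) f"
proof -
  have "Ck_on k (strip t) (\<lambda>p. frechet_derivative f (at p within strip t) v)" for v
    using assms(3) Ck_on_cong[of "strip t" "\<lambda>p. frechet_derivative f (at p within strip t) v" "\<lambda>p. D p v" k]
      frechet_derivative_strip_eq[OF assms(1) _ assms(2)] by simp
  moreover have "f differentiable_on strip t"
    unfolding differentiable_on_def differentiable_def using assms(2) by blast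
  ultimately show ?thesis by simp
qed

lemma Ck_on_const: "t > 0 \<Longrightarrow> Ck_on k (strip t) (\<lambda>p. c)"
proof (induction k arbitrary: c)
  case (Suc k)
  then show ?case by (intro Ck_on_SucI[where D = "\<lambda>p v. 0"]) auto
qed simp

lemma Ck_on_bounded_linear:
  assumes "t > 0" "bounded_linear f" shows "Ck_on k (strip t) f"
proof (cases k)
  case 0
  then show ?thesis using assms by (simp add: bounded_linear.linear linear_continuous_on)
next
  case (Suc m)
  have "Ck_on (Suc m) (strip t) f"
    using assms Ck_on_const[OF assms(1)]
    by (intro Ck_on_SucI[of t f "\<lambda>p. f" m]) (auto intro: bounded_linear_imp_has_derivative)
  then show ?thesis using Suc by simp
qed

lemma Ck_on_add:
  assumes "t > 0" "Ck_on k (strip t) f" "Ck_on k (strip t) g"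
  shows "Ck_on k (strip t) (\<lambda>p. f p + g p)"
  using assms(2,3)
proof (induction k arbitrary: f g)
  case 0
  then show ?case by (simp add: continuous_on_add)
next
  case (Suc k)
  then show ?case
    by (intro Ck_on_SucI[OF assms(1),
          where D = "\<lambda>p v. frechet_derivative f (at p within strip t) v +
                           frechet_derivative g (at p within strip t) v"])
      (auto intro!: has_derivative_add differentiable_on_has_frechet_derivative)
qed

lemma Ck_on_mult:
  fixes f g :: "spacetime \<Rightarrow> real"
  assumes "t > 0" "Ck_on k (strip t) f" "Ck_on k (strip t) g"
  shows "Ck_on k (strip t) (\<lambda>p. f p * g p)"
  using assms(2,3)
proof (induction k arbitrary: f g)
  case 0
  then show ?case by (simp add: continuous_on_mult)
next
  case (Suc k)
  from Suc.prems show ?case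
    by (intro Ck_on_SucI[OF assms(1),
          where D = "\<lambda>p v. f p * frechet_derivative g (at p within strip t) v +
                           frechet_derivative f (at p within strip t) v * g p"]
        has_derivative_mult differentiable_on_has_frechet_derivative Ck_on_add[OF assms(1)] Suc.IH)
      (auto intro: Ck_on_SucD)
qed

lemma Ck_on_sum:
  fixes f :: "'i \<Rightarrow> spacetime \<Rightarrow> real"
  assumes "t > 0" "\<And>i. i \<in> I \<Longrightarrow> Ck_on k (strip t) (f i)"
  shows "Ck_on k (strip t) (\<lambda>p. \<Sum>i\<in>I. f i p)"
  using assms
  by (induction I rule: infinite_finite_induct) (auto intro: Ck_on_const Ck_on_add)

lemma Ck_on_diff:
  fixes f g :: "spacetime \<Rightarrow> real"
  assumes "t > 0" "Ck_on k (strip t) f" "Ck_on k (strip t) g"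
  shows "Ck_on k (strip t) (\<lambda>p. f p - g p)"
  using Ck_on_add[OF assms(1,2) Ck_on_mult[OF assms(1) Ck_on_const[OF assms(1), of k "- 1"] assms(3)]]
  by simp

lemma linear_frechet_derivative_on:
  assumes "f differentiable_on S" "p \<in> S"
  shows "linear (frechet_derivative f (at p within S))"
  using assms by (simp add: differentiable_on_def linear_frechet_derivative)

lemma frechet_derivative_Basis_expansion:
  fixes f :: "spacetime \<Rightarrow> real"
  assumes "f differentiable_on S" "p \<in> S"
  shows "frechet_derivative f (at p within S) v =
    (\<Sum>b\<in>Basis. (v \<bullet> b) * frechet_derivative f (at p within S) b)"
proof -
  interpret linear "frechet_derivative f (at p within S)"
    by (rule linear_frechet_derivative_on[OF assms])
  have "frechet_derivative f (at p within S) v =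
      frechet_derivative f (at p within S) (\<Sum>b\<in>Basis. (v \<bullet> b) *\<^sub>R b)"
    by (simp add: euclidean_representation)
  also have "\<dots> = (\<Sum>b\<in>Basis. (v \<bullet> b) * frechet_derivative f (at p within S) b)"
    by (simp add: sum scale)
  finally show ?thesis .
qed

text \<open>
  A vector field differentiates by a combination of basis derivatives with its coefficients as
  factors, so it costs one order of regularity whenever the coefficients are regular enough.
\<close>

lemma Ck_on_vf_deriv:
  assumes "t > 0" "Ck_on (Suc k) (strip t) f" "\<And>b. Ck_on k (strip t) (\<lambda>p. X p \<bullet> b)"
  shows "Ck_on k (strip t) (vf_deriv (strip t) X f)"
proof -
  have "Ck_on k (strip t) (\<lambda>p. \<Sum>b\<in>Basis. (X p \<bullet> b) * frechet_derivative f (at p within strip t) b)"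
    using assms by (intro Ck_on_sum Ck_on_mult) auto
  then show ?thesis
    using assms(2)
    by (subst Ck_on_cong) (auto simp: vf_deriv_def intro: frechet_derivative_Basis_expansion)
qed

lemma Ck_on_vf_deriv_linear:
  assumes "t > 0" "Ck_on (Suc k) (strip t) f" "bounded_linear X"
  shows "Ck_on k (strip t) (vf_deriv (strip t) X f)"
  using assms Ck_on_bounded_linear[OF assms(1) bounded_linear_inner_left_comp[OF assms(3)]]
  by (intro Ck_on_vf_deriv) auto

lemma bounded_linear_Omega: "bounded_linear (Omega i j)"
proof -
  have "Omega i j = (\<lambda>p. (0, (snd p $ i) *\<^sub>R axis j 1 - (snd p $ j) *\<^sub>R axis i 1))"
    by (auto simp: Omega_def)
  moreover have "bounded_linear \<dots>"
    by (intro bounded_linear_Pair bounded_linear_zero bounded_linear_sub bounded_linear_scaleR_left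
        bounded_linear_compose[OF bounded_linear_scaleR_left]
        bounded_linear_compose[OF bounded_linear_vec_nth bounded_linear_snd])
  ultimately show ?thesis by simp
qed

lemma Ck_on_Omega:
  "t > 0 \<Longrightarrow> Ck_on (Suc k) (strip t) f \<Longrightarrow> Ck_on k (strip t) (vf_deriv (strip t) (Omega i j) f)"
  by (intro Ck_on_vf_deriv_linear bounded_linear_Omega)

lemma Ck_on_L_scal:
  "t > 0 \<Longrightarrow> Ck_on (Suc k) (strip t) f \<Longrightarrow> Ck_on k (strip t) (vf_deriv (strip t) L_scal f)"
  by (intro Ck_on_vf_deriv_linear) (simp_all add: L_scal_def bounded_linear_ident[unfolded id_def[symmetric]] id_def)

lemma Ck_on_D_t:
  "t > 0 \<Longrightarrow> Ck_on (Suc k) (strip t) f \<Longrightarrow> Ck_on k (strip t) (vf_deriv (strip t) D_t f)"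
  by (intro Ck_on_vf_deriv) (auto simp: D_t_def split_beta intro: Ck_on_const)

lemma Ck_on_D_x:
  "t > 0 \<Longrightarrow> Ck_on (Suc k) (strip t) f \<Longrightarrow> Ck_on k (strip t) (vf_deriv (strip t) (D_x i) f)"
  by (intro Ck_on_vf_deriv) (auto simp: D_x_def split_beta intro: Ck_on_const)

lemma Ck_on_box_op:
  assumes "t > 0" "Ck_on (Suc (Suc k)) (strip t) w"
  shows "Ck_on k (strip t) (box_op (strip t) w)"
proof -
  have "Ck_on k (strip t) (\<lambda>p. vf_deriv (strip t) D_t (vf_deriv (strip t) D_t w) p
     - (\<Sum>i\<in>UNIV. vf_deriv (strip t) (D_x i) (vf_deriv (strip t) (D_x i) w) p))"
    using assms by (intro Ck_on_diff Ck_on_sum Ck_on_D_t Ck_on_D_x)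
  then show ?thesis unfolding box_op_def .
qed

lemma Ck_on_Suc_imp_differentiable: "Ck_on (Suc k) S f \<Longrightarrow> f differentiable_on S"
  by simp

abbreviation dt :: "real \<Rightarrow> (spacetime \<Rightarrow> real) \<Rightarrow> spacetime \<Rightarrow> real" where
  "dt t g \<equiv> vf_deriv (strip t) D_t g"

abbreviation dx :: "real \<Rightarrow> 3 \<Rightarrow> (spacetime \<Rightarrow> real) \<Rightarrow> spacetime \<Rightarrow> real" where
  "dx t i g \<equiv> vf_deriv (strip t) (D_x i) g"

lemma frechet_derivative_strip_expansion:
  assumes "g differentiable_on strip t" "p \<in> strip t"
  shows "frechet_derivative g (at p within strip t) (c, v) = c * dt t g p + (\<Sum>i\<in>UNIV. v $ i * dx t i g p)"
proof -
  interpret linear "frechet_derivative g (at p within strip t)"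
    by (rule linear_frechet_derivative_on[OF assms])
  have "(c, v) = c *\<^sub>R (1, 0) + (\<Sum>i\<in>UNIV. (v $ i) *\<^sub>R (0, axis i 1))"
  proof -
    have "(\<Sum>i\<in>UNIV. (v $ i) *\<^sub>R (0::real, axis i (1::real))) = (0, \<Sum>i\<in>UNIV. (v $ i) *\<^sub>R axis i 1)"
      by (simp add: sum_prod[symmetric] prod_eq_iff fst_sum snd_sum)
    moreover have "(\<Sum>i\<in>UNIV. (v $ i) *\<^sub>R axis i 1) = v"
      using basis_expansion[of v] by (simp add: scalar_mult_eq_scaleR)
    ultimately show ?thesis by simp
  qed
  then have "frechet_derivative g (at p within strip t) (c, v) =
     frechet_derivative g (at p within strip t) (c *\<^sub>R (1, 0) + (\<Sum>i\<in>UNIV. (v $ i) *\<^sub>R (0, axis i 1)))"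
    by simp
  also have "\<dots> = c * dt t g p + (\<Sum>i\<in>UNIV. v $ i * dx t i g p)"
    by (simp only: add sum scale real_scaleR_def vf_deriv_def D_t_def D_x_def case_prod_unfold)
  finally show ?thesis .
qed

text \<open>
  Curves are allowed to run inside the faces of the strip; this is how boundary values of the
  derivatives enter below.
\<close>

lemma strip_chain_rule:
  assumes g: "g differentiable_on strip t"
    and s: "(s has_real_derivative s') (at \<tau> within I)"
    and y: "(y has_vector_derivative y') (at \<tau> within I)"
    and I: "\<tau> \<in> I" "\<And>\<tau>. \<tau> \<in> I \<Longrightarrow> s \<tau> \<in> {0..t}"
  shows "((\<lambda>\<tau>. g (s \<tau>, y \<tau>)) has_real_derivative
    (s' * dt t g (s \<tau>, y \<tau>) + (\<Sum>i\<in>UNIV. y' $ i * dx t i g (s \<tau>, y \<tau>)))) (at \<tau> within I)"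
proof -
  have der: "((\<lambda>\<tau>. (s \<tau>, y \<tau>)) has_derivative (\<lambda>h. (h * s', h *\<^sub>R y'))) (at \<tau> within I)"
    using s y by (intro has_derivative_Pair)
      (simp_all add: has_field_derivative_def has_vector_derivative_def mult.commute[of _ s'])
  have p: "(s \<tau>, y \<tau>) \<in> strip t" using I by (auto simp: strip_def)
  have "((\<lambda>\<tau>. g (s \<tau>, y \<tau>)) has_derivative
      (\<lambda>h. frechet_derivative g (at (s \<tau>, y \<tau>) within strip t) (h * s', h *\<^sub>R y'))) (at \<tau> within I)"
    by (rule has_derivative_in_compose2[OF differentiable_on_has_frechet_derivative[OF g] _ I(1) der])
      (use I in \<open>auto simp: strip_def\<close>)
  moreover have "(\<lambda>h. frechet_derivative g (at (s \<tau>, y \<tau>) within strip t) (h * s', h *\<^sub>R y')) =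
      (*) (s' * dt t g (s \<tau>, y \<tau>) + (\<Sum>i\<in>UNIV. y' $ i * dx t i g (s \<tau>, y \<tau>)))"
    by (rule ext, subst frechet_derivative_strip_expansion[OF g p])
      (simp add: algebra_simps sum_distrib_left)
  ultimately show ?thesis by (simp add: has_field_derivative_def)
qed

lemma vf_deriv_Omega:
  assumes "g differentiable_on strip t" "(s, y) \<in> strip t"
  shows "vf_deriv (strip t) (Omega i j) g (s, y) = y $ i * dx t j g (s, y) - y $ j * dx t i g (s, y)"
proof -
  have e: "vf_deriv (strip t) (Omega i j) g (s, y) =
     frechet_derivative g (at (s, y) within strip t) (0, y $ i *\<^sub>R axis j 1 - y $ j *\<^sub>R axis i 1)"
    by (simp only: vf_deriv_def Omega_def prod.case)
  have "vf_deriv (strip t) (Omega i j) g (s, y) =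
     (\<Sum>k\<in>UNIV. (y $ i *\<^sub>R axis j 1 - y $ j *\<^sub>R axis i 1) $ k * dx t k g (s, y))"
    using frechet_derivative_strip_expansion[OF assms, of 0 "y $ i *\<^sub>R axis j 1 - y $ j *\<^sub>R axis i 1"]
    unfolding e by simp
  also have "\<dots> = y $ i * dx t j g (s, y) - y $ j * dx t i g (s, y)"
    by (simp add: left_diff_distrib sum_subtractf axis_def if_distrib[of "\<lambda>x. _ * x"]
        if_distrib[of "\<lambda>x. x * _"] cong: if_cong)
  finally show ?thesis .
qed

lemma vf_deriv_L_scal:
  assumes "g differentiable_on strip t" "(s, y) \<in> strip t"
  shows "vf_deriv (strip t) L_scal g (s, y) = s * dt t g (s, y) + (\<Sum>k\<in>UNIV. y $ k * dx t k g (s, y))"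
proof -
  have "vf_deriv (strip t) L_scal g (s, y) = frechet_derivative g (at (s, y) within strip t) (s, y)"
    by (simp only: vf_deriv_def L_scal_def prod.case)
  then show ?thesis using frechet_derivative_strip_expansion[OF assms, of s y] by simp
qed

text \<open>
  Vanishing initial values give \<open>w\<close> as the time integral of its time derivative. Differentiating
  this integral in space under the integral sign and then in time yields the two mixed derivatives.
\<close>

lemma dt_dx_commute:
  assumes t: "t > 0" and w: "Ck_on 2 (strip t) w" and w0: "\<And>y. w (0, y) = 0"
    and s: "s \<in> {0..t}"
  shows "dt t (dx t i w) (s, y) = dx t i (dt t w) (s, y)"
proof -
  have w2: "Ck_on (Suc (Suc 0)) (strip t) w" using w by (simp add: numeral_2_eq_2)
  have w1: "w differentiable_on strip t" using w2 by (rule Ck_on_Suc_imp_differentiable)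
  have Cdt: "Ck_on (Suc 0) (strip t) (dt t w)" and Cdx: "Ck_on (Suc 0) (strip t) (dx t i w)"
    using t w2 by (auto intro: Ck_on_D_t Ck_on_D_x simp del: Ck_on.simps)
  have ddt: "dt t w differentiable_on strip t" and ddx: "dx t i w differentiable_on strip t"
    using Cdt Cdx by auto
  have cdt: "continuous_on (strip t) (dt t w)"
    using Cdt by (rule Ck_on_imp_continuous)
  have cdxt: "continuous_on (strip t) (dx t i (dt t w))"
    using Ck_on_D_x[OF t Cdt] by simp
  let ?y = "\<lambda>h. y + h *\<^sub>R axis i 1"
  have line: "(?y has_vector_derivative axis i 1) (at h within I)" for h I
    by (auto intro!: derivative_eq_intros)
  have rep: "w (s, y) = integral {0..s} (\<lambda>\<sigma>. dt t w (\<sigma>, y))" if s: "s \<in> {0..t}" for s y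
  proof -
    have "((\<lambda>\<sigma>. dt t w (\<sigma>, y)) has_integral w (s, y) - w (0, y)) {0..s}"
    proof (rule fundamental_theorem_of_calculus)
      fix \<sigma> assume \<sigma>: "\<sigma> \<in> {0..s}"
      show "((\<lambda>\<sigma>. w (\<sigma>, y)) has_vector_derivative dt t w (\<sigma>, y)) (at \<sigma> within {0..s})"
        using strip_chain_rule[OF w1 DERIV_ident has_vector_derivative_const[of y] \<sigma>] s
        by (simp add: has_real_derivative_iff_has_vector_derivative)
    qed (use s in auto)
    then show ?thesis by (simp add: w0 integral_unique)
  qed
  have dxw: "dx t i w (s, y) = integral {0..s} (\<lambda>\<sigma>. dx t i (dt t w) (\<sigma>, y))" if s: "s \<in> {0..t}" for s
  proof -
    have "((\<lambda>h. integral (cbox 0 s) (\<lambda>\<sigma>. dt t w (\<sigma>, ?y h))) has_field_derivative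
       integral (cbox 0 s) (\<lambda>\<sigma>. dx t i (dt t w) (\<sigma>, ?y 0))) (at 0 within UNIV)"
    proof (rule leibniz_rule_field_derivative)
      fix h \<sigma> :: real assume \<sigma>: "\<sigma> \<in> cbox 0 s"
      have "((\<lambda>h. dt t w (\<sigma>, ?y h)) has_real_derivative
          (0 * dt t (dt t w) (\<sigma>, ?y h) + (\<Sum>j\<in>UNIV. axis i 1 $ j * dx t j (dt t w) (\<sigma>, ?y h)))) (at h within UNIV)"
        by (rule strip_chain_rule[OF ddt _ line]) (use \<sigma> s in auto)
      moreover have "(\<Sum>j\<in>UNIV. axis i 1 $ j * dx t j (dt t w) (\<sigma>, ?y h)) = dx t i (dt t w) (\<sigma>, ?y h)"
        by (simp add: axis_def if_distrib[of "\<lambda>x. x * _"] cong: if_cong)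
      ultimately show "((\<lambda>h. dt t w (\<sigma>, ?y h)) has_real_derivative dx t i (dt t w) (\<sigma>, ?y h)) (at h within UNIV)"
        by simp
    next
      fix h :: real
      show "(\<lambda>\<sigma>. dt t w (\<sigma>, ?y h)) integrable_on cbox 0 s"
        using s by (intro integrable_continuous continuous_on_compose2[OF cdt])
          (auto intro!: continuous_intros simp: strip_def)
    next
      show "continuous_on (UNIV \<times> cbox 0 s) (\<lambda>(h, \<sigma>). dx t i (dt t w) (\<sigma>, ?y h))"
        using s unfolding case_prod_unfold by (intro continuous_on_compose2[OF cdxt])
          (auto intro!: continuous_intros simp: strip_def)
    qed auto
    then have 1: "((\<lambda>h. w (s, ?y h)) has_real_derivative
       integral {0..s} (\<lambda>\<sigma>. dx t i (dt t w) (\<sigma>, y))) (at 0)"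
      using rep[OF s] by simp
    have "((\<lambda>h. w (s, ?y h)) has_real_derivative
          (0 * dt t w (s, ?y 0) + (\<Sum>j\<in>UNIV. axis i 1 $ j * dx t j w (s, ?y 0)))) (at 0 within UNIV)"
      by (rule strip_chain_rule[OF w1 _ line]) (use s in auto)
    moreover have "(\<Sum>j\<in>UNIV. axis i 1 $ j * dx t j w (s, ?y 0)) = dx t i w (s, y)"
      by (simp add: axis_def if_distrib[of "\<lambda>x. x * _"] cong: if_cong)
    ultimately have "((\<lambda>h. w (s, ?y h)) has_real_derivative dx t i w (s, y)) (at 0)"
      by simp
    from DERIV_unique[OF this 1] show ?thesis .
  qed
  have "((\<lambda>s. integral {0..s} (\<lambda>\<sigma>. dx t i (dt t w) (\<sigma>, y))) has_vector_derivative
      dx t i (dt t w) (s, y)) (at s within {0..t})"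
    using s by (intro integral_has_vector_derivative continuous_on_compose2[OF cdxt])
      (auto intro!: continuous_intros simp: strip_def)
  then have 1: "((\<lambda>s. dx t i w (s, y)) has_vector_derivative dx t i (dt t w) (s, y)) (at s within {0..t})"
    by (rule has_vector_derivative_transform[OF s, rotated]) (simp add: dxw)
  have 2: "((\<lambda>s. dx t i w (s, y)) has_vector_derivative dt t (dx t i w) (s, y)) (at s within {0..t})"
    using strip_chain_rule[OF ddx DERIV_ident has_vector_derivative_const[of y] s]
    by (simp add: has_real_derivative_iff_has_vector_derivative)
  show ?thesis
  proof (rule vector_derivative_unique_within_closed_interval)
    show "s \<in> cbox 0 t" using s by simp
    show "((\<lambda>s. dx t i w (s, y)) has_vector_derivative dt t (dx t i w) (s, y)) (at s within cbox 0 t)"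
      using 2 by (simp only: cbox_interval)
    show "((\<lambda>s. dx t i w (s, y)) has_vector_derivative dx t i (dt t w) (s, y)) (at s within cbox 0 t)"
      using 1 by (simp only: cbox_interval)
  qed (rule t)
qed

lemma continuous_on_strip_compose:
  assumes "continuous_on (strip t) g" "continuous_on A s" "continuous_on A y"
    "\<And>x. x \<in> A \<Longrightarrow> s x \<in> {0..t}"
  shows "continuous_on A (\<lambda>x. g (s x, y x))"
  by (rule continuous_on_compose2[OF assms(1)])
    (use assms in \<open>auto intro!: continuous_intros simp: strip_def\<close>)

section \<open>Spherical coordinates\<close>

text \<open>
  Two charts of the unit sphere, the second being \<open>polar1\<close> below: the number names the coordinate
  axis through the poles. The first angle is the polar distance, the second the azimuth.
\<close>

definition polar3 :: "real \<times> real \<Rightarrow> real^3" where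
  "polar3 z = vector [sin (fst z) * cos (snd z), sin (fst z) * sin (snd z), cos (fst z)]"

lemma norm_polar3: "norm (polar3 z) = 1"
proof -
  define s c S C where *: "s = sin (fst z)" "c = cos (fst z)" "S = sin (snd z)" "C = cos (snd z)"
  have "(norm (polar3 z))\<^sup>2 = s\<^sup>2 * (C\<^sup>2 + S\<^sup>2) + c\<^sup>2"
    unfolding power2_norm_eq_inner polar3_def *[symmetric]
    by (simp add: inner_vec_def sum_3 power2_eq_square algebra_simps)
  then have "(norm (polar3 z))\<^sup>2 = 1\<^sup>2" by (simp add: *)
  then show ?thesis by (rule power2_eq_imp_eq) auto
qed

definition spherical :: "real^3 \<Rightarrow> real^3" where
  "spherical u = (u $ 1) *\<^sub>R polar3 (u $ 2, u $ 3)"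

definition spherical_deriv :: "real^3 \<Rightarrow> real^3 \<Rightarrow> real^3" where
  "spherical_deriv u h = vector
    [h $ 1 * (sin (u $ 2) * cos (u $ 3)) + u $ 1 * (cos (u $ 2) * h $ 2 * cos (u $ 3) - sin (u $ 2) * sin (u $ 3) * h $ 3),
     h $ 1 * (sin (u $ 2) * sin (u $ 3)) + u $ 1 * (cos (u $ 2) * h $ 2 * sin (u $ 3) + sin (u $ 2) * cos (u $ 3) * h $ 3),
     h $ 1 * cos (u $ 2) - u $ 1 * sin (u $ 2) * h $ 2]"

lemma has_derivative_spherical: "(spherical has_derivative spherical_deriv u) (at u within S)"
proof (rule has_derivative_componentwise_within[THEN iffD2], rule ballI)
  fix b :: "real^3" assume "b \<in> Basis"
  then obtain i where b: "b = axis i 1" by (auto simp: Basis_vec_def)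
  have component: "((\<lambda>x. x $ j) has_derivative (\<lambda>x. x $ j)) (at u within S)" for j :: 3
    by (intro bounded_linear_imp_has_derivative bounded_linear_vec_nth)
  have i: "i = 1 \<or> i = 2 \<or> i = 3" using exhaust_3 by blast
  show "((\<lambda>x. spherical x \<bullet> b) has_derivative (\<lambda>x. spherical_deriv u x \<bullet> b)) (at u within S)"
    using i unfolding b spherical_def spherical_deriv_def polar3_def
    by (elim disjE)
      (auto simp: inner_axis algebra_simps intro!: component[THEN has_derivative_eq_rhs] derivative_eq_intros ext)
qed

lemma det_spherical_deriv: "det (matrix (spherical_deriv u)) = (u $ 1)\<^sup>2 * sin (u $ 2)"
proof -
  have "det (matrix (spherical_deriv u)) =
    (u $ 1)\<^sup>2 * sin (u $ 2) * ((sin (u $ 2))\<^sup>2 + (cos (u $ 2))\<^sup>2) * ((sin (u $ 3))\<^sup>2 + (cos (u $ 3))\<^sup>2)"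
  proof -
    define s c S C where *: "s = sin (u $ 2)" "c = cos (u $ 2)" "S = sin (u $ 3)" "C = cos (u $ 3)"
    show ?thesis
      unfolding det_3 matrix_def spherical_deriv_def *[symmetric]
      by (simp add: axis_def power2_eq_square) (simp add: algebra_simps)
  qed
  then show ?thesis by simp
qed

definition spherical_domain :: "(real^3) set" where
  "spherical_domain = {u. 0 < u $ 1 \<and> 0 < u $ 2 \<and> u $ 2 < pi \<and> 0 \<le> u $ 3 \<and> u $ 3 < 2 * pi}"

lemma inj_on_spherical: "inj_on spherical spherical_domain"
proof (rule inj_onI)
  fix u v assume u: "u \<in> spherical_domain" and v: "v \<in> spherical_domain" and eq: "spherical u = spherical v"
  have "norm (spherical u) = u $ 1" "norm (spherical v) = v $ 1"
    using u v by (simp_all add: spherical_def spherical_domain_def norm_polar3)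
  then have 1: "u $ 1 = v $ 1" using eq by simp
  have p: "polar3 (u $ 2, u $ 3) = polar3 (v $ 2, v $ 3)"
    using eq u unfolding spherical_def 1 by (simp add: spherical_domain_def 1)
  then have "polar3 (u $ 2, u $ 3) $ i = polar3 (v $ 2, v $ 3) $ i" for i by simp
  from this[of 1] this[of 2] this[of 3]
  have e: "sin (u $ 2) * cos (u $ 3) = sin (v $ 2) * cos (v $ 3)"
     "sin (u $ 2) * sin (u $ 3) = sin (v $ 2) * sin (v $ 3)" "cos (u $ 2) = cos (v $ 2)"
    by (simp_all add: polar3_def)
  have 2: "u $ 2 = v $ 2"
    using u v cos_inj_pi[OF _ _ _ _ e(3)] by (simp add: spherical_domain_def)
  have "sin (v $ 2) \<noteq> 0" using v sin_gt_zero[of "v $ 2"] by (simp add: spherical_domain_def)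
  then have "cos (u $ 3) = cos (v $ 3)" "sin (u $ 3) = sin (v $ 3)"
    using e 2 by auto
  then have "sin (u $ 3) = sin (v $ 3) \<and> cos (u $ 3) = cos (v $ 3)" by simp
  then obtain n where n: "u $ 3 = v $ 3 + 2 * pi * real_of_int n"
    unfolding sin_cos_eq_iff by auto
  have "\<bar>2 * pi * real_of_int n\<bar> < 2 * pi * 1" using n u v unfolding spherical_domain_def by auto
  then have "\<bar>real_of_int n\<bar> < 1" by (simp add: abs_mult)
  then have "n = 0" by linarith
  then have "u $ 3 = v $ 3" using n by simp
  with 1 2 show "u = v" by (simp add: vec_eq_iff forall_3)
qed

lemma spherical_domain_borel[measurable]: "spherical_domain \<in> sets borel"
  unfolding spherical_domain_def by measurable

lemma borel_measurable_spherical: "spherical \<in> borel_measurable borel"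
proof (rule borel_measurable_continuous_onI)
  show "continuous_on UNIV spherical"
    by (meson has_derivative_spherical continuous_on_eq_continuous_within has_derivative_continuous)
qed

text \<open>
  The change of variables is needed as an inequality for arbitrary nonnegative integrands, hence it is
  stated for sets first: the image measure of the Jacobian density is dominated by Lebesgue measure.
\<close>

lemma emeasure_spherical_le:
  assumes A: "A \<in> sets borel"
  shows "(\<integral>\<^sup>+u. ennreal ((u $ 1)\<^sup>2 * sin (u $ 2)) * indicator spherical_domain u * indicator A (spherical u) \<partial>lborel)
    \<le> emeasure lborel A"
proof (cases "emeasure lborel A = \<infinity>")
  case fin: False
  define E where "E = spherical_domain \<inter> spherical -` A"
  let ?f = "\<lambda>u. \<bar>det (matrix (spherical_deriv u))\<bar>"
  note borel_measurable_spherical [measurable]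
  have Eb: "E \<in> sets borel"
    using measurable_sets[of spherical borel borel A] A by (auto simp: E_def)
  then have E: "E \<in> sets lebesgue" by auto
  have inj: "inj_on spherical E" using inj_on_spherical by (rule inj_on_subset) (auto simp: E_def)
  have sub: "spherical ` E \<subseteq> A" by (auto simp: E_def)
  have sE: "spherical ` E \<in> sets lebesgue"
    using E has_derivative_spherical
    by (intro differentiable_image_in_sets_lebesgue) (auto simp: differentiable_on_def differentiable_def)
  have Alm: "A \<in> lmeasurable"
    using A fin by (intro fmeasurableI) (simp_all add: less_top)
  have lm: "spherical ` E \<in> lmeasurable"
    by (rule fmeasurableI2[OF Alm sub sE])
  have int: "?f integrable_on E"
    by (rule measurable_differentiable_image_eq[OF E has_derivative_spherical inj, THEN iffD1, OF lm])
  have "(\<integral>\<^sup>+u. ennreal ((u $ 1)\<^sup>2 * sin (u $ 2)) * indicator spherical_domain u * indicator A (spherical u) \<partial>lborel)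
      = (\<integral>\<^sup>+u. ennreal (?f u) * indicator E u \<partial>lborel)"
    by (intro nn_integral_cong)
      (auto simp: E_def det_spherical_deriv abs_mult spherical_domain_def sin_ge_zero split: split_indicator)
  also have "\<dots> = ennreal (integral E ?f)"
    using int by (intro nn_integral_has_integral_lebesgue') (auto simp: integrable_integral)
  also have "integral E ?f = measure lebesgue (spherical ` E)"
    by (rule measure_differentiable_image_eq[OF E has_derivative_spherical inj int, symmetric])
  also have "ennreal \<dots> = emeasure lebesgue (spherical ` E)"
    using lm by (simp add: emeasure_eq_measure2)
  also have "\<dots> \<le> emeasure lebesgue A"
    using A sub by (intro emeasure_mono) auto
  finally show ?thesis using A by simp
qed simp

lemma prod_Basis_real3: "(\<Prod>b\<in>(Basis :: (real^3) set). f b) = f (axis 1 1) * f (axis 2 1) * f (axis 3 1)"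
proof -
  have B: "(Basis :: (real^3) set) = (\<lambda>i. axis i 1) ` UNIV" by (auto simp: Basis_vec_def)
  have "inj (\<lambda>i::3. axis i (1::real))" by (auto simp: inj_def axis_eq_axis)
  then have "(\<Prod>b\<in>(Basis :: (real^3) set). f b) = (\<Prod>i\<in>UNIV. f (axis i 1))"
    unfolding B by (subst prod.reindex) auto
  then show ?thesis unfolding UNIV_3 by (simp add: mult.assoc)
qed

definition cycle_axes :: "real^3 \<Rightarrow> real^3" where
  "cycle_axes y = vector [y $ 3, y $ 1, y $ 2]"

definition polar1 :: "real \<times> real \<Rightarrow> real^3" where
  "polar1 z = vector [cos (fst z), sin (fst z) * cos (snd z), sin (fst z) * sin (snd z)]"

lemma polar1_eq: "polar1 z = cycle_axes (polar3 z)"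
  by (simp add: polar1_def cycle_axes_def polar3_def)

lemma continuous_on_vector3:
  assumes "continuous_on S f" "continuous_on S g" "continuous_on S h"
  shows "continuous_on S (\<lambda>x. vector [f x, g x, h x] :: real^3)"
proof -
  have eq: "(\<lambda>x. vector [f x, g x, h x] :: real^3) =
      (\<lambda>x. f x *\<^sub>R axis 1 1 + g x *\<^sub>R axis 2 1 + h x *\<^sub>R axis 3 1)"
    by (auto simp: vec_eq_iff forall_3 axis_def)
  show ?thesis unfolding eq by (intro continuous_intros assms)
qed

lemma continuous_on_polar:
  "continuous_on S polar3" "continuous_on S polar1"
  unfolding polar3_def[abs_def] polar1_def[abs_def]
  by (rule continuous_on_vector3; intro continuous_intros)+

lemma continuous_on_cycle_axes: "continuous_on S cycle_axes"
  unfolding cycle_axes_def[abs_def] by (rule continuous_on_vector3; intro continuous_intros)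

lemma borel_measurable_vector3: "(\<lambda>(v, a, b). vector [v, a, b] :: real^3) \<in> borel_measurable borel"
  unfolding case_prod_unfold
  by (rule borel_measurable_continuous_onI, rule continuous_on_vector3; intro continuous_intros)

lemma norm_polar1: "norm (polar1 z) = 1"
proof -
  have "norm (polar1 z) = norm (polar3 z)"
    unfolding norm_eq_sqrt_inner by (simp add: polar1_def polar3_def inner_vec_def sum_3)
  then show ?thesis by (simp add: norm_polar3)
qed

lemma emeasure_lborel_Times:
  fixes A :: "'a::euclidean_space set" and B :: "'b::euclidean_space set"
  assumes "A \<in> sets borel" "B \<in> sets borel"
  shows "emeasure lborel (A \<times> B) = emeasure lborel A * emeasure lborel B"
  using assms by (subst lborel_prod[symmetric], intro lborel.emeasure_pair_measure_Times) simp_all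

text \<open>
  Carries the change of variables, which lives on \<open>real^3\<close>, over to iterated integrals.
\<close>

lemma distr_lborel_vector3:
  "distr lborel borel (\<lambda>(v, a, b). vector [v, a, b] :: real^3) = lborel"
proof (rule lborel_eqI[symmetric])
  let ?V = "\<lambda>(v, a, b). vector [v, a, b] :: real^3"
  note borel_measurable_vector3 [measurable]
  fix l u :: "real^3" assume lu: "\<And>b. b \<in> Basis \<Longrightarrow> l \<bullet> b \<le> u \<bullet> b"
  have le: "l $ i \<le> u $ i" for i using lu[of "axis i 1"] by (simp add: inner_axis)
  have "emeasure (distr lborel borel ?V) (box l u) = emeasure lborel (?V -` box l u)"
    by (subst emeasure_distr) auto
  also have "?V -` box l u = {l $ 1<..<u $ 1} \<times> {l $ 2<..<u $ 2} \<times> {l $ 3<..<u $ 3}"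
    by (auto simp: mem_box_cart forall_3)
  also have "emeasure lborel \<dots> = ennreal (u $ 1 - l $ 1) * (ennreal (u $ 2 - l $ 2) * ennreal (u $ 3 - l $ 3))"
    using le by (simp add: emeasure_lborel_Times borel_Times)
  also have "\<dots> = ennreal (\<Prod>b\<in>Basis. (u - l) \<bullet> b)"
    using le by (simp add: prod_Basis_real3 inner_axis ennreal_mult[symmetric] mult.assoc)
  finally show "emeasure (distr lborel borel ?V) (box l u) = ennreal (\<Prod>b\<in>Basis. (u - l) \<bullet> b)" .
qed simp

lemma distr_lborel_cycle_axes: "distr lborel borel cycle_axes = lborel"
proof (rule lborel_eqI[symmetric])
  have [measurable]: "cycle_axes \<in> borel_measurable borel"
    by (rule borel_measurable_continuous_onI[OF continuous_on_cycle_axes])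
  fix l u :: "real^3" assume lu: "\<And>b. b \<in> Basis \<Longrightarrow> l \<bullet> b \<le> u \<bullet> b"
  have le: "l $ i \<le> u $ i" for i using lu[of "axis i 1"] by (simp add: inner_axis)
  have "emeasure (distr lborel borel cycle_axes) (box l u) = emeasure lborel (cycle_axes -` box l u)"
    by (subst emeasure_distr) auto
  also have "cycle_axes -` box l u = box (vector [l $ 2, l $ 3, l $ 1]) (vector [u $ 2, u $ 3, u $ 1])"
    by (auto simp: mem_box_cart forall_3 cycle_axes_def)
  also have "emeasure lborel \<dots> = ennreal (\<Prod>b\<in>Basis. (vector [u $ 2, u $ 3, u $ 1] - vector [l $ 2, l $ 3, l $ 1] :: real^3) \<bullet> b)"
  proof (rule emeasure_lborel_box)
    fix b :: "real^3" assume "b \<in> Basis"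
    then obtain i where b: "b = axis i 1" by (auto simp: Basis_vec_def)
    show "vector [l $ 2, l $ 3, l $ 1] \<bullet> b \<le> vector [u $ 2, u $ 3, u $ 1] \<bullet> b"
      using le exhaust_3[of i] by (auto simp: b inner_axis)
  qed
  also have "\<dots> = ennreal (\<Prod>b\<in>Basis. (u - l) \<bullet> b)"
    by (simp add: prod_Basis_real3 inner_axis ac_simps)
  finally show "emeasure (distr lborel borel cycle_axes) (box l u) = ennreal (\<Prod>b\<in>Basis. (u - l) \<bullet> b)" .
qed simp

text \<open>
  The charts are used only between the polar distances \<open>pi / 4\<close> and \<open>3 * pi / 4\<close>, where the Jacobian
  is bounded below. The two charts together still cover the sphere.
\<close>

definition angles :: "(real \<times> real) set" where
  "angles = {pi / 4..3 * pi / 4} \<times> {0..2 * pi}"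

lemma borel_angles [measurable]: "angles \<in> sets borel"
  unfolding angles_def by (intro borel_closed closed_Times closed_atLeastAtMost)

lemma sin_ge_half: 
  assumes "pi / 4 \<le> a" "a \<le> 3 * pi / 4" shows "1 / 2 \<le> sin a"
proof -
  have *: "1 / 2 \<le> sin x" if "pi / 4 \<le> x" "x \<le> pi / 2" for x
  proof -
    have p: "0 < pi" by (rule pi_gt_zero)
    have "sin (pi / 6) \<le> sin x"
    proof (rule sin_monotone_2pi_le)
      show "- (pi / 2) \<le> pi / 6" using p by linarith
      show "pi / 6 \<le> x" using p that by linarith
      show "x \<le> pi / 2" by fact
     qed
    then show ?thesis by (simp only: sin_30)
  qed
  show ?thesis
  proof (cases "a \<le> pi / 2")
    case True
    then show ?thesis by (rule *[OF assms(1)])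
  next
    case False
    have "1 / 2 \<le> sin (pi - a)"
    proof (rule *)
      show "pi / 4 \<le> pi - a" using assms by linarith
      show "pi - a \<le> pi / 2" using False by linarith
    qed
    then show ?thesis by (simp only: sin_pi_minus)
  qed
qed

text \<open>
  An inequality only: the image of the chart is a part of space, the rest of which is dropped, and on \<open>angles\<close> the Jacobian \<open>v\<^sup>2 * sin a\<close> is at least \<open>v\<^sup>2 / 2\<close>.
\<close>

lemma nn_integral_polar3_le:
  fixes h :: "real^3 \<Rightarrow> ennreal"
  assumes [measurable]: "h \<in> borel_measurable borel"
  shows "(\<integral>\<^sup>+v. (\<integral>\<^sup>+z\<in>angles. h (v *\<^sub>R polar3 z) \<partial>lborel) * (ennreal (v\<^sup>2) * indicator {0<..} v) \<partial>lborel)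
    \<le> 2 * (\<integral>\<^sup>+y. h y \<partial>lborel)"
proof -
  let ?V = "\<lambda>(v, a, b). vector [v, a, b] :: real^3"
  note borel_measurable_spherical [measurable]
  have [measurable]: "polar3 \<in> borel_measurable borel"
    by (rule borel_measurable_continuous_onI) (rule continuous_on_polar)
  note borel_measurable_vector3 [measurable]
  define D where "D u = ennreal ((u $ 1)\<^sup>2 * sin (u $ 2)) * indicator spherical_domain u" for u
  have [measurable]: "D \<in> borel_measurable borel" unfolding D_def by measurable
  let ?J = "\<lambda>v. \<integral>\<^sup>+z. D (?V (v, z)) * h (spherical (?V (v, z))) \<partial>lborel"
  let ?I = "\<lambda>v. (\<integral>\<^sup>+z\<in>angles. h (v *\<^sub>R polar3 z) \<partial>lborel) * (ennreal (v\<^sup>2) * indicator {0<..} v)"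
  define N where "N = distr (density lborel D) borel spherical"
  have "N \<le> lborel"
  proof (subst le_measure)
    show "sets N = sets lborel" by (simp add: N_def)
    show "\<forall>A\<in>sets N. emeasure N A \<le> emeasure lborel A"
    proof
      fix A assume "A \<in> sets N"
      then have A[measurable]: "A \<in> sets borel" by (simp add: N_def)
      have "emeasure N A = emeasure (density lborel D) (spherical -` A)"
        unfolding N_def by (subst emeasure_distr) auto
      also have "\<dots> = (\<integral>\<^sup>+u. D u * indicator (spherical -` A) u \<partial>lborel)"
        using measurable_sets[of spherical borel borel A] by (intro emeasure_density) auto
      also have "\<dots> = (\<integral>\<^sup>+u. ennreal ((u $ 1)\<^sup>2 * sin (u $ 2)) * indicator spherical_domain u * indicator A (spherical u) \<partial>lborel)"
        by (intro nn_integral_cong) (auto simp: D_def split: split_indicator)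
      also have "\<dots> \<le> emeasure lborel A" by (rule emeasure_spherical_le[OF A])
      finally show "emeasure N A \<le> emeasure lborel A" .
    qed
  qed
  then have "(\<integral>\<^sup>+y. h y \<partial>N) \<le> (\<integral>\<^sup>+y. h y \<partial>lborel)"
    by (intro nn_integral_mono_measure) (simp_all add: N_def)
  moreover have "(\<integral>\<^sup>+y. h y \<partial>N) = (\<integral>\<^sup>+u. D u * h (spherical u) \<partial>lborel)"
    unfolding N_def by (simp add: nn_integral_distr nn_integral_density)
  moreover have "\<dots> = (\<integral>\<^sup>+p. D (?V p) * h (spherical (?V p)) \<partial>lborel)"
    by (subst distr_lborel_vector3[symmetric]) (simp add: nn_integral_distr)
  moreover have "\<dots> = (\<integral>\<^sup>+v. ?J v \<partial>lborel)"
    by (subst lborel_prod[symmetric], subst lborel.nn_integral_fst[symmetric])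
      (simp_all add: lborel_prod)
  ultimately have main: "(\<integral>\<^sup>+v. ?J v \<partial>lborel)
      \<le> (\<integral>\<^sup>+y. h y \<partial>lborel)" by simp
  \<comment> \<open>the chart is injective on the half-open azimuth range only; the edge added in \<open>angles\<close> is a null set\<close>
  have "(UNIV :: real set) \<times> {2 * pi} \<in> null_sets lborel"
    by (simp add: null_sets_def emeasure_lborel_Times borel_Times)
  from AE_not_in[OF this] have ae: "AE z::real \<times> real in lborel. snd z \<noteq> 2 * pi"
    by (rule AE_mp) (auto simp: mem_Times_iff)
  have "(\<integral>\<^sup>+v. ?I v \<partial>lborel)
     \<le> (\<integral>\<^sup>+v. 2 * ?J v \<partial>lborel)"
  proof (rule nn_integral_mono)
    fix v :: real
    have "?I v
       = (\<integral>\<^sup>+z. h (v *\<^sub>R polar3 z) * indicator angles z * (ennreal (v\<^sup>2) * indicator {0<..} v) \<partial>lborel)"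
      by (rule nn_integral_multc[symmetric]) measurable
    also have "\<dots> \<le> (\<integral>\<^sup>+z. 2 * (D (?V (v, z)) * h (spherical (?V (v, z)))) \<partial>lborel)"
    proof (rule nn_integral_mono_AE, use ae in eventually_elim)
      fix z :: "real \<times> real" assume z: "snd z \<noteq> 2 * pi"
      show "h (v *\<^sub>R polar3 z) * indicator angles z * (ennreal (v\<^sup>2) * indicator {0<..} v)
        \<le> 2 * (D (?V (v, z)) * h (spherical (?V (v, z))))"
      proof (cases "z \<in> angles \<and> 0 < v")
        case True
        obtain a b where ab: "z = (a, b)" by force
        have a: "pi / 4 \<le> a" "a \<le> 3 * pi / 4" "0 \<le> b" "b < 2 * pi"
          using True z by (auto simp: ab angles_def)
        have "0 < a" "a < pi" using a pi_gt_zero by linarith+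
        then have D: "D (?V (v, z)) = ennreal (v\<^sup>2 * sin a)"
          using a True by (simp add: D_def spherical_domain_def ab)
        have "v\<^sup>2 \<le> 2 * (v\<^sup>2 * sin a)"
          using mult_left_mono[OF sin_ge_half[OF a(1,2)], of "2 * v\<^sup>2"] by simp
        then have "ennreal (v\<^sup>2) \<le> 2 * D (?V (v, z))"
          unfolding D by (metis ennreal_leI ennreal_mult' ennreal_numeral zero_le_numeral)
        moreover have "spherical (?V (v, z)) = v *\<^sub>R polar3 z" by (simp add: spherical_def ab)
        ultimately show ?thesis
          using True mult_left_mono[of "ennreal (v\<^sup>2)" "2 * D (?V (v, z))" "h (v *\<^sub>R polar3 z)"]
          by (simp add: ac_simps)
      qed (auto simp: indicator_def)
    qed
    also have "\<dots> = 2 * ?J v"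
      by (rule nn_integral_cmult) measurable
    finally show "?I v
      \<le> 2 * ?J v" .
  qed
  also have "\<dots> = 2 * (\<integral>\<^sup>+v. ?J v \<partial>lborel)"
    by (rule nn_integral_cmult) measurable
  also have "\<dots> \<le> 2 * (\<integral>\<^sup>+y. h y \<partial>lborel)" by (intro mult_left_mono main) simp
  finally show ?thesis .
qed

lemma nn_integral_polar1_le:
  fixes h :: "real^3 \<Rightarrow> ennreal"
  assumes [measurable]: "h \<in> borel_measurable borel"
  shows "(\<integral>\<^sup>+v. (\<integral>\<^sup>+z\<in>angles. h (v *\<^sub>R polar1 z) \<partial>lborel) * (ennreal (v\<^sup>2) * indicator {0<..} v) \<partial>lborel)
    \<le> 2 * (\<integral>\<^sup>+y. h y \<partial>lborel)"
proof -
  have [measurable]: "cycle_axes \<in> borel_measurable borel"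
    by (rule borel_measurable_continuous_onI[OF continuous_on_cycle_axes])
  have "v *\<^sub>R polar1 z = cycle_axes (v *\<^sub>R polar3 z)" for v z
    by (simp add: polar1_eq cycle_axes_def vec_eq_iff forall_3)
  moreover have "(\<integral>\<^sup>+y. h y \<partial>lborel) = (\<integral>\<^sup>+y. h (cycle_axes y) \<partial>lborel)"
    by (subst distr_lborel_cycle_axes[symmetric]) (simp add: nn_integral_distr)
  ultimately show ?thesis
    using nn_integral_polar3_le[of "\<lambda>y. h (cycle_axes y)"] by simp
qed

text \<open>
  The weight \<open>1 / norm y\<close> turns the volume factor \<open>v\<^sup>2\<close> into \<open>v\<close>, the factor that the radial wave
  equation produces.
\<close>

lemma nn_integral_polar_weight_le:
  fixes g :: "real^3 \<Rightarrow> real"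
  assumes P: "P \<in> {polar3, polar1}" and [measurable]: "g \<in> borel_measurable borel"
  shows "(\<integral>\<^sup>+v. (\<integral>\<^sup>+z\<in>angles. ennreal \<bar>g (v *\<^sub>R P z)\<bar> \<partial>lborel) * ennreal v \<partial>lborel)
    \<le> 2 * (\<integral>\<^sup>+y. ennreal (\<bar>g y\<bar> / norm y) \<partial>lborel)"
proof -
  let ?h = "\<lambda>y. ennreal (\<bar>g y\<bar> / norm y)"
  have nP: "norm (P z) = 1" for z using P norm_polar3[of z] norm_polar1[of z] by (metis insertE singletonD)
  have [measurable]: "P \<in> borel_measurable borel"
    using P continuous_on_polar by (auto intro: borel_measurable_continuous_onI)
  have "(\<integral>\<^sup>+z\<in>angles. ennreal \<bar>g (v *\<^sub>R P z)\<bar> \<partial>lborel) * ennreal v =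
     (\<integral>\<^sup>+z\<in>angles. ?h (v *\<^sub>R P z) \<partial>lborel) * (ennreal (v\<^sup>2) * indicator {0<..} v)" for v
  proof (cases "v > 0")
    case True
    have "ennreal \<bar>g (v *\<^sub>R P z)\<bar> = ?h (v *\<^sub>R P z) * ennreal v" for z
      using True by (simp add: nP ennreal_mult[symmetric])
    then have "(\<integral>\<^sup>+z\<in>angles. ennreal \<bar>g (v *\<^sub>R P z)\<bar> \<partial>lborel)
        = (\<integral>\<^sup>+z. ?h (v *\<^sub>R P z) * indicator angles z * ennreal v \<partial>lborel)"
      by (intro nn_integral_cong) (simp add: ac_simps)
    also have "\<dots> = (\<integral>\<^sup>+z\<in>angles. ?h (v *\<^sub>R P z) \<partial>lborel) * ennreal v"
      by (rule nn_integral_multc) measurable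
    finally show ?thesis using True by (simp add: mult.assoc ennreal_mult[symmetric] power2_eq_square)
  qed (simp add: ennreal_neg)
  then show ?thesis
    using P nn_integral_polar3_le[of ?h] nn_integral_polar1_le[of ?h] by auto
qed

lemma nn_integral_angles:
  assumes [measurable]: "f \<in> borel_measurable borel"
  shows "(\<integral>\<^sup>+z\<in>angles. f z \<partial>lborel) = (\<integral>\<^sup>+a\<in>{pi / 4..3 * pi / 4}. (\<integral>\<^sup>+b\<in>{0..2 * pi}. f (a, b) \<partial>lborel) \<partial>lborel)"
    and "(\<integral>\<^sup>+z\<in>angles. f z \<partial>lborel) = (\<integral>\<^sup>+b\<in>{0..2 * pi}. (\<integral>\<^sup>+a\<in>{pi / 4..3 * pi / 4}. f (a, b) \<partial>lborel) \<partial>lborel)"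
proof -
  let ?A = "{pi / 4..3 * pi / 4}" and ?B = "{0..2 * pi}"
  have m: "(\<lambda>z. f z * indicator angles z) \<in> borel_measurable (lborel \<Otimes>\<^sub>M lborel)"
    unfolding lborel_prod by measurable
  have "(\<integral>\<^sup>+z\<in>angles. f z \<partial>lborel) = (\<integral>\<^sup>+z. f z * indicator angles z \<partial>(lborel \<Otimes>\<^sub>M lborel))"
    unfolding lborel_prod ..
  also have "\<dots> = (\<integral>\<^sup>+a. (\<integral>\<^sup>+b. f (a, b) * indicator angles (a, b) \<partial>lborel) \<partial>lborel)"
    by (rule lborel.nn_integral_fst[OF m, symmetric])
  finally have 1: "(\<integral>\<^sup>+z\<in>angles. f z \<partial>lborel) = \<dots>" .
  also have "\<dots> = (\<integral>\<^sup>+a. (\<integral>\<^sup>+b. f (a, b) * indicator ?B b * indicator ?A a \<partial>lborel) \<partial>lborel)"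
    by (intro nn_integral_cong) (simp add: angles_def indicator_times ac_simps)
  also have "\<dots> = (\<integral>\<^sup>+a\<in>?A. (\<integral>\<^sup>+b\<in>?B. f (a, b) \<partial>lborel) \<partial>lborel)"
    by (intro nn_integral_cong nn_integral_multc) measurable
  finally show "(\<integral>\<^sup>+z\<in>angles. f z \<partial>lborel) = (\<integral>\<^sup>+a\<in>?A. (\<integral>\<^sup>+b\<in>?B. f (a, b) \<partial>lborel) \<partial>lborel)" .
  have "(\<integral>\<^sup>+z\<in>angles. f z \<partial>lborel) = (\<integral>\<^sup>+b. (\<integral>\<^sup>+a. f (a, b) * indicator angles (a, b) \<partial>lborel) \<partial>lborel)"
    unfolding 1 by (rule lborel_pair.Fubini') (use m in \<open>simp add: case_prod_unfold\<close>)
  also have "\<dots> = (\<integral>\<^sup>+b. (\<integral>\<^sup>+a. f (a, b) * indicator ?A a * indicator ?B b \<partial>lborel) \<partial>lborel)"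
    by (intro nn_integral_cong) (simp add: angles_def indicator_times ac_simps)
  also have "\<dots> = (\<integral>\<^sup>+b\<in>?B. (\<integral>\<^sup>+a\<in>?A. f (a, b) \<partial>lborel) \<partial>lborel)"
    by (intro nn_integral_cong nn_integral_multc) measurable
  finally show "(\<integral>\<^sup>+z\<in>angles. f z \<partial>lborel) = (\<integral>\<^sup>+b\<in>?B. (\<integral>\<^sup>+a\<in>?A. f (a, b) \<partial>lborel) \<partial>lborel)" .
qed

lemma nn_integral_angles_swap:
  fixes N :: "real \<times> real \<Rightarrow> real \<Rightarrow> ennreal"
  assumes N: "(\<lambda>q. N (fst q) (snd q)) \<in> borel_measurable borel" and A: "A \<in> sets borel"
  shows "(\<integral>\<^sup>+z\<in>angles. (\<integral>\<^sup>+l\<in>A. N z l \<partial>lborel) \<partial>lborel) = (\<integral>\<^sup>+l\<in>A. (\<integral>\<^sup>+z\<in>angles. N z l \<partial>lborel) \<partial>lborel)"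
proof -
  have "(\<lambda>l. N z l) \<in> borel_measurable borel" for z
  proof -
    have "(\<lambda>l. (z, l)) \<in> borel_measurable borel"
      by (intro borel_measurable_continuous_onI continuous_intros)
    from measurable_compose[OF this N] show ?thesis by simp
  qed
  then have N1: "(\<lambda>l. N z l * indicator A l) \<in> borel_measurable lborel" for z
    using A by (intro borel_measurable_times_ennreal borel_measurable_indicator) simp_all
  have "(\<lambda>z. N z l) \<in> borel_measurable borel" for l
  proof -
    have "(\<lambda>z. (z, l)) \<in> borel_measurable borel"
      by (intro borel_measurable_continuous_onI continuous_intros)
    from measurable_compose[OF this N] show ?thesis by simp
  qed
  then have N2: "(\<lambda>z. N z l * indicator angles z) \<in> borel_measurable lborel" for l
    by (intro borel_measurable_times_ennreal borel_measurable_indicator) simp_all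
  have "angles \<times> A \<in> sets borel" using A by (intro borel_Times borel_angles)
  then have "(\<lambda>q. N (fst q) (snd q) * indicator (angles \<times> A) q) \<in> borel_measurable borel"
    by (intro borel_measurable_times_ennreal N borel_measurable_indicator)
  then have N3: "(\<lambda>(z, l). N z l * indicator A l * indicator angles z) \<in> borel_measurable (lborel \<Otimes>\<^sub>M lborel)"
    by (simp add: lborel_prod case_prod_unfold indicator_times ac_simps)
  have "(\<integral>\<^sup>+z\<in>angles. (\<integral>\<^sup>+l\<in>A. N z l \<partial>lborel) \<partial>lborel) =
      (\<integral>\<^sup>+z. (\<integral>\<^sup>+l. N z l * indicator A l * indicator angles z \<partial>lborel) \<partial>lborel)"
    by (intro nn_integral_cong nn_integral_multc[symmetric] N1)
  also have "\<dots> = (\<integral>\<^sup>+l. (\<integral>\<^sup>+z. N z l * indicator A l * indicator angles z \<partial>lborel) \<partial>lborel)"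
    by (rule lborel_pair.Fubini'[OF N3, symmetric])
  also have "\<dots> = (\<integral>\<^sup>+l. (\<integral>\<^sup>+z. N z l * indicator angles z * indicator A l \<partial>lborel) \<partial>lborel)"
    by (simp add: ac_simps)
  also have "\<dots> = (\<integral>\<^sup>+l\<in>A. (\<integral>\<^sup>+z\<in>angles. N z l \<partial>lborel) \<partial>lborel)"
    by (intro nn_integral_cong nn_integral_multc N2)
  finally show ?thesis .
qed

text \<open>
  The bound on the third coordinate says exactly that the polar distance lies in \<open>angles\<close>.
\<close>

lemma polar3_surj:
  assumes "norm \<theta> = 1" "(\<theta> $ 3)\<^sup>2 \<le> 1 / 2"
  obtains z where "z \<in> angles" "polar3 z = \<theta>"
proof -
  have n: "(\<theta> $ 1)\<^sup>2 + (\<theta> $ 2)\<^sup>2 + (\<theta> $ 3)\<^sup>2 = 1"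
    using assms(1) by (simp add: norm_eq_1 inner_vec_def sum_3 power2_eq_square)
  have "\<bar>\<theta> $ 3\<bar> \<le> sqrt (1 / 2)" using assms(2) real_le_rsqrt[of "\<bar>\<theta> $ 3\<bar>" "1/2"] by simp
  moreover have "sqrt (1 / 2) = cos (pi / 4)"
    by (simp add: cos_45 real_sqrt_divide field_simps)
  ultimately have le: "\<theta> $ 3 \<le> cos (pi / 4)" "- cos (pi / 4) \<le> \<theta> $ 3" by linarith+
  define a where "a = arccos (\<theta> $ 3)"
  have r: "-1 \<le> \<theta> $ 3" "\<theta> $ 3 \<le> 1" using le cos_le_one[of "pi / 4"] by linarith+
  have ca: "cos a = \<theta> $ 3" unfolding a_def using r by (rule cos_arccos)
  have a0: "0 \<le> a" "a \<le> pi" unfolding a_def using r by (auto intro: arccos_lbound arccos_ubound)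
  have a1: "pi / 4 \<le> a"
  proof (rule ccontr)
    assume "\<not> pi / 4 \<le> a"
    then have "cos (pi / 4) < cos a" using a0 pi_gt_zero by (intro cos_monotone_0_pi) linarith+
    then show False using le ca by linarith
  qed
  have a2: "a \<le> 3 * pi / 4"
  proof (rule ccontr)
    assume "\<not> a \<le> 3 * pi / 4"
    then have "cos a < cos (pi - pi / 4)" using a0 pi_gt_zero by (intro cos_monotone_0_pi) linarith+
    then show False using le ca by (simp only: cos_pi_minus)
  qed
  have sa: "sin a \<noteq> 0" using sin_ge_half[OF a1 a2] by linarith
  have s2: "(sin a)\<^sup>2 = (\<theta> $ 1)\<^sup>2 + (\<theta> $ 2)\<^sup>2"
    using n sin_squared_eq[of a] ca by simp
  have "(\<theta> $ 1 / sin a)\<^sup>2 + (\<theta> $ 2 / sin a)\<^sup>2 = 1"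
    using sa by (simp add: power_divide add_divide_distrib[symmetric] s2[symmetric])
  then obtain b where b: "0 \<le> b" "b < 2 * pi" "\<theta> $ 1 / sin a = cos b" "\<theta> $ 2 / sin a = sin b"
    by (rule sincos_total_2pi)
  show ?thesis
  proof
    show "(a, b) \<in> angles" using a1 a2 b by (auto simp: angles_def)
    show "polar3 (a, b) = \<theta>"
      using b(3,4)[symmetric] sa by (simp add: vec_eq_iff forall_3 polar3_def ca)
  qed
qed

text \<open>
  The first and the third coordinate of a unit vector cannot both have square greater than \<open>1 / 2\<close>.
\<close>

lemma polar_chart_cover:
  assumes "norm \<theta> = 1"
  obtains P z where "P \<in> {polar3, polar1}" "z \<in> angles" "P z = \<theta>"
proof (cases "(\<theta> $ 3)\<^sup>2 \<le> 1 / 2")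
  case True
  from polar3_surj[OF assms this] show ?thesis using that by blast
next
  case False
  have n: "(\<theta> $ 1)\<^sup>2 + (\<theta> $ 2)\<^sup>2 + (\<theta> $ 3)\<^sup>2 = 1"
    using assms by (simp add: norm_eq_1 inner_vec_def sum_3 power2_eq_square)
  let ?\<phi> = "vector [\<theta> $ 2, \<theta> $ 3, \<theta> $ 1] :: real^3"
  have "norm ?\<phi> = 1" using n by (simp add: norm_eq_1 inner_vec_def sum_3 power2_eq_square)
  moreover have "(\<theta> $ 1)\<^sup>2 \<le> 1 / 2" using n False zero_le_power2[of "\<theta> $ 2"] by linarith
  then have "(?\<phi> $ 3)\<^sup>2 \<le> 1 / 2" by simp
  ultimately obtain z where z: "z \<in> angles" "polar3 z = ?\<phi>" by (rule polar3_surj)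
  have "polar1 z = \<theta>" by (simp add: polar1_eq z cycle_axes_def vec_eq_iff forall_3)
  then show ?thesis using that z by blast
qed

text \<open>
  Together with \<open>polar3_b\<close> the unit tangent vectors in the directions of increasing polar distance and
  increasing azimuth. The azimuthal one is normalized, so it is regular at the poles.
\<close>

definition polar3_a :: "real \<times> real \<Rightarrow> real^3" where
  "polar3_a z = vector [cos (fst z) * cos (snd z), cos (fst z) * sin (snd z), - sin (fst z)]"

definition polar3_b :: "real \<times> real \<Rightarrow> real^3" where
  "polar3_b z = vector [- sin (snd z), cos (snd z), 0]"

lemma vector3_eq_sum_axis: "(vector [p, q, r] :: real^3) = p *\<^sub>R axis 1 1 + q *\<^sub>R axis 2 1 + r *\<^sub>R axis 3 1"
  by (auto simp: vec_eq_iff forall_3 axis_def)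

lemma has_vector_derivative_vector3:
  assumes "(f has_real_derivative f') (at x within S)" "(g has_real_derivative g') (at x within S)"
     "(h has_real_derivative h') (at x within S)"
  shows "((\<lambda>x. vector [f x, g x, h x] :: real^3) has_vector_derivative vector [f', g', h']) (at x within S)"
proof -
  have "((\<lambda>x. f x *\<^sub>R axis 1 1 + g x *\<^sub>R axis 2 1 + h x *\<^sub>R (axis 3 1 :: real^3)) has_vector_derivative
     (f x *\<^sub>R 0 + f' *\<^sub>R axis 1 1) + (g x *\<^sub>R 0 + g' *\<^sub>R axis 2 1) + (h x *\<^sub>R 0 + h' *\<^sub>R axis 3 1)) (at x within S)"
    by (intro has_vector_derivative_add has_vector_derivative_scaleR has_vector_derivative_const assms)
  then show ?thesis by (simp only: vector3_eq_sum_axis scaleR_zero_right add_0_left)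
qed

text \<open>
  The structure equations of the moving frame; they take the place of Christoffel symbols in the
  integration by parts over the sphere.
\<close>

lemma polar3_derivatives:
  "((\<lambda>a. polar3 (a, b)) has_vector_derivative polar3_a (a, b)) (at a within S)"
  "((\<lambda>b. polar3 (a, b)) has_vector_derivative sin a *\<^sub>R polar3_b (a, b)) (at b within S)"
  "((\<lambda>a. polar3_a (a, b)) has_vector_derivative - polar3 (a, b)) (at a within S)"
  "((\<lambda>b. polar3_b (a, b)) has_vector_derivative - (sin a *\<^sub>R polar3 (a, b) + cos a *\<^sub>R polar3_a (a, b))) (at b within S)"
proof -
  have e: "sin a *\<^sub>R polar3_b (a, b) = vector [- (sin a * sin b), sin a * cos b, 0]"
    "- polar3 (a, b) = vector [- (sin a * cos b), - (sin a * sin b), - cos a]"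
    by (simp_all add: vec_eq_iff forall_3 polar3_b_def polar3_def)
  \<comment> \<open>lets \<open>simp\<close> apply the Pythagorean identity inside longer products\<close>
  have pyth: "sin a * (sin a * X) + cos a * (cos a * X) = X" for X
    by (simp add: mult.assoc[symmetric] power2_eq_square[symmetric] distrib_right[symmetric])
  have e': "- (sin a *\<^sub>R polar3 (a, b) + cos a *\<^sub>R polar3_a (a, b)) = vector [- cos b, - sin b, 0]"
    using pyth[of "cos b"] pyth[of "sin b"]
    by (simp add: vec_eq_iff forall_3 polar3_def polar3_a_def)
  show "((\<lambda>a. polar3 (a, b)) has_vector_derivative polar3_a (a, b)) (at a within S)"
    unfolding polar3_def polar3_a_def fst_conv snd_conv
    by (rule has_vector_derivative_vector3) (auto intro!: derivative_eq_intros)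
  show "((\<lambda>b. polar3 (a, b)) has_vector_derivative sin a *\<^sub>R polar3_b (a, b)) (at b within S)"
    unfolding e polar3_def fst_conv snd_conv
    by (rule has_vector_derivative_vector3) (auto intro!: derivative_eq_intros)
  show "((\<lambda>a. polar3_a (a, b)) has_vector_derivative - polar3 (a, b)) (at a within S)"
    unfolding e polar3_a_def fst_conv snd_conv
    by (rule has_vector_derivative_vector3) (auto intro!: derivative_eq_intros)
  show "((\<lambda>b. polar3_b (a, b)) has_vector_derivative - (sin a *\<^sub>R polar3 (a, b) + cos a *\<^sub>R polar3_a (a, b))) (at b within S)"
    unfolding e' polar3_b_def fst_conv snd_conv
    by (rule has_vector_derivative_vector3) (auto intro!: derivative_eq_intros)
qed

lemma polar3_orthonormal:
  "polar3 z \<bullet> polar3 z = 1" "polar3_a z \<bullet> polar3_a z = 1" "polar3_b z \<bullet> polar3_b z = 1"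
  "polar3 z \<bullet> polar3_a z = 0" "polar3 z \<bullet> polar3_b z = 0" "polar3_a z \<bullet> polar3_b z = 0"
proof -
  define s c S C where *: "s = sin (fst z)" "c = cos (fst z)" "S = sin (snd z)" "C = cos (snd z)"
  have sc: "s\<^sup>2 + c\<^sup>2 = 1" "S\<^sup>2 + C\<^sup>2 = 1" by (simp_all add: *)
  have "polar3 z \<bullet> polar3 z = s\<^sup>2 * (S\<^sup>2 + C\<^sup>2) + c\<^sup>2" "polar3_a z \<bullet> polar3_a z = c\<^sup>2 * (S\<^sup>2 + C\<^sup>2) + s\<^sup>2"
    "polar3_b z \<bullet> polar3_b z = S\<^sup>2 + C\<^sup>2" "polar3 z \<bullet> polar3_a z = s * c * (S\<^sup>2 + C\<^sup>2) - s * c"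
    unfolding polar3_def polar3_a_def polar3_b_def *[symmetric] inner_vec_def sum_3
    by (simp_all add: power2_eq_square algebra_simps)
  then show "polar3 z \<bullet> polar3 z = 1" "polar3_a z \<bullet> polar3_a z = 1" "polar3_b z \<bullet> polar3_b z = 1"
    "polar3 z \<bullet> polar3_a z = 0" using sc by (simp_all add: add.commute)
  show "polar3 z \<bullet> polar3_b z = 0" "polar3_a z \<bullet> polar3_b z = 0"
    unfolding polar3_def polar3_a_def polar3_b_def inner_vec_def sum_3 by simp_all
qed

lemma continuous_on_polar3_ab: "continuous_on S polar3_a" "continuous_on S polar3_b"
  unfolding polar3_a_def[abs_def] polar3_b_def[abs_def]
  by (rule continuous_on_vector3; intro continuous_intros)+

definition polar1_a :: "real \<times> real \<Rightarrow> real^3" where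
  "polar1_a z = vector [- sin (fst z), cos (fst z) * cos (snd z), cos (fst z) * sin (snd z)]"

lemma polar1_derivatives:
  "((\<lambda>a. polar1 (a, b)) has_vector_derivative polar1_a (a, b)) (at a within S)"
  "((\<lambda>b. polar1 (a, b)) has_vector_derivative vector [0, - (sin a * sin b), sin a * cos b]) (at b within S)"
proof -
  show "((\<lambda>a. polar1 (a, b)) has_vector_derivative polar1_a (a, b)) (at a within S)"
    unfolding polar1_def polar1_a_def fst_conv snd_conv
    by (rule has_vector_derivative_vector3) (auto intro!: derivative_eq_intros)
  show "((\<lambda>b. polar1 (a, b)) has_vector_derivative vector [0, - (sin a * sin b), sin a * cos b]) (at b within S)"
    unfolding polar1_def fst_conv snd_conv
    by (rule has_vector_derivative_vector3) (auto intro!: derivative_eq_intros)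
qed

section \<open>Kirchhoff's formula\<close>

text \<open>
  The trace of a bilinear form is the same in all orthonormal bases: a square matrix with orthonormal
  rows has orthonormal columns.
\<close>

lemma orthonormal_trace:
  fixes v :: "3 \<Rightarrow> real^3" and M :: "3 \<Rightarrow> 3 \<Rightarrow> real"
  assumes "\<And>k l. v k \<bullet> v l = (if k = l then 1 else 0)"
  shows "(\<Sum>k\<in>UNIV. \<Sum>i\<in>UNIV. \<Sum>j\<in>UNIV. v k $ i * v k $ j * M i j) = (\<Sum>i\<in>UNIV. M i i)"
proof -
  define N :: "real^3^3" where "N = (\<chi> k. v k)"
  have "N ** transpose N = mat 1"
    using assms by (simp add: N_def matrix_matrix_mult_def transpose_def mat_def vec_eq_iff inner_vec_def)
  then have N: "transpose N ** N = mat 1"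
    using matrix_left_right_inverse by blast
  have *: "(\<Sum>k\<in>UNIV. v k $ i * v k $ j) = (if i = j then 1 else 0)" for i j
    using arg_cong[OF N, of "\<lambda>A. A $ i $ j"]
    by (simp add: N_def matrix_matrix_mult_def transpose_def mat_def)
  have "(\<Sum>k\<in>UNIV. \<Sum>i\<in>UNIV. \<Sum>j\<in>UNIV. v k $ i * v k $ j * M i j) =
     (\<Sum>i\<in>UNIV. \<Sum>j\<in>UNIV. (\<Sum>k\<in>UNIV. v k $ i * v k $ j) * M i j)"
    by (simp add: sum_3 algebra_simps)
  also have "\<dots> = (\<Sum>i\<in>UNIV. M i i)"
    unfolding * by (simp add: if_distrib[of "\<lambda>x. x * _"] cong: if_cong)
  finally show ?thesis .
qed

definition directional :: "real \<Rightarrow> (spacetime \<Rightarrow> real) \<Rightarrow> real^3 \<Rightarrow> spacetime \<Rightarrow> real" where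
  "directional t g v p = (\<Sum>i\<in>UNIV. v $ i * dx t i g p)"

text \<open>
  The second derivative in the directions \<open>u\<close> and \<open>v\<close>, as a bilinear form with constant vectors
  \<open>u\<close>, \<open>v\<close>.
\<close>

definition second_form :: "real \<Rightarrow> (spacetime \<Rightarrow> real) \<Rightarrow> real^3 \<Rightarrow> real^3 \<Rightarrow> spacetime \<Rightarrow> real" where
  "second_form t g u v p = (\<Sum>i\<in>UNIV. v $ i * (\<Sum>j\<in>UNIV. u $ j * dx t j (dx t i g) p))"

lemma directional_simps:
  "directional t g (u + v) p = directional t g u p + directional t g v p"
  "directional t g (c *\<^sub>R v) p = c * directional t g v p"
  "directional t g (- v) p = - directional t g v p"
  "directional t g (u - v) p = directional t g u p - directional t g v p"
  by (simp_all add: directional_def sum_3 algebra_simps)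

lemma second_form_scaleR: "second_form t g (c *\<^sub>R u) v p = c * second_form t g u v p"
  by (simp add: second_form_def sum_3 algebra_simps)

lemma directional_has_derivative:
  assumes t: "t > 0" and g: "Ck_on 2 (strip t) g"
    and s: "(s has_real_derivative s') (at \<tau> within I)"
    and y: "(y has_vector_derivative y') (at \<tau> within I)"
    and v: "(v has_vector_derivative v') (at \<tau> within I)"
    and I: "\<tau> \<in> I" "\<And>\<tau>. \<tau> \<in> I \<Longrightarrow> s \<tau> \<in> {0..t}"
  shows "((\<lambda>\<tau>. directional t g (v \<tau>) (s \<tau>, y \<tau>)) has_real_derivative
    (directional t g v' (s \<tau>, y \<tau>) + s' * (\<Sum>i\<in>UNIV. v \<tau> $ i * dt t (dx t i g) (s \<tau>, y \<tau>))
      + second_form t g y' (v \<tau>) (s \<tau>, y \<tau>))) (at \<tau> within I)"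
proof -
  have "Ck_on (Suc 0) (strip t) (dx t i g)" for i
    using t g by (auto intro!: Ck_on_D_x simp: numeral_2_eq_2 simp del: Ck_on.simps)
  then have d: "dx t i g differentiable_on strip t" for i by simp
  have vi: "((\<lambda>\<tau>. v \<tau> $ i) has_real_derivative v' $ i) (at \<tau> within I)" for i
    using bounded_linear.has_vector_derivative[OF bounded_linear_vec_nth v, of i]
    by (simp add: has_real_derivative_iff_has_vector_derivative)
  have "((\<lambda>\<tau>. \<Sum>i\<in>UNIV. v \<tau> $ i * dx t i g (s \<tau>, y \<tau>)) has_real_derivative
    (\<Sum>i\<in>UNIV. v' $ i * dx t i g (s \<tau>, y \<tau>) + 
      (s' * dt t (dx t i g) (s \<tau>, y \<tau>) + (\<Sum>j\<in>UNIV. y' $ j * dx t j (dx t i g) (s \<tau>, y \<tau>))) * v \<tau> $ i)) (at \<tau> within I)"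
    by (intro DERIV_sum DERIV_mult vi strip_chain_rule[OF d s y I])
  then show ?thesis
    unfolding directional_def second_form_def
    by (rule DERIV_cong) (simp add: sum.distrib sum_distrib_left algebra_simps)
qed

lemma continuous_on_directional:
  assumes t: "t > 0" and g: "Ck_on (Suc 0) (strip t) g"
    and c: "continuous_on A s" "continuous_on A y" "continuous_on A v" "\<And>x. x \<in> A \<Longrightarrow> s x \<in> {0..t}"
  shows "continuous_on A (\<lambda>x. directional t g (v x) (s x, y x))"
proof -
  have "continuous_on (strip t) (dx t i g)" for i
    using Ck_on_D_x[OF t g] by simp
  then show ?thesis unfolding directional_def
    by (intro continuous_intros continuous_on_strip_compose c(1-3)) (use c(4) in auto)
qed

lemma continuous_on_second_form:
  assumes t: "t > 0" and g: "Ck_on 2 (strip t) g"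
    and c: "continuous_on A s" "continuous_on A y" "continuous_on A u" "continuous_on A v" "\<And>x. x \<in> A \<Longrightarrow> s x \<in> {0..t}"
  shows "continuous_on A (\<lambda>x. second_form t g (u x) (v x) (s x, y x))"
proof -
  have "Ck_on (Suc 0) (strip t) (dx t i g)" for i
    using t g by (auto intro!: Ck_on_D_x simp: numeral_2_eq_2 simp del: Ck_on.simps)
  from Ck_on_D_x[OF t this] have "continuous_on (strip t) (dx t j (dx t i g))" for i j by simp
  then show ?thesis unfolding second_form_def
    by (intro continuous_intros continuous_on_strip_compose c(1-4)) (use c(5) in auto)
qed

text \<open>
  The Laplacian in the moving frame. The isometry \<open>T\<close> is there to put the pole of the spherical
  coordinates at any desired point.
\<close>

lemma second_form_trace:
  assumes T: "orthogonal_transformation T"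
  shows "second_form t g (T (polar3 z)) (T (polar3 z)) p + second_form t g (T (polar3_a z)) (T (polar3_a z)) p
    + second_form t g (T (polar3_b z)) (T (polar3_b z)) p = (\<Sum>i\<in>UNIV. dx t i (dx t i g) p)"
proof -
  define v :: "3 \<Rightarrow> real^3" where "v k = T (if k = 1 then polar3 z else if k = 2 then polar3_a z else polar3_b z)" for k
  have inner: "T a \<bullet> T b = a \<bullet> b" for a b using T by (simp add: orthogonal_transformation_def)
  have "v k \<bullet> v l = (if k = l then 1 else 0)" for k l
    using exhaust_3[of k] exhaust_3[of l] polar3_orthonormal[of z]
    by (auto simp: v_def inner inner_commute)
  from orthonormal_trace[OF this, of "\<lambda>i j. dx t j (dx t i g) p"] show ?thesis
    by (simp add: sum_3 v_def second_form_def algebra_simps)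
qed

text \<open>
  With the factor \<open>\<rho>\<close> added, the integrand is \<open>sin a\<close> times the spherical Laplacian of \<open>g\<close> on the
  sphere of radius \<open>\<rho>\<close> about \<open>x\<close>. It is the divergence of the tangential gradient in the moving
  frame, \<open>H1\<close> being the derivative in the polar distance and \<open>H2\<close> the one in the azimuth. The first
  integrates to zero because \<open>sin\<close> vanishes at both poles, the second by periodicity. Dividing by
  \<open>\<rho>\<close> keeps everything regular at \<open>\<rho> = 0\<close>.
\<close>

lemma integral_spherical_laplacian:
  assumes t: "t > 0" and g: "Ck_on 2 (strip t) g" and T: "orthogonal_transformation T"
    and s: "s \<in> {0..t}"
  shows "integral (cbox (0, 0) (pi, 2 * pi)) (\<lambda>z. sin (fst z) *
    (\<rho> * (second_form t g (T (polar3_a z)) (T (polar3_a z)) (s, x + \<rho> *\<^sub>R T (polar3 z))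
        + second_form t g (T (polar3_b z)) (T (polar3_b z)) (s, x + \<rho> *\<^sub>R T (polar3 z)))
     - 2 * directional t g (T (polar3 z)) (s, x + \<rho> *\<^sub>R T (polar3 z)))) = 0"
proof -
  have bT: "bounded_linear T"
    using T by (simp add: orthogonal_transformation_def linear_conv_bounded_linear)
  interpret bounded_linear T by (rule bT)
  have g1: "Ck_on (Suc 0) (strip t) g" using g by (rule Ck_on_le) simp
  have cT: "continuous_on A (\<lambda>z. T (f z))" if "continuous_on A f" for A f
    using that by (rule continuous_on)
  note cP = cT[OF continuous_on_polar(1)] cT[OF continuous_on_polar3_ab(1)] cT[OF continuous_on_polar3_ab(2)]
  let ?y = "\<lambda>z. x + \<rho> *\<^sub>R T (polar3 z)"
  let ?Da = "\<lambda>z. directional t g (T (polar3_a z)) (s, ?y z)"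
  let ?Db = "\<lambda>z. directional t g (T (polar3_b z)) (s, ?y z)"
  let ?D = "\<lambda>z. directional t g (T (polar3 z)) (s, ?y z)"
  let ?Sa = "\<lambda>z. second_form t g (T (polar3_a z)) (T (polar3_a z)) (s, ?y z)"
  let ?Sb = "\<lambda>z. second_form t g (T (polar3_b z)) (T (polar3_b z)) (s, ?y z)"
  define H1 where "H1 z = cos (fst z) * ?Da z + sin (fst z) * (\<rho> * ?Sa z - ?D z)" for z
  define H2 where "H2 z = \<rho> * (sin (fst z) * ?Sb z) - sin (fst z) * ?D z - cos (fst z) * ?Da z" for z
  let ?B = "cbox (0, 0) (pi, 2 * pi)"
  have cy: "continuous_on UNIV ?y" by (intro continuous_intros cP)
  have cD: "continuous_on UNIV ?D" "continuous_on UNIV ?Da" "continuous_on UNIV ?Sa" "continuous_on UNIV ?Sb"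
    by (intro continuous_on_directional[OF t g1] continuous_on_second_form[OF t g] continuous_on_const cy cP s)+
  have cH: "continuous_on UNIV H1" "continuous_on UNIV H2"
    unfolding H1_def[abs_def] H2_def[abs_def] by (intro continuous_intros cD)+
  have dya: "((\<lambda>a. ?y (a, b)) has_vector_derivative \<rho> *\<^sub>R T (polar3_a (a, b))) (at a within A)" for a b A
    by (auto intro!: derivative_eq_intros has_vector_derivative polar3_derivatives)
  have dyb: "((\<lambda>b. ?y (a, b)) has_vector_derivative \<rho> *\<^sub>R sin a *\<^sub>R T (polar3_b (a, b))) (at b within A)" for a b A
    using has_vector_derivative[OF polar3_derivatives(2)[of a b A]]
    by (auto intro!: derivative_eq_intros simp: scaleR)
  have d1: "((\<lambda>a. sin a * ?Da (a, b)) has_vector_derivative H1 (a, b)) (at a within {0..pi})"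
    if "a \<in> {0..pi}" for a b
  proof -
    have "((\<lambda>a. ?Da (a, b)) has_real_derivative
      (directional t g (T (- polar3 (a, b))) (s, ?y (a, b)) + 0 * (\<Sum>i\<in>UNIV. T (polar3_a (a, b)) $ i * dt t (dx t i g) (s, ?y (a, b)))
      + second_form t g (\<rho> *\<^sub>R T (polar3_a (a, b))) (T (polar3_a (a, b))) (s, ?y (a, b)))) (at a within {0..pi})"
      by (rule directional_has_derivative[OF t g DERIV_const dya has_vector_derivative[OF polar3_derivatives(3)] that s])
    from DERIV_mult[OF has_field_derivative_at_within[OF DERIV_sin] this] show ?thesis
      unfolding has_real_derivative_iff_has_vector_derivative[symmetric]
      by (rule DERIV_cong) (simp add: H1_def directional_simps second_form_scaleR neg algebra_simps)
  qed
  have d2: "((\<lambda>b. ?Db (a, b)) has_vector_derivative H2 (a, b)) (at b within {0..2 * pi})"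
    if "b \<in> {0..2 * pi}" for a b
  proof -
    have "((\<lambda>b. ?Db (a, b)) has_real_derivative
      (directional t g (T (- (sin a *\<^sub>R polar3 (a, b) + cos a *\<^sub>R polar3_a (a, b)))) (s, ?y (a, b))
        + 0 * (\<Sum>i\<in>UNIV. T (polar3_b (a, b)) $ i * dt t (dx t i g) (s, ?y (a, b)))
      + second_form t g (\<rho> *\<^sub>R sin a *\<^sub>R T (polar3_b (a, b))) (T (polar3_b (a, b))) (s, ?y (a, b)))) (at b within {0..2 * pi})"
      by (rule directional_has_derivative[OF t g DERIV_const dyb has_vector_derivative[OF polar3_derivatives(4)] that s])
    then show ?thesis
      unfolding has_real_derivative_iff_has_vector_derivative[symmetric]
      by (rule DERIV_cong) (simp add: H2_def directional_simps second_form_scaleR neg add diff scaleR algebra_simps)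
  qed
  have i1: "integral {0..pi} (\<lambda>a. H1 (a, b)) = 0" for b
  proof -
    have "((\<lambda>a. H1 (a, b)) has_integral sin pi * ?Da (pi, b) - sin 0 * ?Da (0, b)) {0..pi}"
      by (rule fundamental_theorem_of_calculus[OF _ d1]) auto
    then show ?thesis by (simp add: integral_unique)
  qed
  have i2: "integral {0..2 * pi} (\<lambda>b. H2 (a, b)) = 0" for a
  proof -
    have "((\<lambda>b. H2 (a, b)) has_integral ?Db (a, 2 * pi) - ?Db (a, 0)) {0..2 * pi}"
      by (rule fundamental_theorem_of_calculus[OF _ d2]) auto
    moreover have "?Db (a, 2 * pi) = ?Db (a, 0)" by (simp add: polar3_def polar3_b_def)
    ultimately show ?thesis by (simp add: integral_unique)
  qed
  have "integral ?B H1 = integral (cbox 0 pi) (\<lambda>a. integral (cbox 0 (2 * pi)) (\<lambda>b. H1 (a, b)))"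
    by (rule integral_prod_continuous) (rule continuous_on_subset[OF cH(1)], simp)
  also have "\<dots> = integral (cbox 0 (2 * pi)) (\<lambda>b. integral (cbox 0 pi) (\<lambda>a. H1 (a, b)))"
    using continuous_on_subset[OF cH(1)] by (intro integral_swap_continuous) (auto simp: case_prod_unfold)
  also have "\<dots> = 0" using i1 by simp
  finally have I1: "integral ?B H1 = 0" .
  have "integral ?B H2 = integral (cbox 0 pi) (\<lambda>a. integral (cbox 0 (2 * pi)) (\<lambda>b. H2 (a, b)))"
    by (rule integral_prod_continuous) (rule continuous_on_subset[OF cH(2)], simp)
  also have "\<dots> = 0" using i2 by simp
  finally have I2: "integral ?B H2 = 0" .
  have "integral ?B (\<lambda>z. H1 z + H2 z) = 0"
    using I1 I2 by (subst integral_add)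
      (auto intro: integrable_continuous continuous_on_subset[OF cH(1)] continuous_on_subset[OF cH(2)])
  moreover have "(\<lambda>z. H1 z + H2 z) = (\<lambda>z. sin (fst z) * (\<rho> * (?Sa z + ?Sb z) - 2 * ?D z))"
    by (rule ext) (simp add: H1_def H2_def algebra_simps)
  ultimately show ?thesis by simp
qed

text \<open>
  Put \<open>u = \<rho> * w\<close> along a ray from \<open>x\<close>. The wave equation says that \<open>(\<partial>\<^sub>s - \<partial>\<^sub>\<rho>) (\<partial>\<^sub>s + \<partial>\<^sub>\<rho>) u\<close> equals
  \<open>\<rho> * F\<close> plus a multiple of the spherical Laplacian of \<open>w\<close>. Down the backward light cone
  the left-hand side is minus the derivative of \<open>Q = (\<partial>\<^sub>s + \<partial>\<^sub>\<rho>) u\<close>, so it integrates to the difference of \<open>Q\<close> at the vertex, which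
  is \<open>w (t, x)\<close>, and \<open>Q\<close> at time zero, which vanishes with the data. Averaging over all rays removes
  the Laplacian.
\<close>

theorem kirchhoff_formula:
  assumes t: "t > 0" and w: "Ck_on 2 (strip t) w" and box: "\<And>p. p \<in> strip t \<Longrightarrow> box_op (strip t) w p = F p"
    and w0: "\<And>y. w (0, y) = 0" and w1: "\<And>y. dt t w (0, y) = 0"
    and T: "orthogonal_transformation T"
  shows "4 * pi * w (t, x) = integral (cbox (0, 0) (pi, 2 * pi)) (\<lambda>z. integral (cbox 0 t)
    (\<lambda>\<rho>. sin (fst z) * (\<rho> * F (t - \<rho>, x + \<rho> *\<^sub>R T (polar3 z)))))"
proof -
  have bT: "bounded_linear T"
    using T by (simp add: orthogonal_transformation_def linear_conv_bounded_linear)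
  interpret bounded_linear T by (rule bT)
  have w2: "Ck_on (Suc (Suc 0)) (strip t) w" using w by (simp add: numeral_2_eq_2)
  have w1': "Ck_on (Suc 0) (strip t) w" using w by (rule Ck_on_le) simp
  have dw: "w differentiable_on strip t" using w2 by (rule Ck_on_Suc_imp_differentiable)
  have Cdt: "Ck_on (Suc 0) (strip t) (dt t w)"
    using t w2 by (rule Ck_on_D_t)
  have ddt: "dt t w differentiable_on strip t" using Cdt by (rule Ck_on_Suc_imp_differentiable)
  have "Ck_on 0 (strip t) (box_op (strip t) w)" by (rule Ck_on_box_op[OF t w2])
  then have cF: "continuous_on (strip t) F" using box by (simp cong: continuous_on_cong)
  let ?q = "\<lambda>\<rho> z. (t - \<rho>, x + \<rho> *\<^sub>R T (polar3 z))"
  \<comment> \<open>the angular part, which averages to zero over each sphere\<close>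
  define R where "R \<rho> z = \<rho> * (second_form t w (T (polar3_a z)) (T (polar3_a z)) (?q \<rho> z)
        + second_form t w (T (polar3_b z)) (T (polar3_b z)) (?q \<rho> z))
     - 2 * directional t w (T (polar3 z)) (?q \<rho> z)" for \<rho> z
  have rep: "((\<lambda>\<rho>. \<rho> * F (?q \<rho> z) + R \<rho> z) has_integral w (t, x)) {0..t}" for z
  proof -
    \<comment> \<open>this is \<open>(\<partial>\<^sub>s + \<partial>\<^sub>\<rho>) (\<rho> * w)\<close>, evaluated on the cone\<close>
    define Q where "Q \<rho> = \<rho> * dt t w (?q \<rho> z) + w (?q \<rho> z) + \<rho> * directional t w (T (polar3 z)) (?q \<rho> z)" for \<rho>
    have "((\<lambda>\<rho>. - (\<rho> * F (?q \<rho> z) + R \<rho> z)) has_integral Q t - Q 0) {0..t}"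
    proof (rule fundamental_theorem_of_calculus)
      fix \<rho> assume \<rho>: "\<rho> \<in> {0..t}"
      let ?p = "?q \<rho> z"
      have s: "((\<lambda>\<rho>. t - \<rho>) has_real_derivative -1) (at \<rho> within {0..t})"
        by (auto intro!: derivative_eq_intros)
      have y: "((\<lambda>\<rho>. x + \<rho> *\<^sub>R T (polar3 z)) has_vector_derivative T (polar3 z)) (at \<rho> within {0..t})"
        by (auto intro!: derivative_eq_intros)
      have in_t: "t - \<rho> \<in> {0..t}" if "\<rho> \<in> {0..t}" for \<rho> using that by auto
      have p: "?p \<in> strip t" using \<rho> by (auto simp: strip_def)
      note d1 = strip_chain_rule[OF ddt s y \<rho> in_t] and d2 = strip_chain_rule[OF dw s y \<rho> in_t]
        and d3 = directional_has_derivative[OF t w s y has_vector_derivative_const \<rho> in_t, of "T (polar3 z)"]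
      have comm: "dt t (dx t i w) ?p = dx t i (dt t w) ?p" for i
        by (rule dt_dx_commute[OF t w w0 in_t[OF \<rho>]])
      have F: "F ?p = dt t (dt t w) ?p - (\<Sum>i\<in>UNIV. dx t i (dx t i w) ?p)"
        using box[OF p] by (simp add: box_op_def)
      have zero: "directional t w 0 ?p = 0" by (simp add: directional_def)
      note D = DERIV_add[OF DERIV_add[OF DERIV_mult[OF DERIV_ident d1] d2] DERIV_mult[OF DERIV_ident d3]]
      show "(Q has_vector_derivative - (\<rho> * F ?p + R \<rho> z)) (at \<rho> within {0..t})"
        unfolding has_real_derivative_iff_has_vector_derivative[symmetric] Q_def[abs_def]
      proof (rule DERIV_cong[OF D])
        let ?A = "directional t w (T (polar3 z)) ?p" and ?B = "second_form t w (T (polar3 z)) (T (polar3 z)) ?p"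
        let ?C = "\<Sum>i\<in>UNIV. T (polar3 z) $ i * dx t i (dt t w) ?p"
        let ?S = "second_form t w (T (polar3_a z)) (T (polar3_a z)) ?p + second_form t w (T (polar3_b z)) (T (polar3_b z)) ?p"
        have lap: "?B + ?S = (\<Sum>i\<in>UNIV. dx t i (dx t i w) ?p)"
          using second_form_trace[OF T, of t w z ?p] by simp
        show "1 * dt t w ?p + (- 1 * dt t (dt t w) ?p + ?C) * \<rho> +
          (- 1 * dt t w ?p + (\<Sum>i\<in>UNIV. T (polar3 z) $ i * dx t i w ?p)) +
          (1 * ?A + (directional t w 0 ?p + - 1 * (\<Sum>i\<in>UNIV. T (polar3 z) $ i * dt t (dx t i w) ?p) + ?B) * \<rho>)
           = - (\<rho> * F ?p + R \<rho> z)"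
          unfolding comm F lap[symmetric] R_def zero directional_def[symmetric]
          by (simp add: algebra_simps)
      qed
    qed (use t in simp)
    moreover have "Q t = 0"
    proof -
      \<comment> \<open>the data vanish on the whole initial face, hence so do their spatial derivatives\<close>
      have dx0: "dx t i w (0, y) = 0" for i y
      proof -
        have "((\<lambda>h. w (0, y + h *\<^sub>R axis i 1)) has_real_derivative
          (0 * dt t w (0, y + 0 *\<^sub>R axis i 1) + (\<Sum>j\<in>UNIV. axis i 1 $ j * dx t j w (0, y + 0 *\<^sub>R axis i 1)))) (at 0 within UNIV)"
          by (rule strip_chain_rule[OF dw]) (use t in \<open>auto intro!: derivative_eq_intros\<close>)
        moreover have "(\<Sum>j\<in>UNIV. axis i 1 $ j * dx t j w (0, y + 0 *\<^sub>R axis i 1)) = dx t i w (0, y)"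
          by (simp add: axis_def if_distrib[of "\<lambda>x. x * _"] cong: if_cong)
        ultimately have "((\<lambda>h::real. 0) has_real_derivative dx t i w (0, y)) (at 0)"
          by (simp add: w0)
        from DERIV_unique[OF this DERIV_const] show ?thesis .
      qed
      show ?thesis by (simp add: Q_def w0 w1 directional_def dx0)
    qed
    moreover have "Q 0 = w (t, x)" by (simp add: Q_def)
    ultimately have "((\<lambda>\<rho>. - (\<rho> * F (?q \<rho> z) + R \<rho> z)) has_integral - w (t, x)) {0..t}" by simp
    from has_integral_neg[OF this] show ?thesis by (simp only: minus_minus)
  qed
  let ?B = "cbox (0, 0) (pi, 2 * pi) :: (real \<times> real) set"
  have cT: "continuous_on A (\<lambda>z. T (f z))" if "continuous_on A f" for A and f :: "'z::topological_space \<Rightarrow> real^3"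
    using that by (rule continuous_on)
  have cPs: "continuous_on A (\<lambda>p. T (polar3 (h p)))" "continuous_on A (\<lambda>p. T (polar3_a (h p)))"
     "continuous_on A (\<lambda>p. T (polar3_b (h p)))" if "continuous_on A h" for A and h :: "'z::topological_space \<Rightarrow> real \<times> real"
    by (intro cT continuous_on_compose2[OF continuous_on_polar(1)[of UNIV] that]
        continuous_on_compose2[OF continuous_on_polar3_ab(1)[of UNIV] that]
        continuous_on_compose2[OF continuous_on_polar3_ab(2)[of UNIV] that]; simp)+
  define G1 where "G1 \<rho> z = sin (fst z) * (\<rho> * F (?q \<rho> z))" for \<rho> z
  define G2 where "G2 \<rho> z = sin (fst z) * R \<rho> z" for \<rho> z
  have cG1: "continuous_on (?B \<times> cbox 0 t) (\<lambda>(z, \<rho>). G1 \<rho> z)"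
    unfolding G1_def case_prod_unfold
    by (intro continuous_intros continuous_on_strip_compose[OF cF] cPs) auto
  have cG2: "continuous_on (?B \<times> cbox 0 t) (\<lambda>(z, \<rho>). G2 \<rho> z)"
    unfolding G2_def R_def case_prod_unfold
    by (intro continuous_intros continuous_on_second_form[OF t w] continuous_on_directional[OF t w1'] cPs) auto
  have cz: "continuous_on (cbox 0 t) (\<lambda>\<rho>. G1 \<rho> z)" "continuous_on (cbox 0 t) (\<lambda>\<rho>. G2 \<rho> z)" if "z \<in> ?B" for z
  proof -
    have p: "continuous_on (cbox 0 t) (\<lambda>\<rho>. (z, \<rho>))" by (intro continuous_intros)
    have im: "(\<lambda>\<rho>. (z, \<rho>)) ` cbox 0 t \<subseteq> ?B \<times> cbox 0 t" using that by auto
    show "continuous_on (cbox 0 t) (\<lambda>\<rho>. G1 \<rho> z)" "continuous_on (cbox 0 t) (\<lambda>\<rho>. G2 \<rho> z)"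
      using continuous_on_compose2[OF cG1 p im] continuous_on_compose2[OF cG2 p im]
      by (simp_all only: prod.case)
  qed
  have I2: "integral ?B (\<lambda>z. integral (cbox 0 t) (\<lambda>\<rho>. G2 \<rho> z)) = 0"
  proof -
    have "integral ?B (\<lambda>z. integral (cbox 0 t) (\<lambda>\<rho>. G2 \<rho> z)) = integral (cbox 0 t) (\<lambda>\<rho>. integral ?B (\<lambda>z. G2 \<rho> z))"
      using cG2 by (intro integral_swap_continuous) (simp only: cbox_Pair_eq)
    also have "\<dots> = integral (cbox 0 t) (\<lambda>\<rho>. 0)"
      by (rule integral_cong) (simp add: G2_def R_def integral_spherical_laplacian[OF t w T])
    finally show ?thesis by simp
  qed
  have ci: "continuous_on ?B (\<lambda>z. integral (cbox 0 t) (\<lambda>\<rho>. G \<rho> z))"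
    if "continuous_on (?B \<times> cbox 0 t) (\<lambda>(z, \<rho>). G \<rho> z)" for G :: "real \<Rightarrow> real \<times> real \<Rightarrow> real"
    using that by (rule integral_continuous_on_param)
  have "sin (fst z) * w (t, x) = integral (cbox 0 t) (\<lambda>\<rho>. G1 \<rho> z) + integral (cbox 0 t) (\<lambda>\<rho>. G2 \<rho> z)"
    if "z \<in> ?B" for z
  proof -
    have "((\<lambda>\<rho>. sin (fst z) * (\<rho> * F (?q \<rho> z) + R \<rho> z)) has_integral sin (fst z) * w (t, x)) {0..t}"
      by (rule has_integral_mult_right[OF rep])
    then have "sin (fst z) * w (t, x) = integral (cbox 0 t) (\<lambda>\<rho>. G1 \<rho> z + G2 \<rho> z)"
      by (simp add: integral_unique G1_def G2_def distrib_left)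
    also have "\<dots> = integral (cbox 0 t) (\<lambda>\<rho>. G1 \<rho> z) + integral (cbox 0 t) (\<lambda>\<rho>. G2 \<rho> z)"
      by (rule integral_add) (rule integrable_continuous[OF cz(1)[OF that]] integrable_continuous[OF cz(2)[OF that]])+
    finally show ?thesis .
  qed
  then have "integral ?B (\<lambda>z. sin (fst z) * w (t, x)) =
     integral ?B (\<lambda>z. integral (cbox 0 t) (\<lambda>\<rho>. G1 \<rho> z) + integral (cbox 0 t) (\<lambda>\<rho>. G2 \<rho> z))"
    by (intro integral_cong) auto
  also have "\<dots> = integral ?B (\<lambda>z. integral (cbox 0 t) (\<lambda>\<rho>. G1 \<rho> z)) + integral ?B (\<lambda>z. integral (cbox 0 t) (\<lambda>\<rho>. G2 \<rho> z))"
    by (intro integral_add integrable_continuous ci cG1 cG2)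
  finally have "integral ?B (\<lambda>z. sin (fst z) * w (t, x)) = integral ?B (\<lambda>z. integral (cbox 0 t) (\<lambda>\<rho>. G1 \<rho> z))"
    using I2 by simp
  moreover have "integral ?B (\<lambda>z. sin (fst z) * w (t, x)) = 4 * pi * w (t, x)"
  proof -
    have "integral ?B (\<lambda>z. sin (fst z) * w (t, x)) =
       integral (cbox 0 pi) (\<lambda>a. integral (cbox 0 (2 * pi)) (\<lambda>b. sin (fst (a, b)) * w (t, x)))"
      by (rule integral_prod_continuous) (intro continuous_intros)
    also have "\<dots> = integral {0..pi} (\<lambda>a. sin a * (2 * pi * w (t, x)))" by (simp add: algebra_simps)
    also have "\<dots> = integral {0..pi} sin * (2 * pi * w (t, x))" by simp
    also have "(sin has_integral (- cos pi) - (- cos 0)) {0..pi}"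
      by (rule fundamental_theorem_of_calculus)
        (auto simp: has_real_derivative_iff_has_vector_derivative[symmetric] intro!: derivative_eq_intros)
    then have "integral {0..pi} sin = (2::real)" by (simp add: integral_unique)
    finally show ?thesis by simp
  qed
  ultimately show ?thesis by (simp add: G1_def)
qed

section \<open>Radial sources\<close>

lemma nn_integral_continuous_on_compact:
  fixes g :: "'a::euclidean_space \<Rightarrow> real"
  assumes "compact S" "continuous_on S g" "\<And>x. x \<in> S \<Longrightarrow> 0 \<le> g x"
  shows "(\<integral>\<^sup>+x\<in>S. ennreal (g x) \<partial>lborel) = ennreal (integral S g)"
proof -
  have int: "integrable lborel (\<lambda>x. indicator S x *\<^sub>R g x)"
    using borel_integrable_compact[OF assms(1,2)] .
  have "(\<integral>\<^sup>+x\<in>S. ennreal (g x) \<partial>lborel) = (\<integral>\<^sup>+x. ennreal (indicator S x *\<^sub>R g x) \<partial>lborel)"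
    by (intro nn_integral_cong) (simp split: split_indicator)
  also have "\<dots> = ennreal (\<integral>x. indicator S x *\<^sub>R g x \<partial>lborel)"
    using assms(3) by (intro nn_integral_eq_integral[OF int] AE_I2) (simp split: split_indicator)
  also have "(\<integral>x. indicator S x *\<^sub>R g x \<partial>lborel) = integral S g"
    using set_borel_integral_eq_integral(2)[of S g] int
    by (simp add: set_integrable_def set_lebesgue_integral_def)
  finally show ?thesis .
qed

text \<open>
  The minimum of \<open>\<bar>f\<bar>\<close> is at most its average, and the integral of \<open>\<bar>f'\<bar>\<close> bounds the distance of any
  value from it. All Sobolev-type bounds below come from this one.
\<close>

lemma abs_le_average_plus_derivative:
  fixes f f' :: "real \<Rightarrow> real"
  assumes "c < d" "x \<in> {c..d}" "continuous_on {c..d} f'"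
    and der: "\<And>y. y \<in> {c..d} \<Longrightarrow> (f has_real_derivative f' y) (at y within {c..d})"
  shows "ennreal \<bar>f x\<bar> \<le> (\<integral>\<^sup>+y\<in>{c..d}. ennreal (\<bar>f y\<bar> / (d - c) + \<bar>f' y\<bar>) \<partial>lborel)"
proof -
  have cf: "continuous_on {c..d} f"
    using der by (meson DERIV_continuous continuous_on_eq_continuous_within)
  obtain m where m: "m \<in> {c..d}" "\<And>y. y \<in> {c..d} \<Longrightarrow> \<bar>f m\<bar> \<le> \<bar>f y\<bar>"
    using continuous_attains_inf[of "{c..d}" "\<lambda>y. \<bar>f y\<bar>"] continuous_on_rabs[OF cf] assms(1)
    by (metis atLeastatMost_empty_iff2 compact_Icc less_le_not_le)
  have int1: "(\<lambda>y. \<bar>f y\<bar>) integrable_on {c..d}" and int2: "(\<lambda>y. \<bar>f' y\<bar>) integrable_on {c..d}"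
    using cf assms(3) by (auto intro!: integrable_continuous_interval continuous_intros)
  have ftc: "\<bar>f b - f a\<bar> \<le> integral {c..d} (\<lambda>y. \<bar>f' y\<bar>)"
    if ab: "c \<le> a" "a \<le> b" "b \<le> d" for a b
  proof -
    have "(f' has_integral f b - f a) {a..b}"
      using ab der[THEN DERIV_subset, of _ "{a..b}"] by (intro fundamental_theorem_of_calculus)
        (auto simp: has_real_derivative_iff_has_vector_derivative[symmetric])
    then have "f b - f a = integral {a..b} f'" by (simp add: integral_unique)
    also have "norm \<dots> \<le> integral {a..b} (\<lambda>y. \<bar>f' y\<bar>)"
      using ab by (intro integral_norm_bound_integral integrable_continuous_interval continuous_intros
          continuous_on_subset[OF assms(3)]) auto
    also have "\<dots> \<le> integral {c..d} (\<lambda>y. \<bar>f' y\<bar>)"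
      using ab by (intro integral_subset_le int2 integrable_continuous_interval continuous_intros
          continuous_on_subset[OF assms(3)]) auto
    finally show ?thesis by simp
  qed
  have "\<bar>f x - f m\<bar> \<le> integral {c..d} (\<lambda>y. \<bar>f' y\<bar>)"
    using ftc[of m x] ftc[of x m] m(1) assms(2) by (cases "m \<le> x") auto
  moreover have "\<bar>f m\<bar> \<le> integral {c..d} (\<lambda>y. \<bar>f y\<bar> / (d - c))"
  proof -
    have "integral {c..d} (\<lambda>y. \<bar>f m\<bar> / (d - c)) \<le> integral {c..d} (\<lambda>y. \<bar>f y\<bar> / (d - c))"
      using m assms(1) int1
      by (intro integral_le) (auto intro!: divide_right_mono integrable_on_divide)
    then show ?thesis using assms(1) by simp
  qed
  ultimately have "\<bar>f x\<bar> \<le> integral {c..d} (\<lambda>y. \<bar>f y\<bar> / (d - c)) + integral {c..d} (\<lambda>y. \<bar>f' y\<bar>)"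
    by linarith
  also have "\<dots> = integral {c..d} (\<lambda>y. \<bar>f y\<bar> / (d - c) + \<bar>f' y\<bar>)"
    using int1 int2 by (intro integral_add[symmetric]) (auto intro: integrable_on_divide)
  finally have "\<bar>f x\<bar> \<le> integral {c..d} (\<lambda>y. \<bar>f y\<bar> / (d - c) + \<bar>f' y\<bar>)" .
  moreover have "(\<integral>\<^sup>+y\<in>{c..d}. ennreal (\<bar>f y\<bar> / (d - c) + \<bar>f' y\<bar>) \<partial>lborel) =
      ennreal (integral {c..d} (\<lambda>y. \<bar>f y\<bar> / (d - c) + \<bar>f' y\<bar>))"
    using assms(1) cf assms(3)
    by (intro nn_integral_continuous_on_compact) (auto intro!: continuous_intros)
  ultimately show ?thesis by (simp add: ennreal_leI)
qed

text \<open>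
  Up to a constant, the integral over the strip of a function radial in space against \<open>dy / norm y\<close>.
  Negative \<open>v\<close> do not contribute, since \<open>ennreal v\<close> is then zero.
\<close>

definition radial_energy :: "real \<Rightarrow> (real \<times> real \<Rightarrow> ennreal) \<Rightarrow> ennreal" where
  "radial_energy t k = (\<integral>\<^sup>+s\<in>{0..t}. (\<integral>\<^sup>+v. k (s, v) * ennreal v \<partial>lborel) \<partial>lborel)"

text \<open>
  Twice \<open>r\<close> times the solution at time \<open>t\<close> and radius \<open>r\<close> of the wave equation with radial source \<open>k\<close>
  and zero data: \<open>r\<close> times a radial solution solves the equation in one space dimension.
\<close>

definition radial_wave :: "real \<Rightarrow> real \<Rightarrow> (real \<times> real \<Rightarrow> ennreal) \<Rightarrow> ennreal" where
  "radial_wave t r k =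
     (\<integral>\<^sup>+s\<in>{0..t}. (\<integral>\<^sup>+v\<in>{\<bar>r - (t - s)\<bar>..r + (t - s)}. k (s, v) * ennreal v \<partial>lborel) \<partial>lborel)"

lemma radial_wave_le_energy: "radial_wave t r k \<le> radial_energy t k"
  unfolding radial_wave_def radial_energy_def
  by (intro nn_integral_mono mult_right_mono) (auto split: split_indicator)

text \<open>
  The regime of small \<open>t\<close> and \<open>r\<close>: the inner interval has length at most \<open>2 * r\<close>, so a bound of
  \<open>k (s, v) * v\<close> that is uniform in \<open>v\<close> suffices. Moving outwards from \<open>v\<close> the factor \<open>v\<close> increases.
\<close>

lemma radial_wave_le_translation:
  assumes [measurable]: "k2 \<in> borel_measurable borel" and r: "r > 0"
    and k: "\<And>s v. 0 \<le> s \<Longrightarrow> s \<le> t \<Longrightarrow> 0 \<le> v \<Longrightarrow> k (s, v) \<le> (\<integral>\<^sup>+v'\<in>{v..v+1}. k2 (s, v') \<partial>lborel)"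
  shows "radial_wave t r k \<le> ennreal (2 * r) * radial_energy t k2"
proof -
  have meas[measurable]: "(\<lambda>v. k2 (s, v)) \<in> borel_measurable borel" for s by measurable
  have "(\<integral>\<^sup>+v\<in>{\<bar>r - (t - s)\<bar>..r + (t - s)}. k (s, v) * ennreal v \<partial>lborel)
      \<le> ennreal (2 * r) * (\<integral>\<^sup>+v. k2 (s, v) * ennreal v \<partial>lborel)" if s: "0 \<le> s" "s \<le> t" for s
  proof -
    let ?M = "\<integral>\<^sup>+v. k2 (s, v) * ennreal v \<partial>lborel"
    have "k (s, v) * ennreal v \<le> ?M" if "0 \<le> v" for v
    proof -
      have "k (s, v) * ennreal v \<le> (\<integral>\<^sup>+v'\<in>{v..v+1}. k2 (s, v') \<partial>lborel) * ennreal v"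
        using k[OF s that] by (rule mult_right_mono) simp
      also have "\<dots> = (\<integral>\<^sup>+v'\<in>{v..v+1}. k2 (s, v') * ennreal v \<partial>lborel)"
        by (subst nn_integral_multc[symmetric]) (auto simp: ac_simps)
      also have "\<dots> \<le> ?M"
        by (intro nn_integral_mono) (auto split: split_indicator intro!: mult_left_mono ennreal_leI)
      finally show ?thesis .
    qed
    then have "(\<integral>\<^sup>+v\<in>{\<bar>r - (t - s)\<bar>..r + (t - s)}. k (s, v) * ennreal v \<partial>lborel)
       \<le> (\<integral>\<^sup>+v\<in>{\<bar>r - (t - s)\<bar>..r + (t - s)}. ?M \<partial>lborel)"
      by (intro nn_integral_mono) (auto split: split_indicator)
    also have "\<dots> = ?M * emeasure lborel {\<bar>r - (t - s)\<bar>..r + (t - s)}"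
      by (simp add: nn_integral_cmult)
    also have "\<dots> \<le> ?M * ennreal (2 * r)"
      using s r by (intro mult_left_mono) (auto intro!: ennreal_leI)
    finally show ?thesis by (simp add: ac_simps)
  qed
  then have "radial_wave t r k \<le>
      (\<integral>\<^sup>+s. ennreal (2 * r) * ((\<integral>\<^sup>+v. k2 (s, v) * ennreal v \<partial>lborel) * indicator {0..t} s) \<partial>lborel)"
    unfolding radial_wave_def by (intro nn_integral_mono) (auto split: split_indicator)
  also have "\<dots> = ennreal (2 * r) * radial_energy t k2"
    unfolding radial_energy_def by (rule nn_integral_cmult) measurable
  finally show ?thesis .
qed

text \<open>
  Two changes of variables: dilating by \<open>l\<close> carries the segment \<open>s + v = u\<close> to \<open>s + v = l * u\<close>, and as \<open>l\<close>
  runs through \<open>{1/2..1}\<close> these segments sweep out a region in which \<open>dl = dv / u\<close>. Of the constant \<open>8\<close>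
  a factor 4 comes from \<open>l \<ge> 1/2\<close> and a factor 2 from \<open>u \<ge> t / 2\<close>.
\<close>

lemma nn_integral_along_cone_le:
  assumes [measurable]: "k \<in> borel_measurable borel" "k1 \<in> borel_measurable borel"
    and t: "t > 0" and u: "u \<ge> t / 2"
    and k: "\<And>s v. 0 \<le> s \<Longrightarrow> s \<le> t \<Longrightarrow> 0 \<le> v \<Longrightarrow> k (s, v) \<le> (\<integral>\<^sup>+l\<in>{1/2..1}. k1 (l * s, l * v) \<partial>lborel)"
  shows "(\<integral>\<^sup>+s\<in>{0..t}. k (s, u - s) * ennreal (u - s) \<partial>lborel) \<le> ennreal (8 / t) * radial_energy t k1"
proof -
  let ?A = "\<lambda>s l. k1 (l * s, l * (u - s)) * ennreal (u - s) * indicator {0..t} s * indicator {1/2..1} l"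
  let ?B = "\<lambda>s l. k1 (s, l * u - s) * ennreal (l * u - s) * indicator {0..t} s * indicator {1/2..1} l"
  let ?E = "\<lambda>s. \<integral>\<^sup>+v. k1 (s, v) * ennreal v \<partial>lborel"
  let ?F = "\<lambda>s. \<integral>\<^sup>+l. k1 (s, l * u - s) * ennreal (l * u - s) \<partial>lborel"
  have "(\<integral>\<^sup>+s\<in>{0..t}. k (s, u - s) * ennreal (u - s) \<partial>lborel)
      \<le> (\<integral>\<^sup>+s. (\<integral>\<^sup>+l. ?A s l \<partial>lborel) \<partial>lborel)"
  proof (rule nn_integral_mono)
    fix s
    show "k (s, u - s) * ennreal (u - s) * indicator {0..t} s
      \<le> (\<integral>\<^sup>+l. ?A s l \<partial>lborel)"
    proof (cases "s \<in> {0..t} \<and> s \<le> u")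
      case True
      then have "k (s, u - s) * ennreal (u - s) \<le> (\<integral>\<^sup>+l\<in>{1/2..1}. k1 (l * s, l * (u - s)) \<partial>lborel) * ennreal (u - s)"
        using k[of s "u - s"] by (intro mult_right_mono) auto
      also have "\<dots> = (\<integral>\<^sup>+l. ?A s l \<partial>lborel)"
        using True by (subst nn_integral_multc[symmetric]) (auto simp: ac_simps)
      finally show ?thesis using True by simp
    next
      case False
      then show ?thesis by (auto simp: indicator_def ennreal_neg)
    qed
  qed
  also have "\<dots> = (\<integral>\<^sup>+l. (\<integral>\<^sup>+s. ?A s l \<partial>lborel) \<partial>lborel)"
    by (rule lborel_pair.Fubini') measurable
  also have "\<dots> \<le> (\<integral>\<^sup>+l. (\<integral>\<^sup>+s. 4 * (?B s l) \<partial>lborel) \<partial>lborel)"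
  proof (rule nn_integral_mono)
    fix l :: real
    show "(\<integral>\<^sup>+s. ?A s l \<partial>lborel)
      \<le> (\<integral>\<^sup>+s. 4 * (?B s l) \<partial>lborel)"
    proof (cases "l \<in> {1/2..1}")
      case l: True
      let ?g = "\<lambda>s. k1 (l * s, l * (u - s)) * ennreal (u - s) * indicator {0..t} s"
      have "(\<integral>\<^sup>+s. ?g s \<partial>lborel) = ennreal \<bar>1 / l\<bar> * (\<integral>\<^sup>+s. ?g (0 + (1 / l) * s) \<partial>lborel)"
        using l by (intro nn_integral_real_affine) auto
      also have "\<dots> = (\<integral>\<^sup>+s. ennreal \<bar>1 / l\<bar> * ?g (0 + (1 / l) * s) \<partial>lborel)"
        by (intro nn_integral_cmult[symmetric]) measurable
      also have "\<dots> \<le> (\<integral>\<^sup>+s. 4 * (k1 (s, l * u - s) * ennreal (l * u - s) * indicator {0..t} s) \<partial>lborel)"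
      proof (intro nn_integral_mono)
        fix s
        have e1: "ennreal (1 / l) * ennreal (u - s / l) \<le> 4 * ennreal (l * u - s)"
        proof (cases "s \<le> l * u")
          case True
          have "1 / l \<le> 2" using l by (simp add: field_simps)
          then have "(1 / l) * (1 / l) \<le> 2 * 2" using l by (intro mult_mono) auto
          then have "(1 / l) * (1 / l) * (l * u - s) \<le> 4 * (l * u - s)"
            using True by (intro mult_right_mono) auto
          also have "(1 / l) * (1 / l) * (l * u - s) = (1 / l) * (u - s / l)"
            using l by (simp add: field_simps)
          finally have le: "(1 / l) * (u - s / l) \<le> 4 * (l * u - s)" .
          have "ennreal (1 / l) * ennreal (u - s / l) = ennreal ((1 / l) * (u - s / l))"
            using l by (intro ennreal_mult'[symmetric]) auto
          also have "\<dots> \<le> ennreal (4 * (l * u - s))" by (intro ennreal_leI le)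
          also have "\<dots> = 4 * ennreal (l * u - s)"
            by (simp only: ennreal_mult'[of 4] ennreal_numeral zero_le_numeral)
          finally show ?thesis .
        next
          case False
          then have "u - s / l < 0" using l by (simp add: field_simps)
          then show ?thesis by (simp add: ennreal_neg)
        qed
        have e2: "indicator {0..t} (s / l) \<le> (indicator {0..t} s :: ennreal)"
        proof -
          have "0 \<le> s \<and> s \<le> t" if "0 \<le> s / l" "s / l \<le> t"
          proof
            show "0 \<le> s" using that l by (simp add: zero_le_divide_iff)
            then show "s \<le> t" using that l t
              by (smt (verit, best) atLeastAtMost_iff divide_pos_pos le_divide_eq_1_pos nonzero_eq_divide_eq
                  mult_left_le mult_nonneg_nonneg)
          qed
          then show ?thesis by (auto simp: indicator_def)
        qed
        have "ennreal \<bar>1 / l\<bar> * ?g (0 + (1 / l) * s) =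
           k1 (s, l * u - s) * (ennreal (1 / l) * ennreal (u - s / l)) * indicator {0..t} (s / l)"
          using l by (simp add: algebra_simps)
        also have "\<dots> \<le> k1 (s, l * u - s) * (4 * ennreal (l * u - s)) * indicator {0..t} s"
          by (rule mult_mono[OF mult_left_mono[OF e1] e2]) auto
        finally show "ennreal \<bar>1 / l\<bar> * ?g (0 + (1 / l) * s)
            \<le> 4 * (k1 (s, l * u - s) * ennreal (l * u - s) * indicator {0..t} s)"
          by (simp add: ac_simps)
      qed
      finally show ?thesis using l by simp
    qed simp
  qed
  also have "\<dots> = (\<integral>\<^sup>+s. (\<integral>\<^sup>+l. 4 * (?B s l) \<partial>lborel) \<partial>lborel)"
    by (rule lborel_pair.Fubini') measurable
  also have "\<dots> \<le> (\<integral>\<^sup>+s. ennreal (8 / t) * ((?E s) * indicator {0..t} s) \<partial>lborel)"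
  proof (rule nn_integral_mono)
    fix s
    have u0: "u > 0" using t u by simp
    have "(?E s) =
        ennreal \<bar>u\<bar> * (\<integral>\<^sup>+l. k1 (s, - s + u * l) * ennreal (- s + u * l) \<partial>lborel)"
      using u0 by (intro nn_integral_real_affine) auto
    also have "(\<lambda>l. - s + u * l) = (\<lambda>l. l * u - s)" by (auto simp: algebra_simps)
    finally have eq: "(?E s) =
        ennreal u * (?F s)"
      using u0 by (simp add: algebra_simps)
    have "(\<integral>\<^sup>+l. 4 * (?B s l) \<partial>lborel)
      \<le> (\<integral>\<^sup>+l. 4 * indicator {0..t} s * (k1 (s, l * u - s) * ennreal (l * u - s)) \<partial>lborel)"
      by (intro nn_integral_mono) (auto split: split_indicator)
    also have "\<dots> = 4 * indicator {0..t} s * (?F s)"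
      by (rule nn_integral_cmult) measurable
    also have "\<dots> \<le> ennreal ((8 / t) * u) * indicator {0..t} s * (?F s)"
    proof (intro mult_right_mono)
      have "4 \<le> (8 / t) * u" using t u by (simp add: field_simps)
      then show "4 \<le> ennreal ((8 / t) * u)" using ennreal_leI by fastforce
    qed auto
    also have "\<dots> = ennreal (8 / t) * ((?E s) * indicator {0..t} s)"
    proof -
      have "ennreal ((8 / t) * u) = ennreal (8 / t) * ennreal u" using t u0 by (intro ennreal_mult) auto
      then show ?thesis unfolding eq by (simp only: ac_simps)
    qed
    finally show "(\<integral>\<^sup>+l. 4 * (?B s l) \<partial>lborel)
      \<le> ennreal (8 / t) * ((?E s) * indicator {0..t} s)" .
  qed
  also have "\<dots> = ennreal (8 / t) * radial_energy t k1"
    unfolding radial_energy_def by (rule nn_integral_cmult) measurable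
  finally show ?thesis .
qed

text \<open>
  The regime \<open>r \<le> t / 2\<close>: in the coordinate \<open>u = s + v\<close> the domain of integration lies between
  \<open>t - r\<close> and \<open>t + r\<close>, so it consists of cone segments to which the preceding bound applies.
\<close>

lemma radial_wave_le_dilation:
  assumes [measurable]: "k \<in> borel_measurable borel" "k1 \<in> borel_measurable borel"
    and r: "0 < r" "r \<le> t / 2"
    and k: "\<And>s v. 0 \<le> s \<Longrightarrow> s \<le> t \<Longrightarrow> 0 \<le> v \<Longrightarrow> k (s, v) \<le> (\<integral>\<^sup>+l\<in>{1/2..1}. k1 (l * s, l * v) \<partial>lborel)"
  shows "radial_wave t r k \<le> ennreal (16 * r / t) * radial_energy t k1"
proof -
  have t: "t > 0" using r by simp
  have "radial_wave t r k \<le>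
      (\<integral>\<^sup>+s. (\<integral>\<^sup>+u. k (s, u - s) * ennreal (u - s) * indicator {0..t} s * indicator {t - r..t + r} u \<partial>lborel) \<partial>lborel)"
    unfolding radial_wave_def
  proof (rule nn_integral_mono)
    fix s
    show "(\<integral>\<^sup>+v\<in>{\<bar>r - (t - s)\<bar>..r + (t - s)}. k (s, v) * ennreal v \<partial>lborel) * indicator {0..t} s
       \<le> (\<integral>\<^sup>+u. k (s, u - s) * ennreal (u - s) * indicator {0..t} s * indicator {t - r..t + r} u \<partial>lborel)"
    proof (cases "s \<in> {0..t}")
      case True
      let ?g = "\<lambda>v. k (s, v) * ennreal v * indicator {\<bar>r - (t - s)\<bar>..r + (t - s)} v"
      have "(\<integral>\<^sup>+v. ?g v \<partial>lborel) = ennreal \<bar>1\<bar> * (\<integral>\<^sup>+u. ?g (- s + 1 * u) \<partial>lborel)"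
        by (intro nn_integral_real_affine) auto
      also have "\<dots> = (\<integral>\<^sup>+u. ?g (u - s) \<partial>lborel)" by simp
      also have "\<dots> \<le> (\<integral>\<^sup>+u. k (s, u - s) * ennreal (u - s) * indicator {t - r..t + r} u \<partial>lborel)"
        using True by (intro nn_integral_mono) (auto split: split_indicator)
      finally show ?thesis using True by simp
    qed simp
  qed
  also have "\<dots> = (\<integral>\<^sup>+u. (\<integral>\<^sup>+s. k (s, u - s) * ennreal (u - s) * indicator {0..t} s * indicator {t - r..t + r} u \<partial>lborel) \<partial>lborel)"
    by (rule lborel_pair.Fubini') measurable
  also have "\<dots> \<le> (\<integral>\<^sup>+u\<in>{t - r..t + r}. ennreal (8 / t) * radial_energy t k1 \<partial>lborel)"
    using nn_integral_along_cone_le[OF assms(1,2) t _ k] r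
    by (intro nn_integral_mono) (auto split: split_indicator)
  also have "\<dots> = ennreal (8 / t) * radial_energy t k1 * ennreal (2 * r)"
    using r by (simp add: nn_integral_cmult)
  also have "\<dots> = ennreal (16 * r / t) * radial_energy t k1"
    using r t by (simp add: ennreal_mult[symmetric] ac_simps)
  finally show ?thesis .
qed

text \<open>
  The constants of the three regimes are 4, 32 and 4 times \<open>r\<close>. The hypotheses on \<open>k1\<close> and \<open>k2\<close> are
  what the scaling field and the radial derivative provide.
\<close>

proposition radial_wave_decay:
  assumes [measurable]: "k \<in> borel_measurable borel" "k1 \<in> borel_measurable borel"
      "k2 \<in> borel_measurable borel"
    and t: "0 < t" and r: "0 < r"
    and dil: "\<And>s v. 0 \<le> s \<Longrightarrow> s \<le> t \<Longrightarrow> 0 \<le> v \<Longrightarrow> k (s, v) \<le> (\<integral>\<^sup>+l\<in>{1/2..1}. k1 (l * s, l * v) \<partial>lborel)"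
    and tra: "\<And>s v. 0 \<le> s \<Longrightarrow> s \<le> t \<Longrightarrow> 0 \<le> v \<Longrightarrow> k (s, v) \<le> (\<integral>\<^sup>+v'\<in>{v..v+1}. k2 (s, v') \<partial>lborel)"
  shows "ennreal (1 + t) * radial_wave t r k \<le>
    ennreal (32 * r) * (radial_energy t k + radial_energy t k1 + radial_energy t k2)"
proof -
  have scale: ?thesis if "radial_wave t r k \<le> ennreal c * E" "0 \<le> c" "(1 + t) * c \<le> 32 * r"
      "E \<le> radial_energy t k + radial_energy t k1 + radial_energy t k2" for c E
  proof -
    have "ennreal (1 + t) * radial_wave t r k \<le> ennreal (1 + t) * (ennreal c * E)"
      using that by (intro mult_left_mono) auto
    also have "\<dots> = ennreal ((1 + t) * c) * E"
      using t that by (simp add: ennreal_mult mult.assoc)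
    also have "\<dots> \<le> ennreal (32 * r) * (radial_energy t k + radial_energy t k1 + radial_energy t k2)"
      by (intro mult_mono ennreal_leI that(3,4)) auto
    finally show ?thesis .
  qed
  have sub: "radial_energy t k \<le> radial_energy t k + radial_energy t k1 + radial_energy t k2"
      "radial_energy t k1 \<le> radial_energy t k + radial_energy t k1 + radial_energy t k2"
      "radial_energy t k2 \<le> radial_energy t k + radial_energy t k1 + radial_energy t k2"
    by (auto simp: add_increasing add_increasing2)
  consider "max 1 t \<le> 2 * r" | "1 \<le> t" "2 * r < t" | "t < 1" "2 * r < 1" by linarith
  then show ?thesis
  proof cases
    case 1
    then show ?thesis using scale[of 1, OF _ _ _ sub(1)] radial_wave_le_energy[of t r k] by auto
  next
    case 2
    have "(1 + t) * (16 * r / t) \<le> (2 * t) * (16 * r / t)"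
      using 2 r by (intro mult_right_mono) auto
    then show ?thesis
      using scale[OF radial_wave_le_dilation[OF assms(1,2) r _ dil] _ _ sub(2)] 2 r by simp
  next
    case 3
    have "(1 + t) * (2 * r) \<le> 2 * (2 * r)"
      using 3 r by (intro mult_right_mono) auto
    then show ?thesis
      using scale[OF radial_wave_le_translation[OF assms(3) r tra] _ _ sub(3)] r by simp
  qed
qed

text \<open>
  Archimedes' theorem: the height on a sphere is uniformly distributed. Both sides become an integral
  in \<open>q\<close>, the square of the distance to the origin, which depends smoothly on \<open>a\<close> and on \<open>v\<close>; the
  distance itself is not differentiable where the sphere passes through the origin.
\<close>

lemma nn_integral_sphere_radial:
  fixes K :: "real \<Rightarrow> ennreal"
  assumes [measurable]: "K \<in> borel_measurable borel" and r: "r > 0" and \<rho>: "\<rho> \<ge> 0"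
  shows "(\<integral>\<^sup>+a\<in>{0..pi}. ennreal (\<rho> * sin a) * K (sqrt (r\<^sup>2 + \<rho>\<^sup>2 - 2 * r * \<rho> * cos a)) \<partial>lborel)
    = ennreal (1 / r) * (\<integral>\<^sup>+v\<in>{\<bar>r - \<rho>\<bar>..r + \<rho>}. K v * ennreal v \<partial>lborel)"
proof (cases "\<rho> = 0")
  case True
  have "(\<integral>\<^sup>+v\<in>{r..r}. K v * ennreal v \<partial>lborel) = 0"
  proof -
    have "(\<integral>\<^sup>+v\<in>{r..r}. K v * ennreal v \<partial>lborel) = (\<integral>\<^sup>+v. 0 \<partial>(lborel :: real measure))"
      by (rule nn_integral_cong_AE, use AE_lborel_singleton[of r] in eventually_elim) simp
    then show ?thesis by simp
  qed
  then show ?thesis using True r by simp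
next
  case False
  with \<rho> have \<rho>: "\<rho> > 0" by simp
  \<comment> \<open>both substitutions lead to the variable \<open>q = v\<^sup>2\<close>\<close>
  let ?f = "\<lambda>q. K (sqrt q)" and ?g = "\<lambda>a. r\<^sup>2 + \<rho>\<^sup>2 - 2 * r * \<rho> * cos a"
  have ends: "?g 0 = \<bar>r - \<rho>\<bar>\<^sup>2" "?g pi = (r + \<rho>)\<^sup>2"
    by (simp_all add: power2_eq_square algebra_simps)
  have "(\<integral>\<^sup>+q. ?f q * indicator {?g 0..?g pi} q \<partial>lborel) =
      (\<integral>\<^sup>+a. ?f (?g a) * ennreal (2 * r * \<rho> * sin a) * indicator {0..pi} a \<partial>lborel)"
    using r \<rho> by (intro nn_integral_substitution_aux)
      (auto intro!: derivative_eq_intros continuous_intros sin_ge_zero mult_nonneg_nonneg)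
  also have "\<dots> = (\<integral>\<^sup>+a. ennreal (2 * r) * (ennreal (\<rho> * sin a) * ?f (?g a) * indicator {0..pi} a) \<partial>lborel)"
  proof (rule nn_integral_cong)
    fix a
    show "?f (?g a) * ennreal (2 * r * \<rho> * sin a) * indicator {0..pi} a =
        ennreal (2 * r) * (ennreal (\<rho> * sin a) * ?f (?g a) * indicator {0..pi} a)"
    proof (cases "a \<in> {0..pi}")
      case True
      then have "ennreal (2 * r * (\<rho> * sin a)) = ennreal (2 * r) * ennreal (\<rho> * sin a)"
        using r by (intro ennreal_mult'') (simp add: \<rho> less_imp_le sin_ge_zero)
      then show ?thesis using True by (simp add: ac_simps)
    qed simp
  qed
  also have "\<dots> = ennreal (2 * r) * (\<integral>\<^sup>+a\<in>{0..pi}. ennreal (\<rho> * sin a) * ?f (?g a) \<partial>lborel)"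
    by (rule nn_integral_cmult) measurable
  finally have 1: "(\<integral>\<^sup>+q. ?f q * indicator {?g 0..?g pi} q \<partial>lborel) = \<dots>" .
  have "(\<integral>\<^sup>+q. ?f q * indicator {\<bar>r - \<rho>\<bar>\<^sup>2..(r + \<rho>)\<^sup>2} q \<partial>lborel) =
      (\<integral>\<^sup>+v. ?f (v\<^sup>2) * ennreal (2 * v) * indicator {\<bar>r - \<rho>\<bar>..r + \<rho>} v \<partial>lborel)"
    using r \<rho> by (intro nn_integral_substitution_aux)
      (auto intro!: derivative_eq_intros continuous_intros)
  also have "\<dots> = (\<integral>\<^sup>+v. ennreal 2 * (K v * ennreal v * indicator {\<bar>r - \<rho>\<bar>..r + \<rho>} v) \<partial>lborel)"
    by (intro nn_integral_cong) (auto simp: ennreal_mult' ac_simps split: split_indicator)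
  also have "\<dots> = ennreal 2 * (\<integral>\<^sup>+v\<in>{\<bar>r - \<rho>\<bar>..r + \<rho>}. K v * ennreal v \<partial>lborel)"
    by (rule nn_integral_cmult) measurable
  finally have 2: "(\<integral>\<^sup>+q. ?f q * indicator {\<bar>r - \<rho>\<bar>\<^sup>2..(r + \<rho>)\<^sup>2} q \<partial>lborel) = \<dots>" .
  have "ennreal (2 * r) * (\<integral>\<^sup>+a\<in>{0..pi}. ennreal (\<rho> * sin a) * ?f (?g a) \<partial>lborel) =
     ennreal 2 * (\<integral>\<^sup>+v\<in>{\<bar>r - \<rho>\<bar>..r + \<rho>}. K v * ennreal v \<partial>lborel)"
    using 1 2 unfolding ends by simp
  then have "ennreal (1 / (2 * r)) * (ennreal (2 * r) * (\<integral>\<^sup>+a\<in>{0..pi}. ennreal (\<rho> * sin a) * ?f (?g a) \<partial>lborel)) =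
     ennreal (1 / (2 * r)) * (ennreal 2 * (\<integral>\<^sup>+v\<in>{\<bar>r - \<rho>\<bar>..r + \<rho>}. K v * ennreal v \<partial>lborel))" by simp
  moreover have "ennreal (1 / (2 * r)) * ennreal (2 * r) = 1"
    using r by (simp add: ennreal_mult[symmetric] del: ennreal_mult')
  moreover have "ennreal (1 / (2 * r)) * ennreal 2 = ennreal (1 / r)"
    using r by (subst ennreal_mult[symmetric]) auto
  ultimately show ?thesis by (simp only: mult.assoc[symmetric] mult_1_left)
qed

lemma radial_energy_add:
  assumes [measurable]: "k \<in> borel_measurable borel" "l \<in> borel_measurable borel"
  shows "radial_energy t (\<lambda>p. k p + l p) = radial_energy t k + radial_energy t l"
proof -
  have "radial_energy t (\<lambda>p. k p + l p) =
     (\<integral>\<^sup>+s. (\<integral>\<^sup>+v. k (s, v) * ennreal v \<partial>lborel) * indicator {0..t} s + (\<integral>\<^sup>+v. l (s, v) * ennreal v \<partial>lborel) * indicator {0..t} s \<partial>lborel)"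
    unfolding radial_energy_def
    by (intro nn_integral_cong) (simp add: distrib_right nn_integral_add)
  also have "\<dots> = radial_energy t k + radial_energy t l"
    unfolding radial_energy_def by (rule nn_integral_add) measurable
  finally show ?thesis .
qed

lemma radial_energy_sum:
  assumes "finite I" "\<And>i. i \<in> I \<Longrightarrow> k i \<in> borel_measurable borel"
  shows "radial_energy t (\<lambda>p. \<Sum>i\<in>I. k i p) = (\<Sum>i\<in>I. radial_energy t (k i))"
  using assms
proof (induction I rule: finite_induct)
  case empty
  then show ?case by (simp add: radial_energy_def)
next
  case (insert i I)
  then show ?case by (simp add: radial_energy_add)
qed

lemma radial_wave_sum:
  assumes "finite I" "\<And>i. i \<in> I \<Longrightarrow> k i \<in> borel_measurable borel"
  shows "radial_wave t r (\<lambda>p. \<Sum>i\<in>I. k i p) = (\<Sum>i\<in>I. radial_wave t r (k i))"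
  using assms
proof (induction I rule: finite_induct)
  case empty
  then show ?case by (simp add: radial_wave_def)
next
  case (insert i I)
  have [measurable]: "k i \<in> borel_measurable borel" "(\<lambda>p. \<Sum>i\<in>I. k i p) \<in> borel_measurable borel"
    using insert.prems by (auto intro!: borel_measurable_sum)
  have [measurable]: "Measurable.pred (borel \<Otimes>\<^sub>M borel) (\<lambda>p. snd p \<in> {\<bar>r - (t - fst p)\<bar>..r + (t - fst p)})"
    unfolding atLeastAtMost_iff by measurable
  let ?J = "\<lambda>k s. \<integral>\<^sup>+v\<in>{\<bar>r - (t - s)\<bar>..r + (t - s)}. k (s, v) * ennreal v \<partial>lborel"
  have m: "(\<lambda>s. ?J k s * indicator {0..t} s) \<in> borel_measurable lborel"
    if [measurable]: "k \<in> borel_measurable borel" for k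
  proof -
    have "?J k \<in> borel_measurable borel" by measurable
    then show ?thesis by (intro borel_measurable_times_ennreal borel_measurable_indicator) simp_all
  qed
  let ?l = "\<lambda>p. \<Sum>i\<in>I. k i p"
  have "radial_wave t r (\<lambda>p. k i p + ?l p) = (\<integral>\<^sup>+s. ?J (k i) s * indicator {0..t} s + ?J ?l s * indicator {0..t} s \<partial>lborel)"
    unfolding radial_wave_def
  proof (rule nn_integral_cong)
    fix s
    have "(\<integral>\<^sup>+v. (k i (s, v) + ?l (s, v)) * ennreal v * indicator {\<bar>r - (t - s)\<bar>..r + (t - s)} v \<partial>lborel) = ?J (k i) s + ?J ?l s"
      by (subst nn_integral_add[symmetric]) (auto simp: distrib_right)
    then show "?J (\<lambda>p. k i p + ?l p) s * indicator {0..t} s = ?J (k i) s * indicator {0..t} s + ?J ?l s * indicator {0..t} s"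
      by (simp add: distrib_right)
  qed
  also have "\<dots> = radial_wave t r (k i) + radial_wave t r ?l"
    unfolding radial_wave_def by (rule nn_integral_add) (rule m, measurable)+
  finally show ?case using insert by simp
qed

section \<open>Sobolev inequality on spheres\<close>

abbreviation Om :: "real \<Rightarrow> 3 \<Rightarrow> 3 \<Rightarrow> (spacetime \<Rightarrow> real) \<Rightarrow> spacetime \<Rightarrow> real" where
  "Om t i j \<equiv> vf_deriv (strip t) (Omega i j)"

lemma angular_derivative:
  assumes g: "g differentiable_on strip t" and s: "s \<in> {0..t}"
    and y: "(y has_vector_derivative y') (at \<tau> within I)" and \<tau>: "\<tau> \<in> I"
  shows "((\<lambda>\<tau>. g (s, \<rho> *\<^sub>R y \<tau>)) has_real_derivative (\<Sum>i\<in>UNIV. \<rho> * y' $ i * dx t i g (s, \<rho> *\<^sub>R y \<tau>))) (at \<tau> within I)"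
proof -
  have "((\<lambda>\<tau>. \<rho> *\<^sub>R y \<tau>) has_vector_derivative \<rho> *\<^sub>R y') (at \<tau> within I)"
    using y by (auto intro!: derivative_eq_intros)
  from strip_chain_rule[OF g DERIV_const this \<tau> s] show ?thesis by simp
qed

text \<open>
  Azimuthal motion is a single rotation; motion in the polar distance combines the other two with
  bounded coefficients.
\<close>

lemma polar3_angular_derivatives:
  assumes g: "g differentiable_on strip t" and s: "s \<in> {0..t}"
  shows "a \<in> I \<Longrightarrow> ((\<lambda>a. g (s, \<rho> *\<^sub>R polar3 (a, b))) has_real_derivative
      - cos b * Om t 1 3 g (s, \<rho> *\<^sub>R polar3 (a, b)) - sin b * Om t 2 3 g (s, \<rho> *\<^sub>R polar3 (a, b))) (at a within I)"
    and "b \<in> I \<Longrightarrow> ((\<lambda>b. g (s, \<rho> *\<^sub>R polar3 (a, b))) has_real_derivative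
      Om t 1 2 g (s, \<rho> *\<^sub>R polar3 (a, b))) (at b within I)"
proof -
  have p: "(s, y) \<in> strip t" for y using s by (auto simp: strip_def)
  have pyth: "cos b * (cos b * X) + sin b * (sin b * X) = X" for b X :: real
    by (simp add: mult.assoc[symmetric] power2_eq_square[symmetric] distrib_right[symmetric])
  show "((\<lambda>a. g (s, \<rho> *\<^sub>R polar3 (a, b))) has_real_derivative
      - cos b * Om t 1 3 g (s, \<rho> *\<^sub>R polar3 (a, b)) - sin b * Om t 2 3 g (s, \<rho> *\<^sub>R polar3 (a, b))) (at a within I)"
    if "a \<in> I"
  proof (rule DERIV_cong[OF angular_derivative[OF g s polar3_derivatives(1) that]])
    let ?D = "\<lambda>i. dx t i g (s, \<rho> *\<^sub>R polar3 (a, b))"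
    show "(\<Sum>i\<in>UNIV. \<rho> * polar3_a (a, b) $ i * ?D i) =
      - cos b * Om t 1 3 g (s, \<rho> *\<^sub>R polar3 (a, b)) - sin b * Om t 2 3 g (s, \<rho> *\<^sub>R polar3 (a, b))"
      unfolding vf_deriv_Omega[OF g p] sum_3
      using pyth[of b "\<rho> * sin a * ?D 3"] by (simp add: polar3_a_def polar3_def algebra_simps)
  qed
  show "((\<lambda>b. g (s, \<rho> *\<^sub>R polar3 (a, b))) has_real_derivative Om t 1 2 g (s, \<rho> *\<^sub>R polar3 (a, b))) (at b within I)"
    if "b \<in> I"
    by (rule DERIV_cong[OF angular_derivative[OF g s polar3_derivatives(2) that]])
      (simp add: vf_deriv_Omega[OF g p] sum_3 polar3_b_def polar3_def algebra_simps)
qed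

lemma polar1_angular_derivatives:
  assumes g: "g differentiable_on strip t" and s: "s \<in> {0..t}"
  shows "a \<in> I \<Longrightarrow> ((\<lambda>a. g (s, \<rho> *\<^sub>R polar1 (a, b))) has_real_derivative
      cos b * Om t 1 2 g (s, \<rho> *\<^sub>R polar1 (a, b)) + sin b * Om t 1 3 g (s, \<rho> *\<^sub>R polar1 (a, b))) (at a within I)"
    and "b \<in> I \<Longrightarrow> ((\<lambda>b. g (s, \<rho> *\<^sub>R polar1 (a, b))) has_real_derivative
      Om t 2 3 g (s, \<rho> *\<^sub>R polar1 (a, b))) (at b within I)"
proof -
  have p: "(s, y) \<in> strip t" for y using s by (auto simp: strip_def)
  have pyth: "cos b * (cos b * X) + sin b * (sin b * X) = X" for b X :: real
    by (simp add: mult.assoc[symmetric] power2_eq_square[symmetric] distrib_right[symmetric])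
  show "((\<lambda>a. g (s, \<rho> *\<^sub>R polar1 (a, b))) has_real_derivative
      cos b * Om t 1 2 g (s, \<rho> *\<^sub>R polar1 (a, b)) + sin b * Om t 1 3 g (s, \<rho> *\<^sub>R polar1 (a, b))) (at a within I)"
    if "a \<in> I"
  proof (rule DERIV_cong[OF angular_derivative[OF g s polar1_derivatives(1) that]])
    let ?D = "\<lambda>i. dx t i g (s, \<rho> *\<^sub>R polar1 (a, b))"
    show "(\<Sum>i\<in>UNIV. \<rho> * polar1_a (a, b) $ i * ?D i) =
      cos b * Om t 1 2 g (s, \<rho> *\<^sub>R polar1 (a, b)) + sin b * Om t 1 3 g (s, \<rho> *\<^sub>R polar1 (a, b))"
      unfolding vf_deriv_Omega[OF g p] sum_3
      using pyth[of b "\<rho> * sin a * ?D 1"] by (simp add: polar1_a_def polar1_def algebra_simps)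
  qed
  show "((\<lambda>b. g (s, \<rho> *\<^sub>R polar1 (a, b))) has_real_derivative Om t 2 3 g (s, \<rho> *\<^sub>R polar1 (a, b))) (at b within I)"
    if "b \<in> I"
    by (rule DERIV_cong[OF angular_derivative[OF g s polar1_derivatives(2) that]])
      (simp add: vf_deriv_Omega[OF g p] sum_3 polar1_def algebra_simps)
qed

lemma abs_le_interval_integral:
  fixes f f' X :: "real \<Rightarrow> real"
  assumes "1 \<le> d - c" "x \<in> {c..d}" "continuous_on {c..d} f'"
    and der: "\<And>y. y \<in> {c..d} \<Longrightarrow> (f has_real_derivative f' y) (at y within {c..d})"
    and le: "\<And>y. y \<in> {c..d} \<Longrightarrow> \<bar>f y\<bar> + \<bar>f' y\<bar> \<le> X y"
  shows "ennreal \<bar>f x\<bar> \<le> (\<integral>\<^sup>+y\<in>{c..d}. ennreal (X y) \<partial>lborel)"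
proof -
  have "ennreal \<bar>f x\<bar> \<le> (\<integral>\<^sup>+y\<in>{c..d}. ennreal (\<bar>f y\<bar> / (d - c) + \<bar>f' y\<bar>) \<partial>lborel)"
    using assms by (intro abs_le_average_plus_derivative) auto
  also have "\<dots> \<le> (\<integral>\<^sup>+y\<in>{c..d}. ennreal (X y) \<partial>lborel)"
  proof (rule nn_integral_mono)
    fix y
    have "\<bar>f y\<bar> / (d - c) \<le> \<bar>f y\<bar> / 1" using assms(1) by (intro divide_left_mono) auto
    then show "ennreal (\<bar>f y\<bar> / (d - c) + \<bar>f' y\<bar>) * indicator {c..d} y \<le> ennreal (X y) * indicator {c..d} y"
    proof (cases "y \<in> {c..d}")
      case True
      with \<open>\<bar>f y\<bar> / (d - c) \<le> \<bar>f y\<bar> / 1\<close> le[OF True]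
      have "\<bar>f y\<bar> / (d - c) + \<bar>f' y\<bar> \<le> X y" by simp
      then show ?thesis by (intro mult_right_mono ennreal_leI) auto
    qed simp
  qed
  finally show ?thesis .
qed

lemma angle_ranges_ge_1: "1 \<le> 3 * pi / 4 - pi / 4" "1 \<le> 2 * pi - 0"
  using pi_ge_two by linarith+

text \<open>
  The multi-indices, in the order of \<open>Z_fields\<close>, that occur in the Sobolev inequality on the sphere. The
  repeated rotations are absent because each of the two angles is differentiated at most once.
\<close>

definition angular_indices :: "nat list set" where
  "angular_indices = {[0,0,0,0,0,0,0], [0,0,0,0,1,0,0], [0,0,0,0,0,1,0], [0,0,0,0,0,0,1],
     [0,0,0,0,1,1,0], [0,0,0,0,1,0,1], [0,0,0,0,0,1,1]}"

lemma Z_pow_angular: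
  "Z_pow S [0,0,0,0,0,0,0] f = f"
  "Z_pow S [0,0,0,0,1,0,0] f = vf_deriv S (Omega 1 2) f"
  "Z_pow S [0,0,0,0,0,1,0] f = vf_deriv S (Omega 1 3) f"
  "Z_pow S [0,0,0,0,0,0,1] f = vf_deriv S (Omega 2 3) f"
  "Z_pow S [0,0,0,0,1,1,0] f = vf_deriv S (Omega 1 2) (vf_deriv S (Omega 1 3) f)"
  "Z_pow S [0,0,0,0,1,0,1] f = vf_deriv S (Omega 1 2) (vf_deriv S (Omega 2 3) f)"
  "Z_pow S [0,0,0,0,0,1,1] f = vf_deriv S (Omega 1 3) (vf_deriv S (Omega 2 3) f)"
  by (simp_all add: Z_pow_def Z_fields_def)

lemma sum_angular_indices:
  "(\<Sum>\<alpha>\<in>angular_indices. \<bar>Z_pow (strip t) \<alpha> f p\<bar>) = \<bar>f p\<bar> + \<bar>Om t 1 2 f p\<bar> + \<bar>Om t 1 3 f p\<bar> + \<bar>Om t 2 3 f p\<bar>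
    + \<bar>Om t 1 2 (Om t 1 3 f) p\<bar> + \<bar>Om t 1 2 (Om t 2 3 f) p\<bar> + \<bar>Om t 1 3 (Om t 2 3 f) p\<bar>"
  unfolding angular_indices_def by (simp add: Z_pow_angular[unfolded One_nat_def])

lemma finite_angular_indices: "finite angular_indices"
  by (simp add: angular_indices_def)

lemma Ck_on_angular:
  assumes "t > 0" "Ck_on (Suc (Suc k)) (strip t) f" "\<alpha> \<in> angular_indices"
  shows "Ck_on k (strip t) (Z_pow (strip t) \<alpha> f)"
proof -
  note C = Ck_on_Omega[OF assms(1)]
  have f0: "Ck_on k (strip t) f" and f1: "Ck_on (Suc k) (strip t) f"
    using Ck_on_le[OF assms(2)] by (simp_all del: Ck_on.simps)
  show ?thesis
    using assms(3) f0 C[OF f1] C[OF C[OF assms(2)]]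
    unfolding angular_indices_def by (auto simp: Z_pow_angular simp del: Ck_on.simps One_nat_def)
qed

lemma continuous_on_sphere_slice:
  assumes "continuous_on (strip t) g" "s \<in> {0..t}" "continuous_on A P"
  shows "continuous_on A (\<lambda>z. g (s, \<rho> *\<^sub>R P z))"
  by (rule continuous_on_strip_compose[OF assms(1)]) (use assms in \<open>auto intro!: continuous_intros\<close>)

text \<open>
  Integrate first in the polar distance, then in the azimuth. The azimuthal rotation, here
  \<open>Omega 1 2\<close>, is then applied last, which is the order of factors that \<open>Z_pow\<close> prescribes.
\<close>

lemma sphere_sobolev_polar3:
  assumes t: "t > 0" and f: "Ck_on 2 (strip t) f" and s: "s \<in> {0..t}" and z: "z \<in> angles"
  shows "ennreal \<bar>f (s, \<rho> *\<^sub>R polar3 z)\<bar> \<le>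
    (\<integral>\<^sup>+z\<in>angles. ennreal (\<Sum>\<alpha>\<in>angular_indices. \<bar>Z_pow (strip t) \<alpha> f (s, \<rho> *\<^sub>R polar3 z)\<bar>) \<partial>lborel)"
proof -
  have f2: "Ck_on (Suc (Suc 0)) (strip t) f" using f by (simp add: numeral_2_eq_2)
  have f1: "Ck_on (Suc 0) (strip t) f" using f by (rule Ck_on_le) simp
  obtain a0 b0 where z0: "z = (a0, b0)" by force
  have a0: "a0 \<in> {pi / 4..3 * pi / 4}" and b0: "b0 \<in> {0..2 * pi}" using z by (auto simp: z0 angles_def)
  let ?q = "\<lambda>a b. (s, \<rho> *\<^sub>R polar3 (a, b))"
  let ?G = "\<lambda>g p. \<bar>g p\<bar> + \<bar>Om t 1 2 g p\<bar>"
  have cO: "continuous_on (strip t) (Om t i j g)" if "Ck_on (Suc 0) (strip t) g" for g i j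
    using Ck_on_Omega[OF t that] by simp
  have cP1: "continuous_on A (\<lambda>b. polar3 (a, b))" for a A
    by (rule continuous_on_compose2[OF continuous_on_polar(1)[of UNIV]]) (auto intro!: continuous_intros)
  have cP2: "continuous_on A (\<lambda>a. polar3 (a, b))" for b A
    by (rule continuous_on_compose2[OF continuous_on_polar(1)[of UNIV]]) (auto intro!: continuous_intros)
  have dg: "g differentiable_on strip t" if "Ck_on (Suc 0) (strip t) g" for g
    using that by simp
  have stepb: "ennreal \<bar>g (?q a b0)\<bar> \<le> (\<integral>\<^sup>+b\<in>{0..2 * pi}. ennreal (?G g (?q a b)) \<partial>lborel)"
    if g: "Ck_on (Suc 0) (strip t) g" for g a
    by (rule abs_le_interval_integral[OF angle_ranges_ge_1(2) b0 _ polar3_angular_derivatives(2)[OF dg[OF g] s]])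
      (auto intro!: continuous_on_sphere_slice[OF cO[OF g] s cP1])
  let ?H = "\<lambda>p. ?G f p + ?G (Om t 1 3 f) p + ?G (Om t 2 3 f) p"
  have C1: "Ck_on (Suc 0) (strip t) (Om t i j f)" for i j by (rule Ck_on_Omega[OF t f2])
  have mb: "(\<lambda>b. ennreal (?G g (?q a b)) * indicator {0..2 * pi} b) \<in> borel_measurable lborel"
    if g: "Ck_on (Suc 0) (strip t) g" for g a
  proof -
    have "(\<lambda>b. ?G g (?q a b)) \<in> borel_measurable borel"
      by (intro borel_measurable_continuous_onI continuous_intros
          continuous_on_sphere_slice[OF _ s cP1] cO[OF g] Ck_on_imp_continuous[OF g])
    then show ?thesis by measurable
  qed
  have "ennreal \<bar>f (?q a0 b0)\<bar> \<le> (\<integral>\<^sup>+a\<in>{pi / 4..3 * pi / 4}.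
      ennreal (\<bar>f (?q a b0)\<bar> + \<bar>Om t 1 3 f (?q a b0)\<bar> + \<bar>Om t 2 3 f (?q a b0)\<bar>) \<partial>lborel)"
  proof (rule abs_le_interval_integral[OF angle_ranges_ge_1(1) a0 _ polar3_angular_derivatives(1)[OF dg[OF f1] s]])
    show "continuous_on {pi / 4..3 * pi / 4} (\<lambda>a. - cos b0 * Om t 1 3 f (?q a b0) - sin b0 * Om t 2 3 f (?q a b0))"
      by (intro continuous_intros continuous_on_sphere_slice[OF cO[OF f1] s cP2])
    fix a
    have "\<bar>cos b0 * X\<bar> \<le> \<bar>X\<bar>" "\<bar>sin b0 * X\<bar> \<le> \<bar>X\<bar>" for X
      by (auto simp: abs_mult intro!: mult_left_le_one_le)
    from this(1)[of "Om t 1 3 f (?q a b0)"] this(2)[of "Om t 2 3 f (?q a b0)"]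
    show "\<bar>f (?q a b0)\<bar> + \<bar>- cos b0 * Om t 1 3 f (?q a b0) - sin b0 * Om t 2 3 f (?q a b0)\<bar>
       \<le> \<bar>f (?q a b0)\<bar> + \<bar>Om t 1 3 f (?q a b0)\<bar> + \<bar>Om t 2 3 f (?q a b0)\<bar>"
      by linarith
  qed
  also have "\<dots> \<le> (\<integral>\<^sup>+a\<in>{pi / 4..3 * pi / 4}. (\<integral>\<^sup>+b\<in>{0..2 * pi}. ennreal (?H (?q a b)) \<partial>lborel) \<partial>lborel)"
  proof (rule nn_integral_mono, rule mult_right_mono)
    fix a
    let ?I = "\<lambda>g. \<integral>\<^sup>+b\<in>{0..2 * pi}. ennreal (?G g (?q a b)) \<partial>lborel"
    have "ennreal (\<bar>f (?q a b0)\<bar> + \<bar>Om t 1 3 f (?q a b0)\<bar> + \<bar>Om t 2 3 f (?q a b0)\<bar>) \<le>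
       ?I f + ?I (Om t 1 3 f) + ?I (Om t 2 3 f)"
      using stepb[OF f1, of a] stepb[OF C1[of 1 3], of a] stepb[OF C1[of 2 3], of a]
      by (simp add: add_mono)
    also have "\<dots> = (\<integral>\<^sup>+b\<in>{0..2 * pi}. ennreal (?H (?q a b)) \<partial>lborel)"
      using mb[OF f1, of a] mb[OF C1[of 1 3], of a] mb[OF C1[of 2 3], of a]
      by (subst nn_integral_add[symmetric], simp, simp, subst nn_integral_add[symmetric], simp, simp)
        (auto intro!: nn_integral_cong split: split_indicator)
    finally show "ennreal (\<bar>f (?q a b0)\<bar> + \<bar>Om t 1 3 f (?q a b0)\<bar> + \<bar>Om t 2 3 f (?q a b0)\<bar>) \<le>
       (\<integral>\<^sup>+b\<in>{0..2 * pi}. ennreal (?H (?q a b)) \<partial>lborel)" .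
  qed simp
  also have "\<dots> = (\<integral>\<^sup>+z\<in>angles. ennreal (?H (s, \<rho> *\<^sub>R polar3 z)) \<partial>lborel)"
  proof (rule nn_integral_angles(1)[symmetric])
    have "(\<lambda>z. ?H (s, \<rho> *\<^sub>R polar3 z)) \<in> borel_measurable borel"
      by (intro borel_measurable_continuous_onI continuous_intros
          continuous_on_sphere_slice[OF _ s continuous_on_polar(1)]
          cO[OF f1] cO[OF C1] Ck_on_imp_continuous[OF f1] Ck_on_imp_continuous[OF C1])
    then show "(\<lambda>z. ennreal (?H (s, \<rho> *\<^sub>R polar3 z))) \<in> borel_measurable borel"
      by measurable
  qed
  also have "\<dots> \<le> (\<integral>\<^sup>+z\<in>angles. ennreal (\<Sum>\<alpha>\<in>angular_indices. \<bar>Z_pow (strip t) \<alpha> f (s, \<rho> *\<^sub>R polar3 z)\<bar>) \<partial>lborel)"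
    unfolding sum_angular_indices by (intro nn_integral_mono mult_right_mono ennreal_leI) auto
  finally show ?thesis by (simp only: z0)
qed

text \<open>
  The azimuthal rotation is now \<open>Omega 2 3\<close>, which \<open>Z_pow\<close> applies first. Hence the order of the two
  integrations is opposite to that for \<open>polar3\<close>; no commutators arise in either chart.
\<close>

lemma sphere_sobolev_polar1:
  assumes t: "t > 0" and f: "Ck_on 2 (strip t) f" and s: "s \<in> {0..t}" and z: "z \<in> angles"
  shows "ennreal \<bar>f (s, \<rho> *\<^sub>R polar1 z)\<bar> \<le>
    (\<integral>\<^sup>+z\<in>angles. ennreal (\<Sum>\<alpha>\<in>angular_indices. \<bar>Z_pow (strip t) \<alpha> f (s, \<rho> *\<^sub>R polar1 z)\<bar>) \<partial>lborel)"
proof -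
  have f2: "Ck_on (Suc (Suc 0)) (strip t) f" using f by (simp add: numeral_2_eq_2)
  have f1: "Ck_on (Suc 0) (strip t) f" using f by (rule Ck_on_le) simp
  obtain a0 b0 where z0: "z = (a0, b0)" by force
  have a0: "a0 \<in> {pi / 4..3 * pi / 4}" and b0: "b0 \<in> {0..2 * pi}" using z by (auto simp: z0 angles_def)
  let ?q = "\<lambda>a b. (s, \<rho> *\<^sub>R polar1 (a, b))"
  let ?G = "\<lambda>g p. \<bar>g p\<bar> + \<bar>Om t 1 2 g p\<bar> + \<bar>Om t 1 3 g p\<bar>"
  have cO: "continuous_on (strip t) (Om t i j g)" if "Ck_on (Suc 0) (strip t) g" for g i j
    using Ck_on_Omega[OF t that] by simp
  have cP1: "continuous_on A (\<lambda>b. polar1 (a, b))" for a A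
    by (rule continuous_on_compose2[OF continuous_on_polar(2)[of UNIV]]) (auto intro!: continuous_intros)
  have cP2: "continuous_on A (\<lambda>a. polar1 (a, b))" for b A
    by (rule continuous_on_compose2[OF continuous_on_polar(2)[of UNIV]]) (auto intro!: continuous_intros)
  have dg: "g differentiable_on strip t" if "Ck_on (Suc 0) (strip t) g" for g
    using that by simp
  have C1: "Ck_on (Suc 0) (strip t) (Om t i j f)" for i j by (rule Ck_on_Omega[OF t f2])
  have stepa: "ennreal \<bar>g (?q a0 b)\<bar> \<le> (\<integral>\<^sup>+a\<in>{pi / 4..3 * pi / 4}. ennreal (?G g (?q a b)) \<partial>lborel)"
    if g: "Ck_on (Suc 0) (strip t) g" for g b
  proof (rule abs_le_interval_integral[OF angle_ranges_ge_1(1) a0 _ polar1_angular_derivatives(1)[OF dg[OF g] s]])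
    show "continuous_on {pi / 4..3 * pi / 4} (\<lambda>a. cos b * Om t 1 2 g (?q a b) + sin b * Om t 1 3 g (?q a b))"
      by (intro continuous_intros continuous_on_sphere_slice[OF cO[OF g] s cP2])
    fix a
    have "\<bar>cos b * X\<bar> \<le> \<bar>X\<bar>" "\<bar>sin b * X\<bar> \<le> \<bar>X\<bar>" for X
      by (auto simp: abs_mult intro!: mult_left_le_one_le)
    from this(1)[of "Om t 1 2 g (?q a b)"] this(2)[of "Om t 1 3 g (?q a b)"]
    show "\<bar>g (?q a b)\<bar> + \<bar>cos b * Om t 1 2 g (?q a b) + sin b * Om t 1 3 g (?q a b)\<bar> \<le> ?G g (?q a b)"
      by linarith
  qed
  let ?H = "\<lambda>p. ?G f p + ?G (Om t 2 3 f) p"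
  have mb: "(\<lambda>a. ennreal (?G g (?q a b)) * indicator {pi / 4..3 * pi / 4} a) \<in> borel_measurable lborel"
    if g: "Ck_on (Suc 0) (strip t) g" for g b
  proof -
    have "(\<lambda>a. ?G g (?q a b)) \<in> borel_measurable borel"
      by (intro borel_measurable_continuous_onI continuous_intros
          continuous_on_sphere_slice[OF _ s cP2] cO[OF g] Ck_on_imp_continuous[OF g])
    then show ?thesis by measurable
  qed
  have "ennreal \<bar>f (?q a0 b0)\<bar> \<le> (\<integral>\<^sup>+b\<in>{0..2 * pi}.
      ennreal (\<bar>f (?q a0 b)\<bar> + \<bar>Om t 2 3 f (?q a0 b)\<bar>) \<partial>lborel)"
    by (rule abs_le_interval_integral[OF angle_ranges_ge_1(2) b0 _ polar1_angular_derivatives(2)[OF dg[OF f1] s]])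
      (auto intro!: continuous_on_sphere_slice[OF cO[OF f1] s cP1])
  also have "\<dots> \<le> (\<integral>\<^sup>+b\<in>{0..2 * pi}. (\<integral>\<^sup>+a\<in>{pi / 4..3 * pi / 4}. ennreal (?H (?q a b)) \<partial>lborel) \<partial>lborel)"
  proof (rule nn_integral_mono, rule mult_right_mono)
    fix b
    let ?I = "\<lambda>g. \<integral>\<^sup>+a\<in>{pi / 4..3 * pi / 4}. ennreal (?G g (?q a b)) \<partial>lborel"
    have "ennreal (\<bar>f (?q a0 b)\<bar> + \<bar>Om t 2 3 f (?q a0 b)\<bar>) \<le> ?I f + ?I (Om t 2 3 f)"
      using stepa[OF f1, of b] stepa[OF C1[of 2 3], of b] by (simp add: add_mono)
    also have "\<dots> = (\<integral>\<^sup>+a\<in>{pi / 4..3 * pi / 4}. ennreal (?H (?q a b)) \<partial>lborel)"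
      using mb[OF f1, of b] mb[OF C1[of 2 3], of b]
      by (subst nn_integral_add[symmetric], simp, simp)
        (auto intro!: nn_integral_cong split: split_indicator)
    finally show "ennreal (\<bar>f (?q a0 b)\<bar> + \<bar>Om t 2 3 f (?q a0 b)\<bar>) \<le>
       (\<integral>\<^sup>+a\<in>{pi / 4..3 * pi / 4}. ennreal (?H (?q a b)) \<partial>lborel)" .
  qed simp
  also have "\<dots> = (\<integral>\<^sup>+z\<in>angles. ennreal (?H (s, \<rho> *\<^sub>R polar1 z)) \<partial>lborel)"
  proof (rule nn_integral_angles(2)[symmetric])
    have "(\<lambda>z. ?H (s, \<rho> *\<^sub>R polar1 z)) \<in> borel_measurable borel"
      by (intro borel_measurable_continuous_onI continuous_intros
          continuous_on_sphere_slice[OF _ s continuous_on_polar(2)]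
          cO[OF f1] cO[OF C1] Ck_on_imp_continuous[OF f1] Ck_on_imp_continuous[OF C1])
    then show "(\<lambda>z. ennreal (?H (s, \<rho> *\<^sub>R polar1 z))) \<in> borel_measurable borel"
      by measurable
  qed
  also have "\<dots> \<le> (\<integral>\<^sup>+z\<in>angles. ennreal (\<Sum>\<alpha>\<in>angular_indices. \<bar>Z_pow (strip t) \<alpha> f (s, \<rho> *\<^sub>R polar1 z)\<bar>) \<partial>lborel)"
    unfolding sum_angular_indices by (intro nn_integral_mono mult_right_mono ennreal_leI) auto
  finally show ?thesis by (simp only: z0)
qed

text \<open>
  The chart that contains the direction of \<open>y\<close> would do; summing over both makes the bound depend on
  \<open>norm y\<close> only.
\<close>

proposition sphere_sobolev:
  assumes t: "t > 0" and f: "Ck_on 2 (strip t) f" and s: "s \<in> {0..t}"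
  shows "ennreal \<bar>f (s, y)\<bar> \<le> (\<Sum>P\<in>{polar3, polar1}. \<Sum>\<alpha>\<in>angular_indices.
    \<integral>\<^sup>+z\<in>angles. ennreal \<bar>Z_pow (strip t) \<alpha> f (s, norm y *\<^sub>R P z)\<bar> \<partial>lborel)"
proof -
  \<comment> \<open>at the origin any direction serves\<close>
  define \<theta> where "\<theta> = (if y = 0 then axis 1 1 else y /\<^sub>R norm y)"
  have "norm \<theta> = 1" by (simp add: \<theta>_def)
  then obtain P z where P: "P \<in> {polar3, polar1}" "z \<in> angles" "P z = \<theta>" by (rule polar_chart_cover)
  have y: "y = norm y *\<^sub>R P z" unfolding P(3) by (simp add: \<theta>_def)
  have f2: "Ck_on (Suc (Suc 0)) (strip t) f" using f by (simp add: numeral_2_eq_2)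
  have cZ: "continuous_on (strip t) (Z_pow (strip t) \<alpha> f)" if "\<alpha> \<in> angular_indices" for \<alpha>
    using Ck_on_angular[OF t f2 that] by simp
  have cP: "continuous_on UNIV P" using P continuous_on_polar by auto
  have "ennreal \<bar>f (s, y)\<bar> \<le>
    (\<integral>\<^sup>+z\<in>angles. ennreal (\<Sum>\<alpha>\<in>angular_indices. \<bar>Z_pow (strip t) \<alpha> f (s, norm y *\<^sub>R P z)\<bar>) \<partial>lborel)"
    using sphere_sobolev_polar3[OF t f s P(2), of "norm y"] sphere_sobolev_polar1[OF t f s P(2), of "norm y"] P(1) y
    by auto
  also have "\<dots> = (\<integral>\<^sup>+z. (\<Sum>\<alpha>\<in>angular_indices. ennreal \<bar>Z_pow (strip t) \<alpha> f (s, norm y *\<^sub>R P z)\<bar> * indicator angles z) \<partial>lborel)"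
    by (intro nn_integral_cong) (auto simp: sum_ennreal split: split_indicator)
  also have "\<dots> = (\<Sum>\<alpha>\<in>angular_indices. \<integral>\<^sup>+z\<in>angles. ennreal \<bar>Z_pow (strip t) \<alpha> f (s, norm y *\<^sub>R P z)\<bar> \<partial>lborel)"
  proof (rule nn_integral_sum)
    fix \<alpha> assume \<alpha>: "\<alpha> \<in> angular_indices"
    have "(\<lambda>z. \<bar>Z_pow (strip t) \<alpha> f (s, norm y *\<^sub>R P z)\<bar>) \<in> borel_measurable borel"
      by (intro borel_measurable_continuous_onI continuous_intros continuous_on_sphere_slice[OF cZ[OF \<alpha>] s cP])
    then show "(\<lambda>z. ennreal \<bar>Z_pow (strip t) \<alpha> f (s, norm y *\<^sub>R P z)\<bar> * indicator angles z) \<in> borel_measurable lborel"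
      by measurable
  qed
  also have "\<dots> \<le> (\<Sum>P\<in>{polar3, polar1}. \<Sum>\<alpha>\<in>angular_indices.
    \<integral>\<^sup>+z\<in>angles. ennreal \<bar>Z_pow (strip t) \<alpha> f (s, norm y *\<^sub>R P z)\<bar> \<partial>lborel)"
    by (rule member_le_sum[OF P(1)]) auto
  finally show ?thesis .
qed

section \<open>Majorizing the source by spherical means\<close>

lemma ennreal_abs_integral_le:
  fixes f :: "'a::euclidean_space \<Rightarrow> real"
  assumes "continuous_on (cbox a b) f"
  shows "ennreal \<bar>integral (cbox a b) f\<bar> \<le> (\<integral>\<^sup>+x\<in>cbox a b. ennreal \<bar>f x\<bar> \<partial>lborel)"
proof -
  have "norm (integral (cbox a b) f) \<le> integral (cbox a b) (\<lambda>x. \<bar>f x\<bar>)"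
    using assms by (intro integral_norm_bound_integral integrable_continuous continuous_intros) auto
  then have "ennreal \<bar>integral (cbox a b) f\<bar> \<le> ennreal (integral (cbox a b) (\<lambda>x. \<bar>f x\<bar>))"
    by (intro ennreal_leI) simp
  also have "\<dots> = (\<integral>\<^sup>+x\<in>cbox a b. ennreal \<bar>f x\<bar> \<partial>lborel)"
    using assms by (intro nn_integral_continuous_on_compact[symmetric] continuous_intros) auto
  finally show ?thesis .
qed

text \<open>
  The pole is placed opposite to \<open>x\<close>, so that the distance of \<open>x + \<rho> *\<^sub>R T (polar3 z)\<close> from the origin
  increases with the polar distance.
\<close>

lemma orthogonal_axis3_exists:
  fixes x :: "real^3"
  obtains T :: "real^3 \<Rightarrow> real^3" where "orthogonal_transformation T"
    "\<And>z. x \<bullet> T (polar3 z) = - (norm x * cos (fst z))"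
proof -
  define u where "u = (if x = 0 then axis 3 1 else - (x /\<^sub>R norm x))"
  have "norm u = 1" by (simp add: u_def)
  then obtain T :: "real^3 \<Rightarrow> real^3" where T: "orthogonal_transformation T" "T (axis 3 1) = u"
    using orthogonal_transformation_exists_1[of "axis 3 1 :: real^3" u] by auto
  have x: "x = - (norm x *\<^sub>R T (axis 3 1))" by (simp add: T u_def)
  have "x \<bullet> T (polar3 z) = - (norm x * cos (fst z))" for z
  proof -
    have "T (axis 3 1) \<bullet> T (polar3 z) = axis 3 1 \<bullet> polar3 z"
      using T(1) by (simp add: orthogonal_transformation_def)
    also have "\<dots> = cos (fst z)" by (simp add: inner_axis' polar3_def)
    finally show ?thesis by (subst x) simp
  qed
  with T(1) show ?thesis using that by blast
qed

text \<open>
  The comparison with a radial source: the distance to the origin of a point on the sphere about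
  \<open>x\<close> depends on its polar distance only, so the azimuth integrates to \<open>2 * pi\<close> and Archimedes'
  theorem does the rest.
\<close>

proposition wave_le_radial_wave:
  assumes t: "t > 0" and w: "Ck_on 2 (strip t) w" and box: "\<And>p. p \<in> strip t \<Longrightarrow> box_op (strip t) w p = F p"
    and w0: "\<And>y. w (0, y) = 0" and w1: "\<And>y. dt t w (0, y) = 0"
    and H[measurable]: "H \<in> borel_measurable borel"
    and FH: "\<And>s y. s \<in> {0..t} \<Longrightarrow> ennreal \<bar>F (s, y)\<bar> \<le> H (s, norm y)"
    and x: "x \<noteq> 0"
  shows "ennreal (2 * \<bar>w (t, x)\<bar>) \<le> ennreal (1 / norm x) * radial_wave t (norm x) H"
proof -
  let ?r = "norm x"
  let ?W = "\<lambda>\<rho>. \<integral>\<^sup>+v\<in>{\<bar>?r - \<rho>\<bar>..?r + \<rho>}. H (t - \<rho>, v) * ennreal v \<partial>lborel"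
  have r: "?r > 0" using x by simp
  have w2: "Ck_on (Suc (Suc 0)) (strip t) w" using w by (simp add: numeral_2_eq_2)
  have "Ck_on 0 (strip t) (box_op (strip t) w)" by (rule Ck_on_box_op[OF t w2])
  then have cF: "continuous_on (strip t) F" using box by (simp cong: continuous_on_cong)
  obtain T where T: "orthogonal_transformation T" "\<And>z. x \<bullet> T (polar3 z) = - (?r * cos (fst z))"
    using orthogonal_axis3_exists[of x] by blast
  have bT: "bounded_linear T"
    using T by (simp add: orthogonal_transformation_def linear_conv_bounded_linear)
  let ?B = "cbox (0, 0) (pi, 2 * pi) :: (real \<times> real) set"
  let ?g = "\<lambda>z \<rho>. sin (fst z) * (\<rho> * F (t - \<rho>, x + \<rho> *\<^sub>R T (polar3 z)))"
  have cTp: "continuous_on A (\<lambda>p. T (polar3 (h p)))" if "continuous_on A h"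
    for A and h :: "'z::topological_space \<Rightarrow> real \<times> real"
    by (intro bounded_linear.continuous_on[OF bT] continuous_on_compose2[OF continuous_on_polar(1)[of UNIV] that]) simp
  have cg: "continuous_on (?B \<times> cbox 0 t) (\<lambda>(z, \<rho>). ?g z \<rho>)"
    unfolding case_prod_unfold
    by (intro continuous_intros continuous_on_strip_compose[OF cF] cTp) auto
  have cg1: "continuous_on (cbox 0 t) (?g z)" for z
    by (intro continuous_on_mult continuous_on_const continuous_on_id continuous_on_diff continuous_on_add
        continuous_on_scaleR continuous_on_strip_compose[OF cF]) auto
  have nrm: "norm (x + \<rho> *\<^sub>R T (polar3 z)) = sqrt (?r\<^sup>2 + \<rho>\<^sup>2 - 2 * ?r * \<rho> * cos (fst z))" for \<rho> z
  proof -
    have "norm (T (polar3 z)) = 1"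
      using T(1) by (simp add: orthogonal_transformation_norm norm_polar3)
    then have "T (polar3 z) \<bullet> T (polar3 z) = 1" by (simp add: norm_eq_1)
    then have "(norm (x + \<rho> *\<^sub>R T (polar3 z)))\<^sup>2 = ?r\<^sup>2 + \<rho>\<^sup>2 - 2 * ?r * \<rho> * cos (fst z)"
    proof -
      have "(x + \<rho> *\<^sub>R p) \<bullet> (x + \<rho> *\<^sub>R p) = x \<bullet> x + 2 * \<rho> * (x \<bullet> p) + \<rho>\<^sup>2 * (p \<bullet> p)" for p
        by (simp add: inner_add_left inner_add_right inner_commute[of p x] power2_eq_square distrib_left)
      from this[of "T (polar3 z)"] show ?thesis
        unfolding power2_norm_eq_inner T(2) \<open>T (polar3 z) \<bullet> T (polar3 z) = 1\<close> by simp
    qed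
    then show ?thesis by (metis norm_ge_zero real_sqrt_unique)
  qed
  have [measurable]: "Measurable.pred (borel \<Otimes>\<^sub>M borel) (\<lambda>p. snd p \<in> {\<bar>?r - fst p\<bar>..?r + fst p})"
    unfolding atLeastAtMost_iff by measurable
  define Y where "Y \<rho> a = ennreal (\<rho> * sin a) * H (t - \<rho>, sqrt (?r\<^sup>2 + \<rho>\<^sup>2 - 2 * ?r * \<rho> * cos a))" for \<rho> a
  have Y[measurable]: "(\<lambda>p. Y (f p) (h p)) \<in> borel_measurable M"
    if [measurable]: "f \<in> borel_measurable M" "h \<in> borel_measurable M" for f h and M :: "'z measure"
    unfolding Y_def by measurable
  have gY: "ennreal \<bar>?g z \<rho>\<bar> \<le> Y \<rho> (fst z)" if "z \<in> ?B" "\<rho> \<in> cbox 0 t" for z \<rho>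
  proof -
    have "0 \<le> sin (fst z)" using that by (intro sin_ge_zero) (auto simp: cbox_Pair_eq)
    then have "ennreal \<bar>?g z \<rho>\<bar> = ennreal (\<rho> * sin (fst z)) * ennreal \<bar>F (t - \<rho>, x + \<rho> *\<^sub>R T (polar3 z))\<bar>"
      using that by (simp add: abs_mult ennreal_mult[symmetric] ac_simps)
    also have "\<dots> \<le> Y \<rho> (fst z)"
      unfolding Y_def nrm[symmetric] using that by (intro mult_left_mono FH) auto
    finally show ?thesis .
  qed
  have "ennreal (4 * pi * \<bar>w (t, x)\<bar>) = ennreal \<bar>4 * pi * w (t, x)\<bar>"
    by (simp add: abs_mult)
  also have "\<dots> = ennreal \<bar>integral ?B (\<lambda>z. integral (cbox 0 t) (?g z))\<bar>"
    by (simp only: kirchhoff_formula[OF t w box w0 w1 T(1), of x])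
  also have "\<dots> \<le> (\<integral>\<^sup>+z\<in>?B. ennreal \<bar>integral (cbox 0 t) (?g z)\<bar> \<partial>lborel)"
    by (intro ennreal_abs_integral_le integral_continuous_on_param cg)
  also have "\<dots> \<le> (\<integral>\<^sup>+z\<in>?B. (\<integral>\<^sup>+\<rho>\<in>cbox 0 t. Y \<rho> (fst z) \<partial>lborel) \<partial>lborel)"
  proof (rule nn_integral_mono)
    fix z
    show "ennreal \<bar>integral (cbox 0 t) (?g z)\<bar> * indicator ?B z \<le> (\<integral>\<^sup>+\<rho>\<in>cbox 0 t. Y \<rho> (fst z) \<partial>lborel) * indicator ?B z"
    proof (cases "z \<in> ?B")
      case True
      have "ennreal \<bar>integral (cbox 0 t) (?g z)\<bar> \<le> (\<integral>\<^sup>+\<rho>\<in>cbox 0 t. ennreal \<bar>?g z \<rho>\<bar> \<partial>lborel)"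
        by (rule ennreal_abs_integral_le[OF cg1])
      also have "\<dots> \<le> (\<integral>\<^sup>+\<rho>\<in>cbox 0 t. Y \<rho> (fst z) \<partial>lborel)"
        using gY[OF True] by (intro nn_integral_mono) (auto split: split_indicator)
      finally show ?thesis using True by simp
    qed simp
  qed
  also have "\<dots> = (\<integral>\<^sup>+z. (\<integral>\<^sup>+\<rho>. Y \<rho> (fst z) * indicator (cbox 0 t) \<rho> * indicator ?B z \<partial>lborel) \<partial>lborel)"
    by (intro nn_integral_cong nn_integral_multc[symmetric]) measurable
  also have "\<dots> = (\<integral>\<^sup>+\<rho>. (\<integral>\<^sup>+z. Y \<rho> (fst z) * indicator (cbox 0 t) \<rho> * indicator ?B z \<partial>lborel) \<partial>lborel)"
  proof (rule lborel_pair.Fubini')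
    have 1: "(\<lambda>p :: real \<times> real \<times> real. fst p) \<in> borel_measurable borel"
      and 2: "(\<lambda>p :: real \<times> real \<times> real. fst (snd p)) \<in> borel_measurable borel"
      by (intro borel_measurable_continuous_onI continuous_intros)+
    have "cbox 0 t \<times> ?B \<in> sets borel" by (intro borel_closed closed_Times closed_cbox)
    then have "(\<lambda>p. Y (fst p) (fst (snd p)) * indicator (cbox 0 t \<times> ?B) p) \<in> borel_measurable borel"
      by (intro borel_measurable_times_ennreal Y[OF 1 2] borel_measurable_indicator)
    then show "(\<lambda>(\<rho>, z). Y \<rho> (fst z) * indicator (cbox 0 t) \<rho> * indicator ?B z)
        \<in> borel_measurable (lborel \<Otimes>\<^sub>M lborel)"
      by (simp add: lborel_prod case_prod_unfold indicator_times mult.assoc)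
  qed
  also have "\<dots> = (\<integral>\<^sup>+\<rho>. (\<integral>\<^sup>+a. (\<integral>\<^sup>+b. Y \<rho> a * indicator (cbox 0 t) \<rho> * indicator {0..pi} a * indicator {0..2 * pi} b \<partial>lborel) \<partial>lborel) \<partial>lborel)"
  proof (rule nn_integral_cong)
    fix \<rho>
    let ?h = "\<lambda>z. Y \<rho> (fst z) * indicator (cbox 0 t) \<rho> * indicator ?B z"
    have "(\<integral>\<^sup>+z. ?h z \<partial>lborel) = (\<integral>\<^sup>+z. ?h z \<partial>(lborel \<Otimes>\<^sub>M lborel))"
      unfolding lborel_prod ..
    also have "\<dots> = (\<integral>\<^sup>+a. (\<integral>\<^sup>+b. ?h (a, b) \<partial>lborel) \<partial>lborel)"
    proof (rule lborel.nn_integral_fst[symmetric])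
      have 1: "(\<lambda>z :: real \<times> real. fst z) \<in> borel_measurable borel"
        by (intro borel_measurable_continuous_onI continuous_intros)
      have "?B \<in> sets borel" by (intro borel_closed closed_cbox)
      then have "?h \<in> borel_measurable borel"
        by (intro borel_measurable_times_ennreal Y 1 borel_measurable_const borel_measurable_indicator)
      then show "?h \<in> borel_measurable (lborel \<Otimes>\<^sub>M lborel)" by (simp add: lborel_prod)
    qed
    also have "\<dots> = (\<integral>\<^sup>+a. (\<integral>\<^sup>+b. Y \<rho> a * indicator (cbox 0 t) \<rho> * indicator {0..pi} a * indicator {0..2 * pi} b \<partial>lborel) \<partial>lborel)"
      by (intro nn_integral_cong) (auto simp: cbox_Pair_eq split: split_indicator)
    finally show "(\<integral>\<^sup>+z. ?h z \<partial>lborel) = \<dots>" .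
  qed
  also have "\<dots> = (\<integral>\<^sup>+\<rho>. (\<integral>\<^sup>+a. ennreal (2 * pi) * indicator (cbox 0 t) \<rho> * (Y \<rho> a * indicator {0..pi} a) \<partial>lborel) \<partial>lborel)"
    by (intro nn_integral_cong) (simp add: nn_integral_cmult ac_simps)
  also have "\<dots> = (\<integral>\<^sup>+\<rho>. ennreal (2 * pi) * indicator (cbox 0 t) \<rho> * (\<integral>\<^sup>+a\<in>{0..pi}. Y \<rho> a \<partial>lborel) \<partial>lborel)"
    by (intro nn_integral_cong nn_integral_cmult) measurable
  also have "\<dots> = (\<integral>\<^sup>+\<rho>. ennreal (2 * pi / ?r) * ((?W \<rho>) * indicator {0..t} \<rho>) \<partial>lborel)"
  proof (rule nn_integral_cong)
    fix \<rho>
    show "ennreal (2 * pi) * indicator (cbox 0 t) \<rho> * (\<integral>\<^sup>+a\<in>{0..pi}. Y \<rho> a \<partial>lborel) =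
       ennreal (2 * pi / ?r) * ((?W \<rho>) * indicator {0..t} \<rho>)"
    proof (cases "\<rho> \<in> {0..t}")
      case True
      have "(\<integral>\<^sup>+a\<in>{0..pi}. Y \<rho> a \<partial>lborel) = ennreal (1 / ?r) * (?W \<rho>)"
        unfolding Y_def using True r by (intro nn_integral_sphere_radial) auto
      moreover have "ennreal (2 * pi) * ennreal (1 / ?r) = ennreal (2 * pi / ?r)"
        using r by (subst ennreal_mult[symmetric]) auto
      ultimately show ?thesis using True by (simp add: mult.assoc[symmetric])
    qed simp
  qed
  also have "\<dots> = ennreal (2 * pi / ?r) * (\<integral>\<^sup>+\<rho>\<in>{0..t}. (?W \<rho>) \<partial>lborel)"
    by (rule nn_integral_cmult) measurable
  also have "(\<integral>\<^sup>+\<rho>\<in>{0..t}. (?W \<rho>) \<partial>lborel) = radial_wave t ?r H"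
  proof -
    let ?m = "\<lambda>\<rho>. (?W \<rho>) * indicator {0..t} \<rho>"
    have "(\<integral>\<^sup>+\<rho>. ?m \<rho> \<partial>lborel) = ennreal \<bar>- 1\<bar> * (\<integral>\<^sup>+s. ?m (t + (- 1) * s) \<partial>lborel)"
    proof (rule nn_integral_real_affine)
      have "(\<lambda>\<rho>. ?W \<rho>) \<in> borel_measurable borel"
        by measurable
      then show "?m \<in> borel_measurable borel"
        by (intro borel_measurable_times_ennreal borel_measurable_indicator) simp_all
    qed simp
    also have "\<dots> = (\<integral>\<^sup>+s. ?m (t - s) \<partial>lborel)" by simp
    also have "\<dots> = radial_wave t ?r H"
      unfolding radial_wave_def by (intro nn_integral_cong) (auto split: split_indicator)
    finally show ?thesis .
  qed
  finally have *: "ennreal (4 * pi * \<bar>w (t, x)\<bar>) \<le> ennreal (2 * pi / ?r) * radial_wave t ?r H" .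
  have "ennreal (1 / (2 * pi)) * ennreal (4 * pi * \<bar>w (t, x)\<bar>) \<le> ennreal (1 / (2 * pi)) * (ennreal (2 * pi / ?r) * radial_wave t ?r H)"
    by (rule mult_left_mono[OF *]) simp
  moreover have "ennreal (1 / (2 * pi)) * ennreal (4 * pi * \<bar>w (t, x)\<bar>) = ennreal (2 * \<bar>w (t, x)\<bar>)"
    by (subst ennreal_mult[symmetric]) auto
  moreover have "ennreal (1 / (2 * pi)) * ennreal (2 * pi / ?r) = ennreal (1 / ?r)"
    using r by (subst ennreal_mult[symmetric]) auto
  ultimately show ?thesis by (simp only: mult.assoc[symmetric])
qed

text \<open>
  Composing with this retraction onto \<open>{0..t}\<close> makes a function that is continuous on the strip
  continuous everywhere, and thus jointly measurable.
\<close>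

definition clamp_time :: "real \<Rightarrow> real \<Rightarrow> real" where
  "clamp_time t s = max 0 (min t s)"

text \<open>
  The integral is taken without the area density \<open>sin a\<close>, which on \<open>angles\<close> lies between \<open>1 / 2\<close>
  and \<open>1\<close>; so it is comparable to the integral over the part of the sphere that the chart covers.
\<close>

definition sphere_mean :: "real \<Rightarrow> (real \<times> real \<Rightarrow> real^3) \<Rightarrow> (spacetime \<Rightarrow> real) \<Rightarrow> real \<times> real \<Rightarrow> ennreal" where
  "sphere_mean t P h p = (\<integral>\<^sup>+z\<in>angles. ennreal \<bar>h (clamp_time t (fst p), snd p *\<^sub>R P z)\<bar> \<partial>lborel)"

lemma clamp_time_in_strip: "t > 0 \<Longrightarrow> clamp_time t s \<in> {0..t}" "s \<in> {0..t} \<Longrightarrow> clamp_time t s = s"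
  by (auto simp: clamp_time_def)

lemma measurable_sphere_integrand:
  fixes P :: "real \<times> real \<Rightarrow> real^3"
  assumes t: "t > 0" and h: "continuous_on (strip t) h" and P: "continuous_on UNIV P"
    and M: "f \<in> borel_measurable M" "g \<in> borel_measurable M" "k \<in> borel_measurable M"
  shows "(\<lambda>x. ennreal \<bar>h (clamp_time t (f x), g x *\<^sub>R P (k x))\<bar>) \<in> borel_measurable M"
proof -
  have "continuous_on UNIV (\<lambda>q. \<bar>h (clamp_time t (fst q), fst (snd q) *\<^sub>R P (snd (snd q)))\<bar>)"
    using clamp_time_in_strip(1)[OF t] unfolding clamp_time_def
    by (intro continuous_on_rabs continuous_on_strip_compose[OF h] continuous_on_max continuous_on_min continuous_on_const
        continuous_on_scaleR continuous_on_fst continuous_on_snd continuous_on_id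
        continuous_on_compose2[OF P]) auto
  then have c: "(\<lambda>q. \<bar>h (clamp_time t (fst q), fst (snd q) *\<^sub>R P (snd (snd q)))\<bar>) \<in> borel_measurable borel"
    by (rule borel_measurable_continuous_onI)
  have "(\<lambda>x. (f x, g x, k x)) \<in> borel_measurable M"
    using M by (intro borel_measurable_Pair)
  from measurable_compose[OF this c] show ?thesis by (simp add: measurable_compose[OF _ measurable_ennreal])
qed

lemma borel_measurable_sphere_mean:
  assumes t: "t > 0" and h: "continuous_on (strip t) h" and P: "continuous_on UNIV P"
  shows "sphere_mean t P h \<in> borel_measurable borel"
proof -
  have 1: "(\<lambda>q :: (real \<times> real) \<times> real \<times> real. fst (fst q)) \<in> borel_measurable borel"
     "(\<lambda>q :: (real \<times> real) \<times> real \<times> real. snd (fst q)) \<in> borel_measurable borel"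
     "(\<lambda>q :: (real \<times> real) \<times> real \<times> real. snd q) \<in> borel_measurable borel"
    by (intro borel_measurable_continuous_onI continuous_intros)+
  have "(UNIV :: (real \<times> real) set) \<times> angles \<in> sets borel"
    by (intro borel_Times borel_angles) simp
  then have "(\<lambda>q. ennreal \<bar>h (clamp_time t (fst (fst q)), snd (fst q) *\<^sub>R P (snd q))\<bar> * indicator (UNIV \<times> angles) q)
     \<in> borel_measurable (borel :: ((real \<times> real) \<times> real \<times> real) measure)"
    by (intro borel_measurable_times_ennreal measurable_sphere_integrand[OF t h P 1] borel_measurable_indicator)
  then have "(\<lambda>(p, z). ennreal \<bar>h (clamp_time t (fst p), snd p *\<^sub>R P z)\<bar> * indicator angles z)
     \<in> borel_measurable (lborel \<Otimes>\<^sub>M lborel)"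
    by (simp add: lborel_prod case_prod_unfold indicator_times)
  from lborel.borel_measurable_nn_integral[OF this] show ?thesis
    unfolding sphere_mean_def[abs_def] by simp
qed

definition weighted_norm :: "real \<Rightarrow> (spacetime \<Rightarrow> real) \<Rightarrow> ennreal" where
  "weighted_norm t h = (\<integral>\<^sup>+s\<in>{0..t}. (\<integral>\<^sup>+y. ennreal (\<bar>h (s, y)\<bar> / norm y) \<partial>lborel) \<partial>lborel)"

lemma radial_energy_sphere_mean_le:
  assumes t: "t > 0" and h: "continuous_on (strip t) h" and P: "P \<in> {polar3, polar1}"
  shows "radial_energy t (sphere_mean t P h) \<le> 2 * weighted_norm t h"
proof -
  let ?G = "\<lambda>s. \<integral>\<^sup>+y. ennreal (\<bar>h (clamp_time t s, y)\<bar> / norm y) \<partial>lborel"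
  let ?K = "\<lambda>s. \<integral>\<^sup>+y. ennreal (\<bar>h (s, y)\<bar> / norm y) \<partial>lborel"
  have "radial_energy t (sphere_mean t P h) \<le>
      (\<integral>\<^sup>+s\<in>{0..t}. 2 * (?K s) \<partial>lborel)"
    unfolding radial_energy_def
  proof (rule nn_integral_mono)
    fix s
    show "(\<integral>\<^sup>+v. sphere_mean t P h (s, v) * ennreal v \<partial>lborel) * indicator {0..t} s \<le>
       2 * (?K s) * indicator {0..t} s"
    proof (cases "s \<in> {0..t}")
      case True
      have "(\<lambda>y. h (s, y)) \<in> borel_measurable borel"
        by (intro borel_measurable_continuous_onI continuous_on_strip_compose[OF h] continuous_on_const continuous_on_id True)
      from nn_integral_polar_weight_le[OF P this] show ?thesis
        using True by (simp add: sphere_mean_def clamp_time_in_strip(2))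
    qed simp
  qed
  also have "\<dots> = 2 * weighted_norm t h"
  proof -
    have "(\<lambda>s. ?G s) \<in> borel_measurable lborel"
    proof (rule lborel.borel_measurable_nn_integral)
      have c: "continuous_on UNIV (\<lambda>q. \<bar>h (clamp_time t (fst q), snd q)\<bar>)"
        using clamp_time_in_strip(1)[OF t] unfolding clamp_time_def
        by (intro continuous_on_rabs continuous_on_strip_compose[OF h] continuous_on_max continuous_on_min continuous_on_const
            continuous_on_fst continuous_on_snd continuous_on_id) auto
      have n: "continuous_on UNIV (\<lambda>q :: spacetime. norm (snd q))" by (intro continuous_intros)
      have "(\<lambda>q. \<bar>h (clamp_time t (fst q), snd q)\<bar> / norm (snd q)) \<in> borel_measurable borel"
        by (intro borel_measurable_divide borel_measurable_continuous_onI c n)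
      then show "(\<lambda>(s, y). ennreal (\<bar>h (clamp_time t s, y)\<bar> / norm y)) \<in> borel_measurable (lborel \<Otimes>\<^sub>M lborel)"
        by (simp add: lborel_prod case_prod_unfold measurable_compose[OF _ measurable_ennreal])
    qed
    then have m: "(\<lambda>s. (?G s) * indicator {0..t} s) \<in> borel_measurable lborel"
      by (intro borel_measurable_times_ennreal borel_measurable_indicator) simp_all
    have "(\<integral>\<^sup>+s\<in>{0..t}. 2 * (?K s) \<partial>lborel) =
        (\<integral>\<^sup>+s. 2 * ((?G s) * indicator {0..t} s) \<partial>lborel)"
      by (intro nn_integral_cong) (auto simp: clamp_time_in_strip(2) mult.assoc split: split_indicator)
    also have "\<dots> = 2 * (\<integral>\<^sup>+s. ((?G s) * indicator {0..t} s) \<partial>lborel)"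
      by (rule nn_integral_cmult[OF m])
    also have "(\<integral>\<^sup>+s. ((?G s) * indicator {0..t} s) \<partial>lborel) = weighted_norm t h"
      unfolding weighted_norm_def by (intro nn_integral_cong) (auto simp: clamp_time_in_strip(2) split: split_indicator)
    finally show ?thesis .
  qed
  finally show ?thesis .
qed

text \<open>
  Along the ray \<open>l \<mapsto> (l * s, l *\<^sub>R y)\<close> the derivative of \<open>h\<close> is \<open>1 / l\<close> times the value of \<open>L h\<close>.
\<close>

lemma dilation_bound:
  assumes t: "t > 0" and h: "Ck_on 1 (strip t) h" and s: "s \<in> {0..t}"
  shows "ennreal \<bar>h (s, y)\<bar> \<le> (\<integral>\<^sup>+l\<in>{1/2..1}. 2 * (ennreal \<bar>h (l * s, l *\<^sub>R y)\<bar> +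
      ennreal \<bar>vf_deriv (strip t) L_scal h (l * s, l *\<^sub>R y)\<bar>) \<partial>lborel)"
proof -
  have h1: "Ck_on (Suc 0) (strip t) h" using h by simp
  have dh: "h differentiable_on strip t" using h1 by simp
  have cL: "continuous_on (strip t) (vf_deriv (strip t) L_scal h)"
    using Ck_on_L_scal[OF t h1] by simp
  let ?L = "\<lambda>l. vf_deriv (strip t) L_scal h (l * s, l *\<^sub>R y)"
  have ls: "l * s \<in> {0..t}" if "l \<in> {1/2..1}" for l
    using that s mult_left_le_one_le[of s l] by auto
  have "ennreal \<bar>h (1 * s, 1 *\<^sub>R y)\<bar> \<le> (\<integral>\<^sup>+l\<in>{1/2..1}. ennreal (\<bar>h (l * s, l *\<^sub>R y)\<bar> / (1 - 1 / 2) + \<bar>?L l / l\<bar>) \<partial>lborel)"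
  proof (rule abs_le_average_plus_derivative)
    show "continuous_on {1/2..1} (\<lambda>l. ?L l / l)"
      using ls by (intro continuous_on_divide continuous_on_strip_compose[OF cL] continuous_on_mult continuous_on_scaleR
          continuous_on_const continuous_on_id) auto
    fix l :: real assume l: "l \<in> {1/2..1}"
    have 1: "((\<lambda>l. l * s) has_real_derivative s) (at l within {1/2..1})"
      by (auto intro!: derivative_eq_intros)
    have 2: "((\<lambda>l. l *\<^sub>R y) has_vector_derivative y) (at l within {1/2..1})"
      by (auto intro!: derivative_eq_intros)
    have p: "(l * s, l *\<^sub>R y) \<in> strip t" using ls[OF l] by (simp add: strip_def)
    show "((\<lambda>l. h (l * s, l *\<^sub>R y)) has_real_derivative ?L l / l) (at l within {1/2..1})"
    proof (rule DERIV_cong[OF strip_chain_rule[OF dh 1 2 l ls]])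
      show "s * dt t h (l * s, l *\<^sub>R y) + (\<Sum>i\<in>UNIV. y $ i * dx t i h (l * s, l *\<^sub>R y)) = ?L l / l"
        using l unfolding vf_deriv_L_scal[OF dh p] by (simp add: sum_3 field_simps)
    qed
  qed auto
  also have "\<dots> \<le> (\<integral>\<^sup>+l\<in>{1/2..1}. 2 * (ennreal \<bar>h (l * s, l *\<^sub>R y)\<bar> + ennreal \<bar>?L l\<bar>) \<partial>lborel)"
  proof (rule nn_integral_mono)
    fix l :: real
    show "ennreal (\<bar>h (l * s, l *\<^sub>R y)\<bar> / (1 - 1 / 2) + \<bar>?L l / l\<bar>) * indicator {1/2..1} l \<le>
       2 * (ennreal \<bar>h (l * s, l *\<^sub>R y)\<bar> + ennreal \<bar>?L l\<bar>) * indicator {1/2..1} l"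
    proof (cases "l \<in> {1/2..1}")
      case True
      have "\<bar>?L l / l\<bar> \<le> \<bar>?L l\<bar> / (1 / 2)"
        unfolding abs_divide using True by (intro divide_left_mono) auto
      then have "\<bar>h (l * s, l *\<^sub>R y)\<bar> / (1 - 1 / 2) + \<bar>?L l / l\<bar> \<le> 2 * (\<bar>h (l * s, l *\<^sub>R y)\<bar> + \<bar>?L l\<bar>)" by simp
      then have "ennreal (\<bar>h (l * s, l *\<^sub>R y)\<bar> / (1 - 1 / 2) + \<bar>?L l / l\<bar>) \<le> ennreal (2 * (\<bar>h (l * s, l *\<^sub>R y)\<bar> + \<bar>?L l\<bar>))"
        by (rule ennreal_leI)
      also have "\<dots> = 2 * (ennreal \<bar>h (l * s, l *\<^sub>R y)\<bar> + ennreal \<bar>?L l\<bar>)"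
        by (subst ennreal_mult') auto
      finally show ?thesis using True by simp
    qed simp
  qed
  finally show ?thesis by simp
qed

lemma radial_translation_bound:
  assumes t: "t > 0" and h: "Ck_on 1 (strip t) h" and s: "s \<in> {0..t}" and \<theta>: "norm \<theta> = 1"
  shows "ennreal \<bar>h (s, v *\<^sub>R \<theta>)\<bar> \<le> (\<integral>\<^sup>+v'\<in>{v..v + 1}. ennreal \<bar>h (s, v' *\<^sub>R \<theta>)\<bar> +
      (\<Sum>i\<in>UNIV. ennreal \<bar>dx t i h (s, v' *\<^sub>R \<theta>)\<bar>) \<partial>lborel)"
proof -
  have h1: "Ck_on (Suc 0) (strip t) h" using h by simp
  have dh: "h differentiable_on strip t" using h1 by simp
  have cD: "continuous_on (strip t) (dx t i h)" for i
    using Ck_on_D_x[OF t h1] by simp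
  let ?D = "\<lambda>v. \<Sum>i\<in>UNIV. \<theta> $ i * dx t i h (s, v *\<^sub>R \<theta>)"
  have "ennreal \<bar>h (s, v *\<^sub>R \<theta>)\<bar> \<le> (\<integral>\<^sup>+v'\<in>{v..v + 1}. ennreal (\<bar>h (s, v' *\<^sub>R \<theta>)\<bar> / (v + 1 - v) + \<bar>?D v'\<bar>) \<partial>lborel)"
  proof (rule abs_le_average_plus_derivative)
    show "continuous_on {v..v + 1} ?D"
      by (intro continuous_on_sum continuous_on_mult continuous_on_const continuous_on_strip_compose[OF cD] continuous_on_scaleR
          continuous_on_id s)
    fix x assume x: "x \<in> {v..v + 1}"
    have 2: "((\<lambda>v. v *\<^sub>R \<theta>) has_vector_derivative \<theta>) (at x within {v..v + 1})"
      by (auto intro!: derivative_eq_intros)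
    show "((\<lambda>v. h (s, v *\<^sub>R \<theta>)) has_real_derivative ?D x) (at x within {v..v + 1})"
      by (rule DERIV_cong[OF strip_chain_rule[OF dh DERIV_const 2 x s]]) simp
  qed auto
  also have "\<dots> \<le> (\<integral>\<^sup>+v'\<in>{v..v + 1}. ennreal \<bar>h (s, v' *\<^sub>R \<theta>)\<bar> + (\<Sum>i\<in>UNIV. ennreal \<bar>dx t i h (s, v' *\<^sub>R \<theta>)\<bar>) \<partial>lborel)"
  proof (intro nn_integral_mono mult_right_mono)
    fix x
    have "\<bar>?D x\<bar> \<le> (\<Sum>i\<in>UNIV. \<bar>\<theta> $ i * dx t i h (s, x *\<^sub>R \<theta>)\<bar>)" by (rule sum_abs)
    also have "\<dots> \<le> (\<Sum>i\<in>UNIV. \<bar>dx t i h (s, x *\<^sub>R \<theta>)\<bar>)"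
      using component_le_norm_cart[of \<theta>] \<theta> by (intro sum_mono) (auto simp: abs_mult intro!: mult_left_le_one_le)
    finally have "\<bar>h (s, x *\<^sub>R \<theta>)\<bar> / (v + 1 - v) + \<bar>?D x\<bar> \<le> \<bar>h (s, x *\<^sub>R \<theta>)\<bar> + (\<Sum>i\<in>UNIV. \<bar>dx t i h (s, x *\<^sub>R \<theta>)\<bar>)" by simp
    from ennreal_leI[OF this]
    show "ennreal (\<bar>h (s, x *\<^sub>R \<theta>)\<bar> / (v + 1 - v) + \<bar>?D x\<bar>) \<le> ennreal \<bar>h (s, x *\<^sub>R \<theta>)\<bar> + (\<Sum>i\<in>UNIV. ennreal \<bar>dx t i h (s, x *\<^sub>R \<theta>)\<bar>)"
      by (simp add: sum_ennreal sum_nonneg)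
  qed simp
  finally show ?thesis .
qed

text \<open>
  The pointwise bounds along dilations and rays are linear, so they pass to spherical means, where
  \<open>radial_wave_decay\<close> applies. The factor is \<open>576 = 32 * 18\<close>: the means of \<open>h\<close> and of its derivatives
  enter 9 times, each with the constant 2 of the polar coordinate inequality.
\<close>

proposition sphere_mean_decay:
  assumes t: "t > 0" and h: "Ck_on 1 (strip t) h" and P: "P \<in> {polar3, polar1}" and r: "r > 0"
    and R: "weighted_norm t h \<le> R" "weighted_norm t (vf_deriv (strip t) L_scal h) \<le> R"
      "\<And>i. weighted_norm t (dx t i h) \<le> R"
  shows "ennreal (1 + t) * radial_wave t r (sphere_mean t P h) \<le> ennreal (576 * r) * R"
proof -
  have h1: "Ck_on (Suc 0) (strip t) h" using h by simp
  let ?L = "vf_deriv (strip t) L_scal h"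
  have ch: "continuous_on (strip t) h" by (rule Ck_on_imp_continuous[OF h])
  have cL: "continuous_on (strip t) ?L" using Ck_on_L_scal[OF t h1] by simp
  have cD: "continuous_on (strip t) (dx t i h)" for i using Ck_on_D_x[OF t h1] by simp
  have cP: "continuous_on UNIV P" using P continuous_on_polar by auto
  have nP: "norm (P z) = 1" for z using P norm_polar3[of z] norm_polar1[of z] by (metis insertE singletonD)
  let ?S = "sphere_mean t P"
  note msm = borel_measurable_sphere_mean[OF t _ cP]
  let ?k1 = "\<lambda>p. (?S h p + ?S ?L p) + (?S h p + ?S ?L p)"
  let ?k2 = "\<lambda>p. ?S h p + (\<Sum>i\<in>UNIV. ?S (dx t i h) p)"
  have m1: "(\<lambda>p. ?S h p + ?S ?L p) \<in> borel_measurable borel"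
    by (intro borel_measurable_add msm ch cL)
  have mk1: "?k1 \<in> borel_measurable borel" by (intro borel_measurable_add m1)
  have mD: "(\<lambda>p. \<Sum>i\<in>UNIV. ?S (dx t i h) p) \<in> borel_measurable borel"
    by (intro borel_measurable_sum msm cD)
  have mk2: "?k2 \<in> borel_measurable borel" by (intro borel_measurable_add mD msm ch)
  have mz: "(\<lambda>z. ennreal \<bar>g (clamp_time t s, v *\<^sub>R P z)\<bar> * indicator angles z) \<in> borel_measurable lborel"
    if "continuous_on (strip t) g" for g s v
    using measurable_sphere_integrand[OF t that cP, of "\<lambda>z. s" borel "\<lambda>z. v" "\<lambda>z. z"]
    by (intro borel_measurable_times_ennreal borel_measurable_indicator) simp_all
  have dil: "?S h (s, v) \<le> (\<integral>\<^sup>+l\<in>{1/2..1}. ?k1 (l * s, l * v) \<partial>lborel)"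
    if s: "0 \<le> s" "s \<le> t" and v: "0 \<le> v" for s v
  proof -
    let ?N = "\<lambda>z l. 2 * (ennreal \<bar>h (clamp_time t (l * s), (l * v) *\<^sub>R P z)\<bar> +
        ennreal \<bar>?L (clamp_time t (l * s), (l * v) *\<^sub>R P z)\<bar>)"
    have cl: "clamp_time t (l * s) = l * s" if "l \<in> {1/2..1}" for l
      using that s mult_left_le_one_le[of s l] by (intro clamp_time_in_strip) auto
    have "?S h (s, v) \<le> (\<integral>\<^sup>+z\<in>angles. (\<integral>\<^sup>+l\<in>{1/2..1}. ?N z l \<partial>lborel) \<partial>lborel)"
      unfolding sphere_mean_def
    proof (rule nn_integral_mono, rule mult_right_mono)
      fix z
      have "ennreal \<bar>h (clamp_time t (fst (s, v)), snd (s, v) *\<^sub>R P z)\<bar> = ennreal \<bar>h (s, v *\<^sub>R P z)\<bar>"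
        using s by (simp add: clamp_time_in_strip(2))
      also have "\<dots> \<le> (\<integral>\<^sup>+l\<in>{1/2..1}. 2 * (ennreal \<bar>h (l * s, l *\<^sub>R (v *\<^sub>R P z))\<bar> +
          ennreal \<bar>?L (l * s, l *\<^sub>R (v *\<^sub>R P z))\<bar>) \<partial>lborel)"
        by (rule dilation_bound[OF t h]) (use s in simp)
      also have "\<dots> = (\<integral>\<^sup>+l\<in>{1/2..1}. ?N z l \<partial>lborel)"
        by (intro nn_integral_cong) (simp add: cl split: split_indicator)
      finally show "ennreal \<bar>h (clamp_time t (fst (s, v)), snd (s, v) *\<^sub>R P z)\<bar> \<le> (\<integral>\<^sup>+l\<in>{1/2..1}. ?N z l \<partial>lborel)" .
    qed simp
    also have "\<dots> = (\<integral>\<^sup>+l\<in>{1/2..1}. (\<integral>\<^sup>+z\<in>angles. ?N z l \<partial>lborel) \<partial>lborel)"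
    proof (rule nn_integral_angles_swap)
      have q: "(\<lambda>q :: (real \<times> real) \<times> real. snd q * s) \<in> borel_measurable borel"
        "(\<lambda>q :: (real \<times> real) \<times> real. snd q * v) \<in> borel_measurable borel"
        "(\<lambda>q :: (real \<times> real) \<times> real. fst q) \<in> borel_measurable borel"
        by (intro borel_measurable_continuous_onI continuous_intros)+
      show "(\<lambda>q. ?N (fst q) (snd q)) \<in> borel_measurable borel"
        by (intro borel_measurable_times_ennreal borel_measurable_const borel_measurable_add
            measurable_sphere_integrand[OF t ch cP q] measurable_sphere_integrand[OF t cL cP q])
    qed simp
    also have "\<dots> = (\<integral>\<^sup>+l\<in>{1/2..1}. ?k1 (l * s, l * v) \<partial>lborel)"
    proof (rule nn_integral_cong, rule arg_cong2[where f = "(*)"])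
      fix l :: real
      let ?a = "\<lambda>z. ennreal \<bar>h (clamp_time t (l * s), (l * v) *\<^sub>R P z)\<bar> * indicator angles z"
      let ?b = "\<lambda>z. ennreal \<bar>?L (clamp_time t (l * s), (l * v) *\<^sub>R P z)\<bar> * indicator angles z"
      have "(\<integral>\<^sup>+z\<in>angles. ?N z l \<partial>lborel) = (\<integral>\<^sup>+z. (?a z + ?b z) + (?a z + ?b z) \<partial>lborel)"
        by (intro nn_integral_cong) (simp add: mult_2 distrib_right)
      also have "\<dots> = ((\<integral>\<^sup>+z. ?a z \<partial>lborel) + (\<integral>\<^sup>+z. ?b z \<partial>lborel)) + ((\<integral>\<^sup>+z. ?a z \<partial>lborel) + (\<integral>\<^sup>+z. ?b z \<partial>lborel))"
        by (simp only: nn_integral_add mz[OF ch] mz[OF cL] borel_measurable_add)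
      also have "\<dots> = ?k1 (l * s, l * v)" by (simp add: sphere_mean_def)
      finally show "(\<integral>\<^sup>+z\<in>angles. ?N z l \<partial>lborel) = ?k1 (l * s, l * v)" .
    qed simp
    finally show ?thesis .
  qed
  have tra: "?S h (s, v) \<le> (\<integral>\<^sup>+v'\<in>{v..v + 1}. ?k2 (s, v') \<partial>lborel)"
    if s: "0 \<le> s" "s \<le> t" and v: "0 \<le> v" for s v
  proof -
    let ?N = "\<lambda>z v'. ennreal \<bar>h (clamp_time t s, v' *\<^sub>R P z)\<bar> + (\<Sum>i\<in>UNIV. ennreal \<bar>dx t i h (clamp_time t s, v' *\<^sub>R P z)\<bar>)"
    have cs: "clamp_time t s = s" using s by (intro clamp_time_in_strip) auto
    have "?S h (s, v) \<le> (\<integral>\<^sup>+z\<in>angles. (\<integral>\<^sup>+v'\<in>{v..v + 1}. ?N z v' \<partial>lborel) \<partial>lborel)"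
      unfolding sphere_mean_def fst_conv snd_conv cs
      by (rule nn_integral_mono, rule mult_right_mono, rule radial_translation_bound[OF t h _ nP])
        (use s in auto)
    also have "\<dots> = (\<integral>\<^sup>+v'\<in>{v..v + 1}. (\<integral>\<^sup>+z\<in>angles. ?N z v' \<partial>lborel) \<partial>lborel)"
    proof (rule nn_integral_angles_swap)
      have q: "(\<lambda>q :: (real \<times> real) \<times> real. s) \<in> borel_measurable borel"
        "(\<lambda>q :: (real \<times> real) \<times> real. snd q) \<in> borel_measurable borel"
        "(\<lambda>q :: (real \<times> real) \<times> real. fst q) \<in> borel_measurable borel"
        by (intro borel_measurable_continuous_onI continuous_intros)+
      show "(\<lambda>q. ?N (fst q) (snd q)) \<in> borel_measurable borel"
        by (intro borel_measurable_add borel_measurable_sum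
            measurable_sphere_integrand[OF t ch cP q] measurable_sphere_integrand[OF t cD cP q])
    qed simp
    also have "\<dots> = (\<integral>\<^sup>+v'\<in>{v..v + 1}. ?k2 (s, v') \<partial>lborel)"
    proof (rule nn_integral_cong, rule arg_cong2[where f = "(*)"])
      fix v' :: real
      let ?a = "\<lambda>g z. ennreal \<bar>g (clamp_time t s, v' *\<^sub>R P z)\<bar> * indicator angles z"
      have "(\<integral>\<^sup>+z\<in>angles. ?N z v' \<partial>lborel) = (\<integral>\<^sup>+z. ?a h z + (\<Sum>i\<in>UNIV. ?a (dx t i h) z) \<partial>lborel)"
        by (intro nn_integral_cong) (simp add: distrib_right sum_distrib_right)
      also have "\<dots> = (\<integral>\<^sup>+z. ?a h z \<partial>lborel) + (\<Sum>i\<in>UNIV. \<integral>\<^sup>+z. ?a (dx t i h) z \<partial>lborel)"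
        by (simp only: nn_integral_add mz[OF ch] mz[OF cD] borel_measurable_sum nn_integral_sum)
      also have "\<dots> = ?k2 (s, v')" by (simp add: sphere_mean_def)
      finally show "(\<integral>\<^sup>+z\<in>angles. ?N z v' \<partial>lborel) = ?k2 (s, v')" .
    qed simp
    finally show ?thesis .
  qed
  have E: "radial_energy t (?S g) \<le> 2 * R" if "continuous_on (strip t) g" "weighted_norm t g \<le> R" for g
    using radial_energy_sphere_mean_le[OF t that(1) P] mult_left_mono[OF that(2), of 2] by (rule order_trans) simp
  have Eh: "radial_energy t (?S h) \<le> 2 * R" and EL: "radial_energy t (?S ?L) \<le> 2 * R"
    and ED: "\<And>i. radial_energy t (?S (dx t i h)) \<le> 2 * R"
    by (intro E ch cL cD R)+
  have E1: "radial_energy t ?k1 \<le> (2 * R + 2 * R) + (2 * R + 2 * R)"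
    unfolding radial_energy_add[OF m1 m1] radial_energy_add[OF msm[OF ch] msm[OF cL]]
    by (intro add_mono Eh EL)
  have E2: "radial_energy t ?k2 \<le> 2 * R + (2 * R + 2 * R + 2 * R)"
  proof -
    have "radial_energy t ?k2 = radial_energy t (?S h) + (\<Sum>i\<in>UNIV. radial_energy t (?S (dx t i h)))"
      unfolding radial_energy_add[OF msm[OF ch] mD]
      by (subst radial_energy_sum) (simp_all add: msm[OF cD])
    then show ?thesis unfolding sum_3 using Eh ED by (simp add: add_mono)
  qed
  have "ennreal (1 + t) * radial_wave t r (?S h) \<le>
      ennreal (32 * r) * (radial_energy t (?S h) + radial_energy t ?k1 + radial_energy t ?k2)"
    by (rule radial_wave_decay[OF msm[OF ch] mk1 mk2 t r dil tra])
  also have "\<dots> \<le> ennreal (32 * r) * (2 * R + ((2 * R + 2 * R) + (2 * R + 2 * R)) + (2 * R + (2 * R + 2 * R + 2 * R)))"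
    by (intro mult_left_mono add_mono Eh E1 E2) simp
  also have "\<dots> = ennreal (32 * r) * (18 * R)" by (simp add: distrib_right[symmetric])
  also have "\<dots> = ennreal (576 * r) * R"
  proof -
    have "ennreal (32 * r) * ennreal 18 = ennreal (576 * r)"
      using r by (subst ennreal_mult[symmetric]) auto
    then show ?thesis by (simp add: mult.assoc[symmetric])
  qed
  finally show ?thesis .
qed

section \<open>The weighted estimate\<close>

lemma angular_indices_cases:
  assumes "\<alpha> \<in> angular_indices"
  obtains a b c where "\<alpha> = [0,0,0,0,a,b,c]" "a + b + c \<le> 2"
  using assms unfolding angular_indices_def by auto

text \<open>
  In \<open>Z_fields\<close> the translations precede the rotations, so a translation applied after rotations is again
  a product in the prescribed order.
\<close>

lemma dx_Z_pow_angular: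
  assumes "\<alpha> \<in> angular_indices"
  obtains \<beta> where "(0, \<beta>) \<in> LZ_indices" "dx t i (Z_pow (strip t) \<alpha> f) = Z_pow (strip t) \<beta> f"
proof -
  from assms obtain a b c where \<alpha>: "\<alpha> = [0,0,0,0,a,b,c]" "a + b + c \<le> 2"
    by (rule angular_indices_cases)
  consider "i = 1" | "i = 2" | "i = 3" using exhaust_3[of i] by blast
  then show ?thesis
  proof cases
    case 1
    show ?thesis by (rule that[of "[0,1,0,0,a,b,c]"])
      (use \<alpha> 1 in \<open>auto simp: LZ_indices_def Z_pow_def Z_fields_def\<close>)
  next
    case 2
    show ?thesis by (rule that[of "[0,0,1,0,a,b,c]"])
      (use \<alpha> 2 in \<open>auto simp: LZ_indices_def Z_pow_def Z_fields_def\<close>)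
  next
    case 3
    show ?thesis by (rule that[of "[0,0,0,1,a,b,c]"])
      (use \<alpha> 3 in \<open>auto simp: LZ_indices_def Z_pow_def Z_fields_def\<close>)
  qed
qed

text \<open>
  There are two charts and seven multi-indices, whence \<open>8064 = 2 * 7 * 576\<close>.
\<close>

lemma wave_decay_away_from_origin:
  assumes t: "t > 0" and w: "Ck_on 5 (strip t) w" and box: "\<And>p. p \<in> strip t \<Longrightarrow> box_op (strip t) w p = F p"
    and w0: "\<And>y. w (0, y) = 0" and w1: "\<And>y. dt t w (0, y) = 0" and x: "x \<noteq> 0"
    and R: "\<And>j \<alpha>. (j, \<alpha>) \<in> LZ_indices \<Longrightarrow>
      weighted_norm t ((vf_deriv (strip t) L_scal ^^ j) (Z_pow (strip t) \<alpha> F)) \<le> R"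
  shows "ennreal ((1 + t) * \<bar>w (t, x)\<bar>) \<le> ennreal 8064 * R"
proof -
  have "Ck_on 3 (strip t) (box_op (strip t) w)"
    by (rule Ck_on_box_op[OF t]) (use w in \<open>simp add: numeral_eq_Suc\<close>)
  then have F3: "Ck_on 3 (strip t) F"
    using Ck_on_cong[of "strip t" "box_op (strip t) w" F 3] box by simp
  have F2: "Ck_on 2 (strip t) F" by (rule Ck_on_le[OF F3]) simp
  have F3': "Ck_on (Suc (Suc 1)) (strip t) F" using F3 by (simp add: numeral_eq_Suc)
  let ?Z = "\<lambda>\<alpha>. Z_pow (strip t) \<alpha> F"
  have CZ: "Ck_on 1 (strip t) (?Z \<alpha>)" if "\<alpha> \<in> angular_indices" for \<alpha>
    by (rule Ck_on_angular[OF t F3' that])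
  have mS: "sphere_mean t P (?Z \<alpha>) \<in> borel_measurable borel" if "P \<in> {polar3, polar1}" "\<alpha> \<in> angular_indices" for P \<alpha>
    using that continuous_on_polar
    by (intro borel_measurable_sphere_mean[OF t] Ck_on_imp_continuous[OF CZ]) auto
  define H where "H p = (\<Sum>P\<in>{polar3, polar1}. \<Sum>\<alpha>\<in>angular_indices. sphere_mean t P (?Z \<alpha>) p)" for p
  have H: "H \<in> borel_measurable borel"
    unfolding H_def[abs_def] by (intro borel_measurable_sum mS)
  let ?r = "norm x"
  have r: "?r > 0" using x by simp
  have dec: "ennreal (1 + t) * radial_wave t ?r (sphere_mean t P (?Z \<alpha>)) \<le> ennreal (576 * ?r) * R"
    if P: "P \<in> {polar3, polar1}" and \<alpha>: "\<alpha> \<in> angular_indices" for P \<alpha>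
  proof (rule sphere_mean_decay[OF t CZ[OF \<alpha>] P r])
    obtain a b c where abc: "\<alpha> = [0,0,0,0,a,b,c]" "a + b + c \<le> 2"
      using angular_indices_cases[OF \<alpha>] .
    then have "(0, \<alpha>) \<in> LZ_indices" "(1, \<alpha>) \<in> LZ_indices" by (auto simp: LZ_indices_def Z_fields_def)
    from R[OF this(1)] R[OF this(2)]
    show "weighted_norm t (?Z \<alpha>) \<le> R" "weighted_norm t (vf_deriv (strip t) L_scal (?Z \<alpha>)) \<le> R" by simp_all
    fix i
    obtain \<beta> where "(0, \<beta>) \<in> LZ_indices" "dx t i (?Z \<alpha>) = ?Z \<beta>"
      using dx_Z_pow_angular[OF \<alpha>] .
    with R[OF this(1)] show "weighted_norm t (dx t i (?Z \<alpha>)) \<le> R" by simp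
  qed
  have "radial_wave t ?r H = (\<Sum>P\<in>{polar3, polar1}. \<Sum>\<alpha>\<in>angular_indices. radial_wave t ?r (sphere_mean t P (?Z \<alpha>)))"
    unfolding H_def[abs_def]
    by (subst radial_wave_sum; (intro borel_measurable_sum mS sum.cong refl radial_wave_sum finite_angular_indices)?; simp?)
  then have "ennreal (1 + t) * radial_wave t ?r H =
      (\<Sum>P\<in>{polar3, polar1}. \<Sum>\<alpha>\<in>angular_indices. ennreal (1 + t) * radial_wave t ?r (sphere_mean t P (?Z \<alpha>)))"
    by (simp only: sum_distrib_left)
  also have "\<dots> \<le> (\<Sum>P\<in>{polar3, polar1}. \<Sum>\<alpha>\<in>angular_indices. ennreal (576 * ?r) * R)"
    by (intro sum_mono dec)
  also have "\<dots> = of_nat (card {polar3, polar1}) * (of_nat (card angular_indices) * (ennreal (576 * ?r) * R))"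
    by (simp only: sum_constant)
  also have "\<dots> \<le> 2 * (7 * (ennreal (576 * ?r) * R))"
  proof (intro mult_mono)
    have "card {polar3, polar1} \<le> 2" by (simp add: card_insert_if)
    then have "(of_nat (card {polar3, polar1}) :: ennreal) \<le> of_nat 2" by (rule of_nat_mono)
    then show "(of_nat (card {polar3, polar1}) :: ennreal) \<le> 2" by simp
    have "card angular_indices = 7" by (simp add: angular_indices_def)
    then show "(of_nat (card angular_indices) :: ennreal) \<le> 7" by simp
  qed auto
  finally have rw: "ennreal (1 + t) * radial_wave t ?r H \<le> 2 * (7 * (ennreal (576 * ?r) * R))" .
  have "ennreal ((1 + t) * \<bar>w (t, x)\<bar>) \<le> ennreal ((1 + t) * (2 * \<bar>w (t, x)\<bar>))"
    using t by (intro ennreal_leI mult_left_mono) auto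
  also have "\<dots> = ennreal (1 + t) * ennreal (2 * \<bar>w (t, x)\<bar>)"
    using t by (intro ennreal_mult) auto
  also have "\<dots> \<le> ennreal (1 + t) * (ennreal (1 / ?r) * radial_wave t ?r H)"
  proof (intro mult_left_mono wave_le_radial_wave[OF t _ box w0 w1 H _ x])
    show "Ck_on 2 (strip t) w" by (rule Ck_on_le[OF w]) simp
    fix s y assume s: "s \<in> {0..t}"
    show "ennreal \<bar>F (s, y)\<bar> \<le> H (s, norm y)"
      using sphere_sobolev[OF t F2 s, of y] by (simp only: H_def sphere_mean_def fst_conv snd_conv clamp_time_in_strip(2)[OF s])
  qed auto
  also have "\<dots> = ennreal (1 / ?r) * (ennreal (1 + t) * radial_wave t ?r H)" by (simp only: ac_simps)
  also have "\<dots> \<le> ennreal (1 / ?r) * (2 * (7 * (ennreal (576 * ?r) * R)))"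
    by (intro mult_left_mono rw) simp
  also have "\<dots> = ennreal 8064 * R"
  proof -
    have "ennreal (1 / ?r) * (ennreal 2 * (ennreal 7 * ennreal (576 * ?r))) = ennreal 8064"
    proof -
      have "ennreal (1 / ?r) * (ennreal 2 * (ennreal 7 * ennreal (576 * ?r))) = ennreal (1 / ?r) * ennreal (8064 * ?r)"
        using r by (simp add: ennreal_mult[symmetric] flip: ennreal_numeral)
      also have "\<dots> = ennreal 8064"
        using r by (subst ennreal_mult[symmetric]) auto
      finally show ?thesis .
    qed
    then show ?thesis by (simp add: mult.assoc[symmetric])
  qed
  finally show ?thesis .
qed

theorem proposition2p1:
  shows "\<exists>C::real. \<forall>t>0. \<forall>(w :: spacetime \<Rightarrow> real) (F :: spacetime \<Rightarrow> real).
    Ck_on 5 (strip t) w \<longrightarrow>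
    (\<forall>p\<in>strip t. box_op (strip t) w p = F p) \<longrightarrow>
    (\<forall>y. w (0, y) = 0 \<and> vf_deriv (strip t) D_t w (0, y) = 0) \<longrightarrow>
    (\<forall>x. ennreal ((1 + t) * \<bar>w (t, x)\<bar>) \<le>
       ennreal C * (\<integral>\<^sup>+s\<in>{0..t}. (\<integral>\<^sup>+y. ennreal
         ((\<Sum>(j, \<alpha>)\<in>LZ_indices.
             \<bar>(vf_deriv (strip t) L_scal ^^ j) (Z_pow (strip t) \<alpha> F) (s, y)\<bar>) / norm y)
         \<partial>lborel) \<partial>lborel))"
proof (rule exI[of _ 8064], intro allI impI)
  fix t :: real and w F :: "spacetime \<Rightarrow> real" and x :: "real^3"
  assume t: "t > 0" and w: "Ck_on 5 (strip t) w"
    and box: "\<forall>p\<in>strip t. box_op (strip t) w p = F p"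
    and data: "\<forall>y. w (0, y) = 0 \<and> vf_deriv (strip t) D_t w (0, y) = 0"
  define R where "R = (\<integral>\<^sup>+s\<in>{0..t}. (\<integral>\<^sup>+y. ennreal
         ((\<Sum>(j, \<alpha>)\<in>LZ_indices.
             \<bar>(vf_deriv (strip t) L_scal ^^ j) (Z_pow (strip t) \<alpha> F) (s, y)\<bar>) / norm y)
         \<partial>lborel) \<partial>lborel)"
  have R: "weighted_norm t ((vf_deriv (strip t) L_scal ^^ j) (Z_pow (strip t) \<alpha> F)) \<le> R"
    if "(j, \<alpha>) \<in> LZ_indices" for j \<alpha>
    unfolding weighted_norm_def R_def
  proof (rule nn_integral_mono, rule mult_right_mono, rule nn_integral_mono, rule ennreal_leI, rule divide_right_mono)
    fix s y
    show "\<bar>(vf_deriv (strip t) L_scal ^^ j) (Z_pow (strip t) \<alpha> F) (s, y)\<bar> \<le>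
      (\<Sum>(j, \<alpha>)\<in>LZ_indices. \<bar>(vf_deriv (strip t) L_scal ^^ j) (Z_pow (strip t) \<alpha> F) (s, y)\<bar>)"
      using member_le_sum[OF that, of "\<lambda>(j, \<alpha>). \<bar>(vf_deriv (strip t) L_scal ^^ j) (Z_pow (strip t) \<alpha> F) (s, y)\<bar>"]
        finite_LZ_indices by auto
  qed auto
  have away: "ennreal ((1 + t) * \<bar>w (t, x)\<bar>) \<le> ennreal 8064 * R" if "x \<noteq> 0" for x
    by (rule wave_decay_away_from_origin[OF t w _ _ _ that R]) (use box data in auto)
  have "ennreal ((1 + t) * \<bar>w (t, x)\<bar>) \<le> ennreal 8064 * R"
  \<comment> \<open>the bound does not depend on \<open>x\<close>, so it passes to the limit \<open>x = 0\<close>\<close>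
  proof (cases "x = 0 \<and> ennreal 8064 * R \<noteq> top")
    case True
    then obtain m where m: "0 \<le> m" "ennreal 8064 * R = ennreal m"
      by (cases "ennreal 8064 * R") auto
    have "continuous_on UNIV (\<lambda>x. (1 + t) * \<bar>w (t, x)\<bar>)"
      by (intro continuous_intros continuous_on_strip_compose[OF Ck_on_imp_continuous[OF w]])
        (use t in auto)
    then have "((\<lambda>x. (1 + t) * \<bar>w (t, x)\<bar>) \<longlongrightarrow> (1 + t) * \<bar>w (t, 0)\<bar>) (at 0)"
      by (simp add: continuous_on_def)
    moreover have "\<forall>\<^sub>F x in at 0. (1 + t) * \<bar>w (t, x)\<bar> \<le> m"
      unfolding eventually_at_filter using away m
      by (intro always_eventually) (auto simp: ennreal_le_iff)
    ultimately have "(1 + t) * \<bar>w (t, 0)\<bar> \<le> m"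
      by (rule tendsto_upperbound) simp
    then show ?thesis using True m by (simp add: ennreal_leI)
  next
    case False
    then show ?thesis using away[of x] by auto
  qed
  then show "ennreal ((1 + t) * \<bar>w (t, x)\<bar>) \<le> ennreal 8064 *
      (\<integral>\<^sup>+s\<in>{0..t}. (\<integral>\<^sup>+y. ennreal
         ((\<Sum>(j, \<alpha>)\<in>LZ_indices.
             \<bar>(vf_deriv (strip t) L_scal ^^ j) (Z_pow (strip t) \<alpha> F) (s, y)\<bar>) / norm y)
         \<partial>lborel) \<partial>lborel)"
    unfolding R_def .
qed

end
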